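(* Let $\phi\in\mathcal K_{R,S}$ be the true interaction kernel. Let $\{\mathcal L_n\}_{n\ge 1}$ be finite-dimensional linear subspaces of $C^{1,1}([0,R])$ for which there are constants $c_1,\gamma>0$ such that $\|\varphi'\|_\infty\le c_1(\dim\mathcal L_n)^\gamma\|\varphi\|_\infty$ for all $n$ and all $\varphi\in\mathcal L_n$, and suppose $$\inf_{\varphi\in\mathcal L_n}\|\varphi-\phi\|_\infty\longrightarrow 0\quad (n\to\infty).$$ Let $S_0\ge S$ and, for a sequence of positive integers $n_M$ with $n_M\to\infty$, $\dim(\mathcal L_{n_M})=n_M$ and $\lim_{M\to\infty}\frac{n_M\log n_M}{M}=0$, let $$\mathcal H_M=\{\varphi\in\mathcal L_{n_M}:\ \|\varphi\|_\infty\le 2S_0\}.$$ Suppose the coercivity condition holds on $\bigcup_n\mathcal L_n$ (with some constant $c>0$). Let $\widehat\phi_{T,M,\mathcal H_M}$ be a minimizer of $\mathcal E_{T,M}$ over $\mathcal H_M$. Then, with probability one, $$\lim_{M\to\infty}\big|\!\big|\!\big|\widehat\phi_{T,M,\mathcal H_M}-\phi\big|\!\big|\!\big|=0 .$$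
   Context: Fix integers $N\ge2$, $d\ge1$ and reals $\sigma,T,R,S>0$. For $\varphi:[0,\infty)\to\mathbb R$ define $\mathbf f_\varphi:\mathbb R^{dN}\to\mathbb R^{dN}$ by $(\mathbf f_\varphi(\mathbf x))_i=\frac1N\sum_{i'=1}^N\varphi(\|\mathbf x_{i'}-\mathbf x_i\|)(\mathbf x_{i'}-\mathbf x_i)$, $i=1,\dots,N$, where $\mathbf x=(\mathbf x_1,\dots,\mathbf x_N)$, $\mathbf x_i\in\mathbb R^d$. The observed system is $d\mathbf X_t=\mathbf f_\phi(\mathbf X_t)\,dt+\sigma\,d\mathbf B_t$ on $[0,T]$, with $\mathbf B$ a standard Brownian motion in $\mathbb R^{dN}$ and $\mathbf X_0\sim\mu_0$ independent of $\mathbf B$ with finite second moment; $\phi$ is the (true) interaction kernel. Write $\mathbf r_{ii'}(t)=\mathbf x_{i',t}-\mathbf x_{i,t}$ and $r_{ii'}(t)=\|\mathbf r_{ii'}(t)\|$. Admissible set: $\mathcal K_{R,S}=\{\varphi\in C^1(\mathbb R_+):\ \mathrm{supp}(\varphi)\subset[0,R],\ \|\varphi\|_\infty+\|\varphi'\|_\infty\le S\}$. $C^{1,1}([0,R])$ is the space of $C^1$ functions on $[0,R]$ with Lipschitz derivative. Functions on $[0,R]$ are regarded as functions on $\mathbb R_+$ by setting them to $0$ outside $[0,R]$. $\|\cdot\|_\infty$ is the sup norm. Measure and norm: $\rho_T(dr)=\frac{1}{\binom N2T}\int_0^T\sum_{1\le i<i'\le N}\mathbb E[\delta_{r_{ii'}(t)}(dr)]\,dt$,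 and $|\!|\!|\varphi|\!|\!|=\big(\int_{\mathbb R_+}|\varphi(r)r|^2\rho_T(dr)\big)^{1/2}$. Error functional: given $M$ independent copies $\mathbf X^{(1)},\dots,\mathbf X^{(M)}$ of the trajectory $\mathbf X_{[0,T]}$ (first $M$ members of an i.i.d. sequence), $\mathcal E_{T,M}(\varphi)=\frac1M\sum_{m=1}^M\mathcal E_{\mathbf X^{(m)}_{[0,T]}}(\varphi)$, where $\mathcal E_{\mathbf X_{[0,T]}}(\varphi)=\frac{1}{2\sigma^2TN}\Big(\int_0^T\|\mathbf f_\varphi(\mathbf X_t)\|^2dt-2\int_0^T\langle\mathbf f_\varphi(\mathbf X_t),d\mathbf X_t\rangle\Big)$. Coercivity condition on a set $\mathcal H$ of functions on $\mathbb R_+$ with constant $c_{\mathcal H}>0$: $c_{\mathcal H}|\!|\!|\varphi|\!|\!|^2\le\frac{1}{2\sigma^2NT}\int_0^T\sum_{i=1}^N\mathbb E\Big[\big\|\frac1N\sum_{i'=1}^N\varphi(r_{ii'}(t))\mathbf r_{ii'}(t)\big\|^2\Big]dt$ for all $\varphi\in\mathcal H$ with $|\!|\!|\varphi|\!|\!|<\infty$. *)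

theory Defs
  imports "HOL-Probability.Probability" "HOL-Library.Function_Algebras"
begin

text \<open>
  Particle configurations in \<open>\<real>\<^sup>d\<^sup>N\<close> are elements of \<^typ>\<open>real ^ 'd ^ 'n\<close> with \<open>d = CARD('d)\<close> and
  \<open>N = CARD('n)\<close>; the type \<open>'n\<close> carries a linear order so that the sum over \<open>i < i'\<close> in the
  definition of \<open>\<rho>\<^sub>T\<close> can be written down. A function on \<open>[0,\<infinity>)\<close> is a function of type
  \<^typ>\<open>real \<Rightarrow> real\<close> whose values at negative arguments are never used.
\<close>

section \<open>Function spaces\<close>

definition sup_norm_on :: "real set \<Rightarrow> (real \<Rightarrow> real) \<Rightarrow> real"
  where "sup_norm_on A g = (SUP x\<in>A. \<bar>g x\<bar>)"

text \<open>Derivative relative to a nondegenerate interval (one-sided at its end points).\<close>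

definition deriv_on :: "real set \<Rightarrow> (real \<Rightarrow> real) \<Rightarrow> real \<Rightarrow> real"
  where "deriv_on A g x = vector_derivative g (at x within A)"

definition admissible_kernels :: "real \<Rightarrow> real \<Rightarrow> (real \<Rightarrow> real) set"
  where "admissible_kernels R S =
    {\<phi>. \<phi> differentiable_on {0..} \<and> continuous_on {0..} (deriv_on {0..} \<phi>) \<and>
        closure {r\<in>{0..}. \<phi> r \<noteq> 0} \<subseteq> {0..R} \<and>
        sup_norm_on {0..} \<phi> + sup_norm_on {0..} (deriv_on {0..} \<phi>) \<le> S}"

text \<open>\<open>C\<^sup>1\<^sup>,\<^sup>1([0,R])\<close>, its elements being extended by \<open>0\<close> (possibly with a jump at \<open>R\<close>).\<close>

definition C11 :: "real \<Rightarrow> (real \<Rightarrow> real) set"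
  where "C11 R =
    {\<phi>. \<phi> differentiable_on {0..R} \<and> (\<exists>K. K-lipschitz_on {0..R} (deriv_on {0..R} \<phi>)) \<and>
        (\<forall>r. r \<notin> {0..R} \<longrightarrow> \<phi> r = 0)}"

global_interpretation funspace: vector_space "\<lambda>(c::real) (f::real \<Rightarrow> real) x. c * f x"
  by unfold_locales (auto simp: fun_eq_iff algebra_simps)

definition finite_dim_subspace :: "(real \<Rightarrow> real) set \<Rightarrow> bool"
  where "finite_dim_subspace V \<longleftrightarrow>
    funspace.subspace V \<and> (\<exists>B. finite B \<and> V = funspace.span B)"


section \<open>The interacting particle system\<close>

definition interaction :: "(real \<Rightarrow> real) \<Rightarrow> real ^ 'd ^ 'n \<Rightarrow> real ^ 'd ^ 'n"
  where "interaction \<phi> x =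
    (\<chi> i. (1 / real CARD('n)) *\<^sub>R
           (\<Sum>i'\<in>UNIV. \<phi> (norm (x $ i' - x $ i)) *\<^sub>R (x $ i' - x $ i)))"

text \<open>The trajectory on \<open>[0,T]\<close> as a random element of the space of functions on \<open>[0,T]\<close>, with the
  product \<open>\<sigma>\<close>-algebra.\<close>

definition trajectory :: "real \<Rightarrow> (real \<Rightarrow> 'w \<Rightarrow> 'e) \<Rightarrow> 'w \<Rightarrow> real \<Rightarrow> 'e"
  where "trajectory T X \<omega> = (\<lambda>t\<in>{0..T}. X t \<omega>)"

abbreviation path_space :: "real \<Rightarrow> (real \<Rightarrow> 'e::euclidean_space) measure"
  where "path_space T \<equiv> \<Pi>\<^sub>M t\<in>{0..T}. borel"

definition continuous_process :: "'w measure \<Rightarrow> real \<Rightarrow> (real \<Rightarrow> 'w \<Rightarrow> 'e::euclidean_space) \<Rightarrow> bool"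
  where "continuous_process P T X \<longleftrightarrow>
    (\<forall>t\<in>{0..T}. X t \<in> borel_measurable P) \<and>
    (\<forall>\<omega>\<in>space P. continuous_on {0..T} (\<lambda>t. X t \<omega>))"

definition brownian_motion :: "'w measure \<Rightarrow> real \<Rightarrow> (real \<Rightarrow> 'w \<Rightarrow> 'e::euclidean_space) \<Rightarrow> bool"
  where "brownian_motion P T B \<longleftrightarrow>
    continuous_process P T B \<and>
    (AE \<omega> in P. B 0 \<omega> = 0) \<and>
    (\<forall>(k::nat) ts. (\<forall>j\<le>k. ts j \<in> {0..T}) \<and> (\<forall>j<k. ts j < ts (Suc j)) \<longrightarrow>
       prob_space.indep_vars P (\<lambda>_. borel) (\<lambda>j \<omega>. B (ts (Suc j)) \<omega> - B (ts j) \<omega>) {..<k}) \<and>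
    (\<forall>s t. 0 \<le> s \<and> s < t \<and> t \<le> T \<longrightarrow>
       prob_space.indep_vars P (\<lambda>_. borel) (\<lambda>b \<omega>. (B t \<omega> - B s \<omega>) \<bullet> b) Basis \<and>
       (\<forall>b\<in>Basis. distributed P lborel (\<lambda>\<omega>. (B t \<omega> - B s \<omega>) \<bullet> b)
          (\<lambda>x. ennreal (normal_density 0 (sqrt (t - s)) x))))"

definition observed_system ::
    "'w measure \<Rightarrow> (real \<Rightarrow> real) \<Rightarrow> real \<Rightarrow> real \<Rightarrow> (real ^ 'd ^ 'n) measure
      \<Rightarrow> (real \<Rightarrow> 'w \<Rightarrow> real ^ 'd ^ 'n) \<Rightarrow> (real \<Rightarrow> 'w \<Rightarrow> real ^ 'd ^ 'n) \<Rightarrow> bool"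
  where "observed_system P \<phi> \<sigma> T \<mu>0 X B \<longleftrightarrow>
    prob_space P \<and> continuous_process P T X \<and> brownian_motion P T B \<and>
    distr P borel (X 0) = \<mu>0 \<and> integrable \<mu>0 (\<lambda>x. (norm x)\<^sup>2) \<and>
    prob_space.indep_set P (sets (vimage_algebra (space P) (X 0) borel))
      (sets (vimage_algebra (space P) (trajectory T B) (path_space T))) \<and>
    (AE \<omega> in P. \<forall>t\<in>{0..T}.
       X t \<omega> = X 0 \<omega> + (LBINT s:{0..t}. interaction \<phi> (X s \<omega>)) + \<sigma> *\<^sub>R B t \<omega>)"

text \<open>An i.i.d. sequence of copies of the (continuous) trajectory \<open>X\<close>.\<close>

definition iid_copies ::
    "'w measure \<Rightarrow> real \<Rightarrow> (real \<Rightarrow> 'w \<Rightarrow> 'e::euclidean_space) \<Rightarrow> 'v measure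
      \<Rightarrow> (nat \<Rightarrow> real \<Rightarrow> 'v \<Rightarrow> 'e) \<Rightarrow> bool"
  where "iid_copies P T X Q Xs \<longleftrightarrow>
    prob_space Q \<and> (\<forall>m. continuous_process Q T (Xs m)) \<and>
    prob_space.indep_vars Q (\<lambda>_. path_space T) (\<lambda>m. trajectory T (Xs m)) UNIV \<and>
    (\<forall>m. distr Q (path_space T) (trajectory T (Xs m)) = distr P (path_space T) (trajectory T X))"


section \<open>The measure, the norm and the coercivity condition\<close>

definition rho ::
    "'w measure \<Rightarrow> real \<Rightarrow> (real \<Rightarrow> 'w \<Rightarrow> real ^ 'd ^ 'n::{finite,linorder}) \<Rightarrow> real measure"
  where "rho P T X = measure_of UNIV (sets borel)
    (\<lambda>A. ennreal (1 / (real (CARD('n) choose 2) * T)) *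
         (\<integral>\<^sup>+t\<in>{0..T}. (\<Sum>(i, i')\<in>{(i, i'). i < i'}.
            emeasure P {\<omega>\<in>space P. norm (X t \<omega> $ i' - X t \<omega> $ i) \<in> A}) \<partial>lborel))"

lemma continuous_process_pair_measurable:
  fixes X :: "real \<Rightarrow> 'w \<Rightarrow> 'e::euclidean_space"
  assumes "continuous_process P T X" "T > 0"
  shows "(\<lambda>(t, \<omega>). X (max 0 (min T t)) \<omega>) \<in> borel_measurable (lborel \<Otimes>\<^sub>M P)"
proof -
  define clamp where "clamp = (\<lambda>t::real. max 0 (min T t))"
  have c01: "clamp t \<in> {0..T}" for t using assms(2) by (auto simp: clamp_def)
  have meas[measurable]: "X (clamp t) \<in> borel_measurable P" for t
    using assms(1) c01 by (auto simp: continuous_process_def)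
  define Y where "Y = (\<lambda>(n::nat) z. X (clamp (of_int \<lfloor>real (Suc n) * fst z\<rfloor> / real (Suc n))) (snd z))"
  have Ym: "Y n \<in> borel_measurable (lborel \<Otimes>\<^sub>M P)" for n
    unfolding Y_def
    by (rule measurable_compose_countable
        [where f = "\<lambda>(k::int) z. X (clamp (of_int k / real (Suc n))) (snd z)"]) measurable
  have lim: "(\<lambda>n. Y n z) \<longlonglongrightarrow> X (clamp (fst z)) (snd z)" if z: "z \<in> space (lborel \<Otimes>\<^sub>M P)" for z
  proof -
    let ?s = "\<lambda>n::nat. of_int \<lfloor>real (Suc n) * fst z\<rfloor> / real (Suc n)"
    have "?s \<longlonglongrightarrow> fst z"
    proof (rule tendsto_sandwich[where f = "\<lambda>n. fst z - 1 / real (Suc n)" and h = "\<lambda>_. fst z"])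
      show "\<forall>\<^sub>F n in sequentially. fst z - 1 / real (Suc n) \<le> ?s n"
      proof (intro always_eventually allI)
        fix n :: nat
        have "real (Suc n) * fst z - 1 \<le> of_int \<lfloor>real (Suc n) * fst z\<rfloor>" by linarith
        hence "(real (Suc n) * fst z - 1) / real (Suc n) \<le> ?s n"
          by (intro divide_right_mono) auto
        thus "fst z - 1 / real (Suc n) \<le> ?s n" by (simp add: diff_divide_distrib)
      qed
      show "\<forall>\<^sub>F n in sequentially. ?s n \<le> fst z"
      proof (intro always_eventually allI)
        fix n :: nat
        have "?s n \<le> real (Suc n) * fst z / real (Suc n)"
          by (intro divide_right_mono) auto
        thus "?s n \<le> fst z" by simp
      qed
      show "(\<lambda>n. fst z - 1 / real (Suc n)) \<longlonglongrightarrow> fst z"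
        using tendsto_diff[OF tendsto_const LIMSEQ_inverse_real_of_nat, of "fst z"]
        by (simp add: inverse_eq_divide)
    qed simp
    hence 1: "(\<lambda>n. clamp (?s n)) \<longlonglongrightarrow> clamp (fst z)"
      unfolding clamp_def by (intro tendsto_intros)
    have "continuous_on {0..T} (\<lambda>t. X t (snd z))"
      using z assms(1) by (auto simp: continuous_process_def space_pair_measure)
    from continuous_on_tendsto_compose[OF this 1 c01] show ?thesis
      using c01 by (simp add: Y_def)
  qed
  have "(\<lambda>z. X (clamp (fst z)) (snd z)) \<in> borel_measurable (lborel \<Otimes>\<^sub>M P)"
    by (rule borel_measurable_LIMSEQ_metric[OF Ym lim])
  thus ?thesis by (simp add: clamp_def case_prod_beta')
qed

lemma sets_rho [simp]: "sets (rho P T X) = sets borel"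
  and space_rho [simp]: "space (rho P T X) = UNIV"
  using sets.sigma_sets_eq[of "borel :: real measure"] by (simp_all add: rho_def)

text \<open>The set function used in the definition of \<open>\<rho>\<^sub>T\<close> is indeed a measure.\<close>

lemma emeasure_rho:
  fixes X :: "real \<Rightarrow> 'w \<Rightarrow> real ^ 'd ^ 'n::{finite,linorder}"
  assumes "prob_space P" and X: "continuous_process P T X" and T: "T > 0" and A: "A \<in> sets borel"
  shows "emeasure (rho P T X) A = ennreal (1 / (real (CARD('n) choose 2) * T)) *
         (\<integral>\<^sup>+t\<in>{0..T}. (\<Sum>(i, i')\<in>{(i, i'). i < i'}.
            emeasure P {\<omega>\<in>space P. norm (X t \<omega> $ i' - X t \<omega> $ i) \<in> A}) \<partial>lborel)"
proof -
  interpret prob_space P by fact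
  let ?V = "\<lambda>t i i' A. {\<omega>\<in>space P. norm (X t \<omega> $ i' - X t \<omega> $ i) \<in> A}"
  define g where "g = (\<lambda>A t. (\<Sum>(i, i')\<in>{(i, i'). i < i'}. emeasure P (?V t i i' A)) * indicator {0..T} t)"
  have meas: "g A \<in> borel_measurable lborel" if [measurable]: "A \<in> sets borel" for A
  proof -
    note [measurable] = continuous_process_pair_measurable[OF X T, unfolded case_prod_beta']
    have [measurable]: "(\<lambda>x::real ^ 'd ^ ('n::{finite,linorder}). x $ i) \<in> borel_measurable borel" for i
      by (intro borel_measurable_continuous_onI continuous_intros)
    have 1: "Measurable.pred (lborel \<Otimes>\<^sub>M P)
        (\<lambda>z. norm (X (max 0 (min T (fst z))) (snd z) $ i' - X (max 0 (min T (fst z))) (snd z) $ i) \<in> A)" for i i'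
      by measurable
    have 2: "(\<lambda>t. emeasure P (?V (max 0 (min T t)) i i' A)) \<in> borel_measurable lborel" for i i'
      using 1[of i' i] unfolding pred_def
      by (intro measurable_emeasure)
        (auto elim!: back_subst[where P = "\<lambda>A. A \<in> sets _"] simp: space_pair_measure)
    have "(\<lambda>t. (\<Sum>(i, i')\<in>{(i, i'). i < i'}. emeasure P (?V (max 0 (min T t)) i i' A)) * indicator {0..T} t)
        \<in> borel_measurable lborel"
      using 2 by (auto simp: case_prod_beta')
    also have "(\<lambda>t. (\<Sum>(i, i')\<in>{(i, i'). i < i'}. emeasure P (?V (max 0 (min T t)) i i' A)) * indicator {0..T} t) = g A"
      by (auto simp: g_def fun_eq_iff indicator_def)
    finally show ?thesis .
  qed
  have V: "?V t i i' A \<in> sets P" if "t \<in> {0..T}" "A \<in> sets borel" for t i i' A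
  proof -
    have [measurable]: "X t \<in> borel_measurable P" "A \<in> sets borel"
      using X that by (auto simp: continuous_process_def)
    have [measurable]: "(\<lambda>x::real ^ 'd ^ ('n::{finite,linorder}). x $ i) \<in> borel_measurable borel" for i
      by (intro borel_measurable_continuous_onI continuous_intros)
    show ?thesis by measurable
  qed
  let ?\<mu> = "\<lambda>A. ennreal (1 / (real (CARD('n) choose 2) * T)) * (\<integral>\<^sup>+t. g A t \<partial>lborel)"
  have "emeasure (rho P T X) A = ?\<mu> A"
  proof (rule emeasure_measure_of[where \<Omega> = UNIV and A = "sets borel"])
    show "rho P T X = measure_of UNIV (sets borel) ?\<mu>" by (simp add: rho_def g_def)
    show "A \<in> sets (rho P T X)" using A by simp
    show "positive (sets (rho P T X)) ?\<mu>" by (simp add: positive_def g_def)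
    show "countably_additive (sets (rho P T X)) ?\<mu>"
    proof (rule countably_additiveI)
      fix F :: "nat \<Rightarrow> real set"
      assume F: "range F \<subseteq> sets (rho P T X)" "disjoint_family F"
      hence F': "F n \<in> sets borel" for n by auto
      have eq: "g (\<Union>n. F n) t = (\<Sum>n. g (F n) t)" for t
      proof (cases "t \<in> {0..T}")
        case True
        have "emeasure P (?V t i i' (\<Union>n. F n)) = (\<Sum>n. emeasure P (?V t i i' (F n)))" for i i'
        proof -
          have "(\<Sum>n. emeasure P (?V t i i' (F n))) = emeasure P (\<Union>n. ?V t i i' (F n))"
            using V[OF True F'] F(2)
            by (intro suminf_emeasure) (auto simp: disjoint_family_on_def disjoint_iff)
          also have "(\<Union>n. ?V t i i' (F n)) = ?V t i i' (\<Union>n. F n)" by auto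
          finally show ?thesis by simp
        qed
        thus ?thesis using True
          by (simp add: g_def case_prod_beta' suminf_sum)
      qed (simp add: g_def)
      have "(\<Sum>n. ?\<mu> (F n)) = ennreal (1 / (real (CARD('n) choose 2) * T)) * (\<Sum>n. \<integral>\<^sup>+t. g (F n) t \<partial>lborel)"
        by simp
      also have "(\<Sum>n. \<integral>\<^sup>+t. g (F n) t \<partial>lborel) = (\<integral>\<^sup>+t. g (\<Union>n. F n) t \<partial>lborel)"
        unfolding eq using meas[OF F'] by (rule nn_integral_suminf[symmetric])
      finally show "(\<Sum>n. ?\<mu> (F n)) = ?\<mu> (\<Union>n. F n)" .
    qed
  qed auto
  thus ?thesis by (simp add: g_def)
qed

definition rho_norm_finite :: "real measure \<Rightarrow> (real \<Rightarrow> real) \<Rightarrow> bool"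
  where "rho_norm_finite \<rho> \<phi> \<longleftrightarrow> set_integrable \<rho> {0..} (\<lambda>r. \<bar>\<phi> r * r\<bar>\<^sup>2)"

definition rho_norm :: "real measure \<Rightarrow> (real \<Rightarrow> real) \<Rightarrow> real"
  where "rho_norm \<rho> \<phi> = sqrt (LINT r:{0..}|\<rho>. \<bar>\<phi> r * r\<bar>\<^sup>2)"

definition coercive ::
    "'w measure \<Rightarrow> real \<Rightarrow> real \<Rightarrow> (real \<Rightarrow> 'w \<Rightarrow> real ^ 'd ^ 'n::{finite,linorder})
      \<Rightarrow> (real \<Rightarrow> real) set \<Rightarrow> real \<Rightarrow> bool"
  where "coercive P \<sigma> T X \<H> c \<longleftrightarrow>
    c > 0 \<and>
    (\<forall>\<phi>\<in>\<H>. rho_norm_finite (rho P T X) \<phi> \<longrightarrow>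
      c * (rho_norm (rho P T X) \<phi>)\<^sup>2 \<le>
        1 / (2 * \<sigma>\<^sup>2 * real CARD('n) * T) *
        (LBINT t:{0..T}. \<Sum>i\<in>UNIV. LINT \<omega>|P. (norm (interaction \<phi> (X t \<omega>) $ i))\<^sup>2))"


section \<open>Stochastic integrals\<close>

definition natural_filtration ::
    "'w measure \<Rightarrow> (real \<Rightarrow> 'w \<Rightarrow> 'e::euclidean_space) \<Rightarrow> real \<Rightarrow> 'w measure"
  where "natural_filtration P Z t =
    vimage_algebra (space P) (trajectory t Z) (path_space t)"

text \<open>A simple integrand \<open>\<Sum>\<^sub>j\<^sub><\<^sub>k \<xi>\<^sub>j 1\<^bsub>(t\<^sub>j, t\<^sub>j\<^sub>+\<^sub>1]\<^esub>\<close> with bounded coefficients \<open>\<xi>\<^sub>j\<close>, each depending on the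
  past of \<open>Z\<close> up to time \<open>t\<^sub>j\<close>.\<close>

definition simple_integrand ::
    "'w measure \<Rightarrow> real \<Rightarrow> (real \<Rightarrow> 'w \<Rightarrow> 'e::euclidean_space)
      \<Rightarrow> nat \<Rightarrow> (nat \<Rightarrow> real) \<Rightarrow> (nat \<Rightarrow> 'w \<Rightarrow> 'e) \<Rightarrow> bool"
  where "simple_integrand P T Z k ts \<xi> \<longleftrightarrow>
    (\<forall>j\<le>k. ts j \<in> {0..T}) \<and> (\<forall>j<k. ts j < ts (Suc j)) \<and>
    (\<forall>j<k. \<xi> j \<in> borel_measurable (natural_filtration P Z (ts j)) \<and>
           (\<exists>C. \<forall>\<omega>\<in>space P. norm (\<xi> j \<omega>) \<le> C))"

definition simple_process ::
    "nat \<Rightarrow> (nat \<Rightarrow> real) \<Rightarrow> (nat \<Rightarrow> 'w \<Rightarrow> 'e::euclidean_space) \<Rightarrow> real \<Rightarrow> 'w \<Rightarrow> 'e"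
  where "simple_process k ts \<xi> t \<omega> = (\<Sum>j<k. indicator {ts j<..ts (Suc j)} t *\<^sub>R \<xi> j \<omega>)"

definition simple_integral ::
    "nat \<Rightarrow> (nat \<Rightarrow> real) \<Rightarrow> (nat \<Rightarrow> 'w \<Rightarrow> 'e::euclidean_space) \<Rightarrow> (real \<Rightarrow> 'w \<Rightarrow> 'e)
      \<Rightarrow> 'w \<Rightarrow> real"
  where "simple_integral k ts \<xi> Z \<omega> = (\<Sum>j<k. \<xi> j \<omega> \<bullet> (Z (ts (Suc j)) \<omega> - Z (ts j) \<omega>))"

text \<open>
  \<open>I\<close> is a version of the Ito integral \<open>\<integral>\<^sub>0\<^sup>T \<langle>H\<^sub>t, dZ\<^sub>t\<rangle>\<close>, in the \<open>L\<^sup>2\<close> theory: simple integrands converge to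
  \<open>H\<close> in \<open>L\<^sup>2(dt \<otimes> P)\<close> and their integrals converge to \<open>I\<close> in \<open>L\<^sup>2(P)\<close>. It is used for
  \<open>dZ\<^sub>t = b\<^sub>t dt + \<sigma> dB\<^sub>t\<close> with bounded drift \<open>b\<close> and Brownian \<open>B\<close>; integration against \<open>Z\<close> of simple integrands
  is then bounded from \<open>L\<^sup>2(dt \<otimes> P)\<close> to \<open>L\<^sup>2(P)\<close>, so that \<open>I\<close> is determined by \<open>H\<close> up to null sets and
  equals \<open>\<integral>\<^sub>0\<^sup>T \<langle>H\<^sub>t, b\<^sub>t\<rangle> dt + \<sigma> \<integral>\<^sub>0\<^sup>T \<langle>H\<^sub>t, dB\<^sub>t\<rangle>\<close>.
\<close>

definition has_ito_integral ::
    "'w measure \<Rightarrow> real \<Rightarrow> (real \<Rightarrow> 'w \<Rightarrow> 'e::euclidean_space) \<Rightarrow> (real \<Rightarrow> 'w \<Rightarrow> 'e)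
      \<Rightarrow> ('w \<Rightarrow> real) \<Rightarrow> bool"
  where "has_ito_integral P T Z H I \<longleftrightarrow>
    I \<in> borel_measurable P \<and>
    (\<exists>k ts \<xi>.
      (\<forall>n::nat. simple_integrand P T Z (k n) (ts n) (\<xi> n)) \<and>
      (\<lambda>n. \<integral>\<^sup>+\<omega>. (\<integral>\<^sup>+t\<in>{0..T}.
          ennreal ((norm (simple_process (k n) (ts n) (\<xi> n) t \<omega> - H t \<omega>))\<^sup>2) \<partial>lborel) \<partial>P)
        \<longlonglongrightarrow> 0 \<and>
      (\<lambda>n. \<integral>\<^sup>+\<omega>. ennreal ((simple_integral (k n) (ts n) (\<xi> n) Z \<omega> - I \<omega>)\<^sup>2) \<partial>P)
        \<longlonglongrightarrow> 0)"

text \<open>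
  The error functional is defined through stochastic integrals, which for each single \<open>\<phi>\<close> are only
  determined up to a null set depending on \<open>\<phi>\<close>. To speak of minimizers over a set of functions one
  has to fix the integrals for all \<open>\<phi>\<close> simultaneously: \<open>J \<phi>\<close> is a version of
  \<open>\<integral>\<^sub>0\<^sup>T \<langle>\<^bold>f\<^sub>\<phi>(X\<^sub>t), dX\<^sub>t\<rangle>\<close> for every \<open>\<phi>\<close> in \<open>V\<close>, and almost surely \<open>\<phi> \<mapsto> J \<phi>\<close> is linear on \<open>V\<close>.
  On a finite-dimensional \<open>V\<close> any two such families agree on \<open>V\<close> outside a single null set.
\<close>

definition interaction_integrals ::
    "'w measure \<Rightarrow> real \<Rightarrow> (real \<Rightarrow> 'w \<Rightarrow> real ^ 'd ^ 'n) \<Rightarrow> (real \<Rightarrow> real) set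
      \<Rightarrow> ((real \<Rightarrow> real) \<Rightarrow> 'w \<Rightarrow> real) \<Rightarrow> bool"
  where "interaction_integrals P T X V J \<longleftrightarrow>
    (\<forall>\<phi>\<in>V. has_ito_integral P T X (\<lambda>t \<omega>. interaction \<phi> (X t \<omega>)) (J \<phi>)) \<and>
    (AE \<omega> in P. \<forall>\<phi>\<in>V. \<forall>\<psi>\<in>V. \<forall>a b.
       J (\<lambda>r. a * \<phi> r + b * \<psi> r) \<omega> = a * J \<phi> \<omega> + b * J \<psi> \<omega>)"


section \<open>The error functional\<close>

definition path_error ::
    "real \<Rightarrow> real \<Rightarrow> (real \<Rightarrow> 'w \<Rightarrow> real ^ 'd ^ 'n) \<Rightarrow> ((real \<Rightarrow> real) \<Rightarrow> 'w \<Rightarrow> real)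
      \<Rightarrow> (real \<Rightarrow> real) \<Rightarrow> 'w \<Rightarrow> real"
  where "path_error \<sigma> T X J \<phi> \<omega> =
    1 / (2 * \<sigma>\<^sup>2 * T * real CARD('n)) *
    ((LBINT t:{0..T}. (norm (interaction \<phi> (X t \<omega>)))\<^sup>2) - 2 * J \<phi> \<omega>)"

definition empirical_error ::
    "real \<Rightarrow> real \<Rightarrow> (nat \<Rightarrow> real \<Rightarrow> 'w \<Rightarrow> real ^ 'd ^ 'n)
      \<Rightarrow> (nat \<Rightarrow> (real \<Rightarrow> real) \<Rightarrow> 'w \<Rightarrow> real) \<Rightarrow> nat \<Rightarrow> (real \<Rightarrow> real) \<Rightarrow> 'w \<Rightarrow> real"
  where "empirical_error \<sigma> T Xs J M \<phi> \<omega> =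
    1 / real M * (\<Sum>m<M. path_error \<sigma> T (Xs m) (J m) \<phi> \<omega>)"

definition hypothesis_space :: "(nat \<Rightarrow> (real \<Rightarrow> real) set) \<Rightarrow> (nat \<Rightarrow> nat) \<Rightarrow> real \<Rightarrow> nat \<Rightarrow> (real \<Rightarrow> real) set"
  where "hypothesis_space L nM S0 M = {\<phi>\<in>L (nM M). sup_norm_on {0..} \<phi> \<le> 2 * S0}"

end

theory Submission
  imports Defs
begin

text \<open>
  Write \<open>E(h) = \<integral>\<^sub>0\<^sup>T |f\<^sub>h(X)|\<^sup>2 dt\<close> and \<open>N(h) = \<integral>\<^sub>0\<^sup>T \<langle>f\<^sub>h(X), dX\<rangle> - \<integral>\<^sub>0\<^sup>T \<langle>f\<^sub>h(X), f\<^sub>\<phi>(X)\<rangle> dt\<close>, with empirical means \<open>E\<^sub>M\<close>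
  and \<open>N\<^sub>M\<close>. Completing the square, minimality of the estimator \<open>\<psi>\<close> against a best approximation
  \<open>\<psi>\<^sub>0\<close> of \<open>\<phi>\<close> reads \<open>E\<^sub>M(\<psi> - \<phi>) \<le> E\<^sub>M(\<psi>\<^sub>0 - \<phi>) + 2 N\<^sub>M(\<psi> - \<psi>\<^sub>0)\<close>, so by coercivity it suffices that on
  balls of \<open>L\<^sub>n\<close>, uniformly, \<open>N\<^sub>M\<close> is small and \<open>E\<^sub>M\<close> is close to its mean. For a single function both
  follow with probability exponentially close to \<open>1\<close> in \<open>M\<close>: from Hoeffding's inequality for \<open>E\<^sub>M\<close>, and for
  \<open>N\<^sub>M\<close> from the exponential martingale of the stochastic integral. A ball of \<open>L\<^sub>n\<close> has a net of
  at most \<open>A\<^sup>n\<close> elements, and \<open>n\<^sub>M / M \<rightarrow> 0\<close> makes the sum of the exceptional probabilities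
  finite, so that the Borel-Cantelli lemma applies.

  The martingale property with respect to the filtration of \<open>X\<close> requires that \<open>X\<close> up to time \<open>s\<close> is
  independent of the later increments of \<open>B\<close>. This holds since the drift is Lipschitz, so that \<open>X\<close>
  is the limit of its Euler schemes.
\<close>

section \<open>Kernels and interactions\<close>

text \<open>Three obstacles shape the argument. The stochastic integral \<open>J m h\<close> is
  given only through versions, without any continuity in \<open>h\<close>; the noise is therefore
  extended from a net to a ball by linearity alone, at the price of a factor 2, while the energy, a
  pathwise integral, is Lipschitz in the sup norm on balls. The number of net points must be at most
  \<open>A ^ n\<close> with \<open>A\<close> independent of the space, although the spaces are
  abstract and come without a good basis; this is obtained from digit expansions and not from
  volumes. Finally, the copies live on another probability space and carry no Brownian motion, so
  everything drawn from the equation is condensed into a property of the law of one path.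

  The estimator depends on the sample, hence the probabilistic estimates must hold for all kernels
  of a ball at once. Since \<open>\<phi>\<close> need not lie in any of the spaces, coercivity and
  the uniform estimates are applied to the difference of the estimator and an approximant, which
  stays in the space and has sup norm at most \<open>4 * S0\<close>.\<close>

definition kernels :: "real \<Rightarrow> real \<Rightarrow> (real \<Rightarrow> real) set"
  where "kernels R K = {g. g \<in> borel_measurable borel \<and> (\<forall>r. \<bar>g r\<bar> \<le> K) \<and> (\<forall>r>R. g r = 0)}"

lemma kernelsD:
  assumes "g \<in> kernels R K"
  shows "g \<in> borel_measurable borel" "\<bar>g r\<bar> \<le> K" "r > R \<Longrightarrow> g r = 0"
  using assms by (auto simp: kernels_def)

lemma kernels_scale: "g \<in> kernels R K \<Longrightarrow> (\<lambda>r. a * g r) \<in> kernels R (\<bar>a\<bar> * K)"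
  by (auto simp: kernels_def abs_mult intro!: mult_left_mono)

lemma kernels_diff:
  assumes "g \<in> kernels R K" "h \<in> kernels R K'"
  shows "(\<lambda>r. g r - h r) \<in> kernels R (K + K')"
proof -
  have "\<bar>g r - h r\<bar> \<le> K + K'" for r
    using kernelsD(2)[OF assms(1), of r] kernelsD(2)[OF assms(2), of r] by linarith
  then show ?thesis using assms by (auto simp: kernels_def)
qed

lemma kernel_times_id_bound:
  assumes "g \<in> kernels R K" "R \<ge> 0" "r \<ge> 0"
  shows "\<bar>g r * r\<bar> \<le> K * R"
proof (cases "r > R")
  case True
  have "0 \<le> K" using kernelsD(2)[OF assms(1), of r] by linarith
  then show ?thesis using kernelsD(3)[OF assms(1) True] assms by simp
next
  case False
  have "0 \<le> K" using kernelsD(2)[OF assms(1), of r] by linarith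
  then show ?thesis using kernelsD(2)[OF assms(1), of r] False assms
    by (auto simp: abs_mult intro!: mult_mono)
qed

lemma sup_norm_on_upper:
  assumes "bdd_above ((\<lambda>x. \<bar>g x\<bar>) ` A)" "x \<in> A"
  shows "\<bar>g x\<bar> \<le> sup_norm_on A g"
  unfolding sup_norm_on_def using assms by (intro cSUP_upper)

lemma sup_norm_on_least:
  assumes "A \<noteq> {}" "\<And>x. x \<in> A \<Longrightarrow> \<bar>g x\<bar> \<le> K"
  shows "sup_norm_on A g \<le> K"
  unfolding sup_norm_on_def using assms by (intro cSUP_least)

lemma C11_continuous: "g \<in> C11 R \<Longrightarrow> continuous_on {0..R} g"
  by (auto simp: C11_def intro: differentiable_imp_continuous_on)

lemma C11_outside: "g \<in> C11 R \<Longrightarrow> r \<notin> {0..R} \<Longrightarrow> g r = 0"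
  by (auto simp: C11_def)

lemma C11_bounded:
  assumes "g \<in> C11 R"
  obtains K where "\<And>r. \<bar>g r\<bar> \<le> K"
proof -
  have "compact (g ` {0..R})"
    by (intro compact_continuous_image C11_continuous assms) auto
  then have "\<exists>K. \<forall>x\<in>{0..R}. \<bar>g x\<bar> \<le> K"
    by (auto dest!: compact_imp_bounded simp: bounded_iff)
  then obtain K where K: "\<And>x. x \<in> {0..R} \<Longrightarrow> \<bar>g x\<bar> \<le> K" by blast
  have "\<bar>g r\<bar> \<le> max K 0" for r
    using K[of r] C11_outside[OF assms, of r] by (cases "r \<in> {0..R}") auto
  then show ?thesis using that by blast
qed

lemma C11_borel:
  assumes "g \<in> C11 R"
  shows "g \<in> borel_measurable borel"
proof -
  have "(\<lambda>x. if x \<in> {0..R} then g x else 0) \<in> borel_measurable borel"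
    by (rule borel_measurable_continuous_on_if) (auto intro: C11_continuous[OF assms])
  also have "(\<lambda>x. if x \<in> {0..R} then g x else 0) = g"
    using C11_outside[OF assms] by auto
  finally show ?thesis .
qed

lemma C11_kernelI:
  assumes "g \<in> C11 R" "\<And>r. r \<ge> 0 \<Longrightarrow> \<bar>g r\<bar> \<le> K"
  shows "g \<in> kernels R K"
proof -
  have "0 \<le> K" using assms(2)[of 0] by auto
  then have "\<bar>g r\<bar> \<le> K" for r
    using assms(2)[of r] C11_outside[OF assms(1), of r] by (cases "r \<ge> 0") auto
  then show ?thesis
    using C11_borel[OF assms(1)] C11_outside[OF assms(1)] by (auto simp: kernels_def)
qed

lemma C11_kernel:
  assumes "g \<in> C11 R"
  obtains K where "g \<in> kernels R K"
  using C11_bounded[OF assms] C11_kernelI[OF assms] by metis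

lemma C11_sup_norm_kernel:
  assumes "g \<in> C11 R" "sup_norm_on {0..} g \<le> K"
  shows "g \<in> kernels R K"
proof (rule C11_kernelI[OF assms(1)])
  fix r :: real assume "r \<ge> 0"
  obtain K' where "\<And>r. \<bar>g r\<bar> \<le> K'" using C11_bounded[OF assms(1)] by blast
  then have "bdd_above ((\<lambda>x. \<bar>g x\<bar>) ` {0..})" by (auto intro!: bdd_aboveI)
  from sup_norm_on_upper[OF this, of r] show "\<bar>g r\<bar> \<le> K" using \<open>r \<ge> 0\<close> assms(2) by auto
qed

text \<open>Membership in \<open>kernels\<close> bounds a function on the whole line, while an
  admissible kernel is constrained on the half line only. Resetting the values at negative arguments
  does not affect interactions, which evaluate kernels at norms.\<close>

definition clip :: "(real \<Rightarrow> real) \<Rightarrow> real \<Rightarrow> real"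
  where "clip g r = (if r < 0 then 0 else g r)"

text \<open>A supremum over an unbounded set carries no information. The support condition is
  therefore used first, to make the kernel and its derivative vanish beyond \<open>R\<close> and so
  be bounded; then the bound \<open>S\<close> on the two sup norms becomes pointwise, and the
  Lipschitz estimate is the mean value inequality.\<close>

lemma admissible_kernel:
  assumes \<phi>: "\<phi> \<in> admissible_kernels R S" and R: "R > 0"
  shows "clip \<phi> \<in> kernels R S"
    and "\<And>a b. a \<ge> 0 \<Longrightarrow> b \<ge> 0 \<Longrightarrow> \<bar>\<phi> a - \<phi> b\<bar> \<le> S * \<bar>a - b\<bar>"
proof -
  let ?d = "deriv_on {0..} \<phi>"
  have diff: "\<phi> differentiable_on {0..}" and cd: "continuous_on {0..} ?d"
    and supp: "closure {r\<in>{0..}. \<phi> r \<noteq> 0} \<subseteq> {0..R}"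
    and le: "sup_norm_on {0..} \<phi> + sup_norm_on {0..} ?d \<le> S"
    using \<phi> by (auto simp: admissible_kernels_def)
  have zero: "\<phi> r = 0" if "r > R" for r
    using subsetD[OF supp subsetD[OF closure_subset], of r] that R by auto
  have cont: "continuous_on {0..} \<phi>" using diff by (rule differentiable_imp_continuous_on)
  have der: "(\<phi> has_vector_derivative ?d x) (at x within {0..})" if "x \<ge> 0" for x
    unfolding deriv_on_def using diff that
    by (auto simp: differentiable_on_def vector_derivative_works)
  have dzero: "?d r = 0" if r: "r > R" for r
  proof -
    have "(\<phi> has_vector_derivative ?d r) (at r within {R<..})"
      using der[of r] by (rule has_vector_derivative_within_subset) (use r R in auto)
    moreover have "((\<lambda>_. 0) has_vector_derivative ?d r) (at r within {R<..}) \<longleftrightarrow>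
       (\<phi> has_vector_derivative ?d r) (at r within {R<..})"
      by (rule has_vector_derivative_cong_ev) (use zero r in auto)
    ultimately have "((\<lambda>_. 0) has_vector_derivative ?d r) (at r within {R<..})" by blast
    then have "((\<lambda>_. 0::real) has_vector_derivative ?d r) (at r)"
      using r by (subst (asm) at_within_open) auto
    from vector_derivative_unique_at[OF this, of 0] show ?thesis by auto
  qed
  have bdd: "bdd_above ((\<lambda>x. \<bar>f x\<bar>) ` {0..})"
    if c: "continuous_on {0..} f" and z: "\<And>r. r > R \<Longrightarrow> f r = 0" for f :: "real \<Rightarrow> real"
  proof -
    have "continuous_on {0..R} f" using c by (rule continuous_on_subset) auto
    then have "compact (f ` {0..R})" by (intro compact_continuous_image) auto
    then have "\<exists>K. \<forall>x\<in>{0..R}. \<bar>f x\<bar> \<le> K"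
      by (auto dest!: compact_imp_bounded simp: bounded_iff)
    then obtain K where K: "\<And>x. x \<in> {0..R} \<Longrightarrow> \<bar>f x\<bar> \<le> K" by blast
    have "\<bar>f x\<bar> \<le> max K 0" if "x \<ge> 0" for x
      using K[of x] z[of x] that by (cases "x > R") auto
    then show ?thesis by (auto intro!: bdd_aboveI)
  qed
  note b1 = bdd[OF cont zero] and b2 = bdd[OF cd dzero]
  have pos: "0 \<le> sup_norm_on {0..} \<phi>" "0 \<le> sup_norm_on {0..} ?d"
    using sup_norm_on_upper[OF b1, of 0] sup_norm_on_upper[OF b2, of 0] by auto
  have bnd: "\<bar>\<phi> r\<bar> \<le> S" "\<bar>?d r\<bar> \<le> S" if "r \<ge> 0" for r
    using sup_norm_on_upper[OF b1, of r] sup_norm_on_upper[OF b2, of r] pos le that by auto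
  have S0: "0 \<le> S" using bnd(1)[of 0] by auto
  have "(\<lambda>r. if r \<in> {0..} then \<phi> r else 0) \<in> borel_measurable borel"
    by (rule borel_measurable_continuous_on_if) (auto intro: cont)
  also have "(\<lambda>r. if r \<in> {0..} then \<phi> r else 0) = clip \<phi>"
    by (simp add: clip_def fun_eq_iff)
  finally show "clip \<phi> \<in> kernels R S"
    using bnd zero S0 R by (simp add: kernels_def) (simp add: clip_def)
  show "\<bar>\<phi> a - \<phi> b\<bar> \<le> S * \<bar>a - b\<bar>" if "a \<ge> 0" "b \<ge> 0" for a b
  proof -
    have "norm (\<phi> a - \<phi> b) \<le> S * norm (a - b)"
    proof (rule field_differentiable_bound[where S = "{0..}" and f' = ?d])
      show "(\<phi> has_field_derivative ?d x) (at x within {0..})" if "x \<in> {0..}" for x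
        using der[of x] that by (simp add: has_real_derivative_iff_has_vector_derivative)
    qed (use bnd that in auto)
    then show ?thesis by simp
  qed
qed

section \<open>Bounds, linearity and Lipschitz continuity of the interaction field\<close>

lemma interaction_nth:
  "interaction g x $ i = (1 / real CARD('n)) *\<^sub>R
     (\<Sum>i'\<in>UNIV. g (norm (x $ i' - x $ i)) *\<^sub>R (x $ i' - x $ i))"
  for x :: "real ^ 'd ^ 'n"
  by (simp add: interaction_def)

lemma interaction_cong:
  "(\<And>r. r \<ge> 0 \<Longrightarrow> g r = h r) \<Longrightarrow> interaction g x = interaction h x"
  by (simp add: interaction_def)

lemma interaction_clip: "interaction (clip g) = interaction g"
  by (intro ext interaction_cong) (simp add: clip_def)

lemma interaction_lincomb:
  "interaction (\<lambda>r. a * g r + b * h r) x = a *\<^sub>R interaction g x + b *\<^sub>R interaction h x"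
  by (simp add: vec_eq_iff interaction_nth scaleR_add_left sum.distrib scaleR_add_right
      scaleR_sum_right mult.commute mult.left_commute)

lemma interaction_diff:
  "interaction (\<lambda>r. g r - h r) x = interaction g x - interaction h x"
  using interaction_lincomb[of 1 g "-1" h x] by simp

lemma interaction_nth_bound:
  fixes x :: "real ^ 'd ^ 'n"
  assumes g: "g \<in> kernels R K" and R: "R \<ge> 0"
  shows "norm (interaction g x $ i) \<le> K * R"
proof -
  have "norm (\<Sum>i'\<in>UNIV. g (norm (x $ i' - x $ i)) *\<^sub>R (x $ i' - x $ i)) \<le> (\<Sum>i'\<in>(UNIV::'n set). K * R)"
    using kernel_times_id_bound[OF g R] by (intro sum_norm_le) (auto simp: abs_mult)
  also have "\<dots> = real CARD('n) * (K * R)" by simp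
  finally show ?thesis by (simp add: interaction_nth field_simps)
qed

lemma norm_vec_squared: "(norm (x :: real ^ 'd ^ 'n))\<^sup>2 = (\<Sum>i\<in>UNIV. (norm (x $ i))\<^sup>2)"
  by (simp add: norm_vec_def L2_set_def sum_nonneg)

lemma interaction_norm_squared_bound:
  fixes x :: "real ^ 'd ^ 'n"
  assumes g: "g \<in> kernels R K" and R: "R \<ge> 0"
  shows "(norm (interaction g x))\<^sup>2 \<le> real CARD('n) * (K * R)\<^sup>2"
proof -
  have "(norm (interaction g x))\<^sup>2 \<le> (\<Sum>i\<in>(UNIV::'n set). (K * R)\<^sup>2)"
    unfolding norm_vec_squared by (intro sum_mono power_mono interaction_nth_bound[OF g R]) auto
  then show ?thesis by simp
qed

lemma interaction_norm_bound:
  fixes x :: "real ^ 'd ^ 'n"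
  assumes g: "g \<in> kernels R K" and R: "R \<ge> 0"
  shows "norm (interaction g x) \<le> real CARD('n) * (K * R)"
proof -
  have "norm (interaction g x) \<le> (\<Sum>i\<in>(UNIV::'n set). norm (interaction g x $ i))"
    by (simp add: norm_vec_def L2_set_le_sum)
  also have "\<dots> \<le> (\<Sum>i\<in>(UNIV::'n set). K * R)"
    by (intro sum_mono interaction_nth_bound[OF g R])
  finally show ?thesis by simp
qed

lemma borel_measurable_vec_nth [measurable]:
  "(\<lambda>x::real ^ 'd ^ 'n. x $ i) \<in> borel_measurable borel"
  by (intro borel_measurable_continuous_onI continuous_intros)

lemma borel_measurable_interaction:
  assumes [measurable]: "g \<in> borel_measurable borel"
  shows "interaction g \<in> borel_measurable (borel :: (real ^ 'd ^ 'n) measure)"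
proof (subst borel_measurable_euclidean_space, intro ballI)
  fix u :: "real ^ 'd ^ 'n" assume "u \<in> Basis"
  then obtain i v where u: "u = axis i v" by (auto simp: Basis_vec_def)
  show "(\<lambda>x. interaction g x \<bullet> u) \<in> borel_measurable borel"
    unfolding u inner_axis interaction_nth by measurable
qed

text \<open>It suffices to treat the map \<open>H\<close>, sending \<open>v\<close> to
  \<open>\<phi> (norm v) *\<^sub>R v\<close>. The difference is split so that the increment of
  \<open>\<phi>\<close> multiplies the shorter vector \<open>w\<close>: either
  \<open>norm w \<le> R\<close>, which gives the constant \<open>S * (1 + R)\<close>, or both values
  vanish. The factor 2 comes from the pair differences, the number of particles from summing the
  components.\<close>

lemma interaction_lipschitz:
  assumes \<phi>: "\<phi> \<in> admissible_kernels R S" and R: "R > 0"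
  shows "norm (interaction \<phi> x - interaction \<phi> y)
     \<le> 2 * real CARD('n) * (S * (1 + R)) * norm (x - y :: real ^ 'd ^ 'n)"
proof -
  note k = admissible_kernel[OF assms]
  have bnd: "\<bar>\<phi> r\<bar> \<le> S" if "r \<ge> 0" for r
    using kernelsD(2)[OF k(1), of r] that by (simp add: clip_def)
  have S0: "0 \<le> S" using bnd[of 0] by auto
  define H where "H v = \<phi> (norm v) *\<^sub>R v" for v :: "real ^ 'd"
  have H1: "norm (H v - H w) \<le> S * (1 + R) * norm (v - w)" if vw: "norm w \<le> norm v" for v w
  proof (cases "norm w > R")
    case True
    then have "\<phi> (norm w) = 0" "\<phi> (norm v) = 0"
      using kernelsD(3)[OF k(1), of "norm w"] kernelsD(3)[OF k(1), of "norm v"] vw by (auto simp: clip_def)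
    then show ?thesis using S0 R by (simp add: H_def)
  next
    case False
    have "H v - H w = \<phi> (norm v) *\<^sub>R (v - w) + (\<phi> (norm v) - \<phi> (norm w)) *\<^sub>R w"
      by (simp add: H_def algebra_simps)
    also have "norm \<dots> \<le> \<bar>\<phi> (norm v)\<bar> * norm (v - w) + \<bar>\<phi> (norm v) - \<phi> (norm w)\<bar> * norm w"
      by (intro norm_triangle_le add_mono) auto
    also have "\<dots> \<le> S * norm (v - w) + (S * norm (v - w)) * R"
    proof (intro add_mono mult_mono bnd)
      have "\<bar>\<phi> (norm v) - \<phi> (norm w)\<bar> \<le> S * \<bar>norm v - norm w\<bar>" by (intro k(2)) auto
      also have "\<dots> \<le> S * norm (v - w)" using S0 norm_triangle_ineq3 by (intro mult_left_mono) auto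
      finally show "\<bar>\<phi> (norm v) - \<phi> (norm w)\<bar> \<le> S * norm (v - w)" .
    qed (use False S0 in auto)
    finally show ?thesis by (simp add: algebra_simps)
  qed
  have H: "norm (H v - H w) \<le> S * (1 + R) * norm (v - w)" for v w
    using H1[of v w] H1[of w v] by (cases "norm w \<le> norm v") (auto simp: norm_minus_commute)
  have comp: "norm (interaction \<phi> x $ i - interaction \<phi> y $ i) \<le> 2 * (S * (1 + R)) * norm (x - y)" for i
  proof -
    have "interaction \<phi> x $ i - interaction \<phi> y $ i =
      (1 / real CARD('n)) *\<^sub>R (\<Sum>i'\<in>UNIV. H (x $ i' - x $ i) - H (y $ i' - y $ i))"
      by (simp add: interaction_nth H_def sum_subtractf scaleR_diff_right)
    also have "norm \<dots> \<le> (1 / real CARD('n)) * (\<Sum>i'\<in>(UNIV::'n set). 2 * (S * (1 + R)) * norm (x - y))"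
    proof -
      have "norm (H (x $ i' - x $ i) - H (y $ i' - y $ i)) \<le> S * (1 + R) * (2 * norm (x - y))" for i'
      proof -
        have "norm (H (x $ i' - x $ i) - H (y $ i' - y $ i))
            \<le> S * (1 + R) * norm ((x $ i' - x $ i) - (y $ i' - y $ i))" by (rule H)
        also have "(x $ i' - x $ i) - (y $ i' - y $ i) = (x - y) $ i' - (x - y) $ i" by simp
        finally have 1: "norm (H (x $ i' - x $ i) - H (y $ i' - y $ i))
            \<le> S * (1 + R) * norm ((x - y) $ i' - (x - y) $ i)" .
        have "norm ((x - y) $ i' - (x - y) $ i) \<le> norm ((x - y) $ i') + norm ((x - y) $ i)" by (rule norm_triangle_ineq4)
        also have "\<dots> \<le> 2 * norm (x - y)"
          using Finite_Cartesian_Product.norm_nth_le[of "x - y" i'] Finite_Cartesian_Product.norm_nth_le[of "x - y" i]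
          by linarith
        finally have "S * (1 + R) * norm ((x - y) $ i' - (x - y) $ i) \<le> S * (1 + R) * (2 * norm (x - y))"
          using S0 R by (intro mult_left_mono) auto
        with 1 show ?thesis by linarith
      qed
      then have "norm (\<Sum>i'\<in>UNIV. H (x $ i' - x $ i) - H (y $ i' - y $ i))
          \<le> (\<Sum>i'\<in>(UNIV::'n set). 2 * (S * (1 + R)) * norm (x - y))"
        by (intro sum_norm_le) (simp only: mult.assoc mult.left_commute[of 2])
      from mult_left_mono[OF this, of "1 / real CARD('n)"] show ?thesis by simp
    qed
    finally show ?thesis by simp
  qed
  have "norm (interaction \<phi> x - interaction \<phi> y) \<le> (\<Sum>i\<in>(UNIV::'n set). norm ((interaction \<phi> x - interaction \<phi> y) $ i))"
    by (simp add: norm_vec_def L2_set_le_sum)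
  also have "\<dots> \<le> (\<Sum>i\<in>(UNIV::'n set). 2 * (S * (1 + R)) * norm (x - y))"
    using comp by (intro sum_mono) simp
  finally show ?thesis by simp
qed

section \<open>Metric entropy of finite-dimensional function spaces\<close>

lemma funspace_lincomb:
  assumes V: "funspace.subspace V" and f: "\<And>i. i \<in> A \<Longrightarrow> f i \<in> V"
  shows "(\<lambda>r. \<Sum>i\<in>A. c i * f i r) \<in> V"
  using f
proof (induction A rule: infinite_finite_induct)
  case (insert a A)
  have "(\<lambda>r. c a * f a r) + (\<lambda>r. \<Sum>i\<in>A. c i * f i r) \<in> V"
    using insert by (intro funspace.subspace_add[OF V] funspace.subspace_scale[OF V]) auto
  then show ?case using insert by (simp add: plus_fun_def)
qed (use funspace.subspace_0[OF V] in \<open>simp_all add: zero_fun_def\<close>)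

lemma funspace_lincomb2:
  assumes V: "funspace.subspace V" and "f \<in> V" "g \<in> V"
  shows "(\<lambda>r. a * f r + b * g r) \<in> V"
  using funspace.subspace_add[OF V funspace.subspace_scale[OF V, of f a] funspace.subspace_scale[OF V, of g b]] assms
  by (simp add: plus_fun_def)

lemma funspace_diff:
  assumes V: "funspace.subspace V" and "f \<in> V" "g \<in> V"
  shows "(\<lambda>r. f r - g r) \<in> V"
  using funspace_lincomb2[OF assms, of 1 "-1"] by simp

text \<open>Nodes and functions in duality, as in Lagrange interpolation. Coefficients with respect
  to such a system are point evaluations, hence bounded by the sup norm.\<close>

definition biorthogonal :: "nat \<Rightarrow> (nat \<Rightarrow> real) \<Rightarrow> (nat \<Rightarrow> real \<Rightarrow> real) \<Rightarrow> bool"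
  where "biorthogonal d x l \<longleftrightarrow> (\<forall>i<d. \<forall>j<d. l i (x j) = (if i = j then 1 else 0))"

text \<open>Evaluation at \<open>x i\<close> annihilates the span of the other functions but not
  \<open>l i\<close>, so the functions are independent.\<close>

lemma biorthogonal_le_dim:
  assumes V: "finite_dim_subspace V" and l: "\<And>i. i < d \<Longrightarrow> l i \<in> V" and b: "biorthogonal d x l"
  shows "d \<le> funspace.dim V"
proof -
  have inj: "inj_on l {..<d}"
  proof (rule inj_onI)
    fix i j assume "i \<in> {..<d}" "j \<in> {..<d}" "l i = l j"
    have "l i (x i) = 1" "l j (x i) = (if j = i then 1 else 0)"
      using b \<open>i \<in> {..<d}\<close> \<open>j \<in> {..<d}\<close> unfolding biorthogonal_def by auto
    then show "i = j" using \<open>l i = l j\<close> by (metis zero_neq_one)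
  qed
  have ind: "funspace.independent (l ` {..<d})"
    unfolding funspace.dependent_def
  proof safe
    fix i assume i: "i < d" and sp: "l i \<in> funspace.span (l ` {..<d} - {l i})"
    from sp have "l i \<in> {f. f (x i) = 0}"
    proof (induction rule: funspace.span_induct)
      case base
      show ?case by (auto simp: funspace.subspace_def)
    next
      case (step f)
      then show ?case using b i by (auto simp: biorthogonal_def)
    qed
    then show False using b i by (simp add: biorthogonal_def)
  qed
  obtain B0 where B0: "finite B0" "V = funspace.span B0"
    using V by (auto simp: finite_dim_subspace_def)
  obtain B where B: "B \<subseteq> V" "funspace.independent B" "V \<subseteq> funspace.span B" "card B = funspace.dim V"
    using funspace.basis_exists by blast
  have "finite B"
    using funspace.independent_span_bound[OF B0(1) B(2)] B(1) B0(2) by blast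
  then have "card (l ` {..<d}) \<le> card B"
    using funspace.independent_span_bound[OF _ ind, of B] l B(3) by auto
  then show ?thesis using inj B(4) by (simp add: card_image)
qed

text \<open>A biorthogonal system of maximal length reproduces every element of \<open>V\<close>: if
  the interpolation of \<open>g\<close> failed at some point \<open>r\<close>, the residual would
  vanish at all nodes but not at \<open>r\<close>, and \<open>r\<close> could be added as a further
  node.\<close>

lemma biorthogonal_exists:
  assumes V: "finite_dim_subspace V"
  obtains d x l where "d \<le> funspace.dim V" "\<And>i. i < d \<Longrightarrow> l i \<in> V"
    "\<And>g r. g \<in> V \<Longrightarrow> g r = (\<Sum>i<d. g (x i) * l i r)"
proof -
  have sub: "funspace.subspace V" using V by (simp add: finite_dim_subspace_def)
  define A where "A = {d. \<exists>x l. (\<forall>i<d. l i \<in> V) \<and> biorthogonal d x l}"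
  have "A \<subseteq> {..funspace.dim V}"
    unfolding A_def using biorthogonal_le_dim[OF V] by auto
  then have fin: "finite A" by (rule finite_subset) simp
  have "0 \<in> A" by (auto simp: A_def biorthogonal_def)
  define d where "d = Max A"
  have "d \<in> A" unfolding d_def using fin \<open>0 \<in> A\<close> by (intro Max_in) auto
  then obtain x l where l: "\<And>i. i < d \<Longrightarrow> l i \<in> V" and b: "biorthogonal d x l"
    by (auto simp: A_def)
  have bD: "l i (x j) = (if i = j then 1 else 0)" if "i < d" "j < d" for i j
    using b that by (auto simp: biorthogonal_def)
  have rep: "g r = (\<Sum>i<d. g (x i) * l i r)" if g: "g \<in> V" for g r
  proof (rule ccontr)
    define h where "h = (\<lambda>r. g r - (\<Sum>i<d. g (x i) * l i r))"
    assume "g r \<noteq> (\<Sum>i<d. g (x i) * l i r)"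
    then have h0: "h r \<noteq> 0" by (simp add: h_def)
    have hV: "h \<in> V" unfolding h_def
      by (intro funspace_diff[OF sub] g funspace_lincomb[OF sub] l) auto
    have hx: "h (x j) = 0" if "j < d" for j
    proof -
      have "(\<Sum>i<d. g (x i) * l i (x j)) = (\<Sum>i<d. if i = j then g (x i) else 0)"
        using bD that by (intro sum.cong) auto
      then show ?thesis using that by (simp add: h_def)
    qed
    define x' where "x' = x(d := r)"
    \<comment> \<open>Multiples of \<open>h\<close> may be subtracted freely, since \<open>h\<close>
      vanishes at the old nodes; they are chosen so that the old functions vanish at
      \<open>r\<close>, and the normalized residual is the new one.\<close>
    define l' where "l' = (\<lambda>i s. if i < d then l i s - l i r / h r * h s else h s / h r)"
    have "l' i \<in> V" if "i < Suc d" for i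
    proof (cases "i < d")
      case True
      then show ?thesis
        using funspace_lincomb2[OF sub l[OF True] hV, of 1 "- (l i r / h r)"] by (simp add: l'_def)
    next
      case False
      then show ?thesis
        using funspace.subspace_scale[OF sub hV, of "1 / h r"] by (simp add: l'_def)
    qed
    moreover have "biorthogonal (Suc d) x' l'"
      using h0 hx bD unfolding biorthogonal_def
      by (auto simp: l'_def x'_def less_Suc_eq)
    ultimately have "Suc d \<in> A" unfolding A_def by blast
    then have "Suc d \<le> d" unfolding d_def using fin by (intro Max_ge)
    then show False by simp
  qed
  show ?thesis
    using that[OF biorthogonal_le_dim[OF V l b] l rep] by blast
qed

definition separated :: "real \<Rightarrow> (real \<Rightarrow> real) set \<Rightarrow> bool"
  where "separated \<delta> F \<longleftrightarrow> (\<forall>f\<in>F. \<forall>g\<in>F. f \<noteq> g \<longrightarrow> (\<exists>r. \<bar>f r - g r\<bar> > \<delta>))"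

text \<open>The elements of \<open>P\<close> are expansions
  \<open>f0 + \<theta> * f1 + \<theta>^2 * f2 + ...\<close> with \<open>k\<close> digits from
  \<open>F\<close> and ratio \<open>\<theta> = \<delta> / 8\<close>. Two of them are already
  distinguished at their first differing digit. The bound \<open>8 / 7\<close> is the sum of the
  geometric series of ratio \<open>1 / 8\<close>.\<close>

lemma packing_power:
  assumes V: "funspace.subspace V" and F: "finite F" "F \<subseteq> V" "separated \<delta> F" "\<And>f r. f \<in> F \<Longrightarrow> \<bar>f r\<bar> \<le> 1"
    and \<delta>: "0 < \<delta>" "\<delta> \<le> 1"
  shows "\<exists>P. finite P \<and> P \<subseteq> V \<and> card P = card F ^ k \<and> (\<forall>p\<in>P. \<forall>r. \<bar>p r\<bar> \<le> 8 / 7) \<and>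
     separated ((\<delta> / 8) ^ k * (\<delta> / 2)) P"
proof (induction k)
  case 0
  show ?case
    by (rule exI[of _ "{0}"]) (auto simp: separated_def funspace.subspace_0[OF V])
next
  case (Suc k)
  then obtain P where P: "finite P" "P \<subseteq> V" "card P = card F ^ k" "\<And>p r. p \<in> P \<Longrightarrow> \<bar>p r\<bar> \<le> 8 / 7"
     "separated ((\<delta> / 8) ^ k * (\<delta> / 2)) P" by auto
  define \<theta> where "\<theta> = \<delta> / 8"
  define m where "m = (\<lambda>(f, p) (r::real). f r + \<theta> * p r :: real)"
  have \<theta>: "0 < \<theta>" "\<theta> \<le> 1 / 8" using \<delta> by (auto simp: \<theta>_def)
  have sep: "\<exists>r. \<bar>m z r - m z' r\<bar> > \<theta> ^ Suc k * (\<delta> / 2)"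
    if zz: "z \<in> F \<times> P" "z' \<in> F \<times> P" "z \<noteq> z'" for z z'
  proof -
    obtain f p g q where z: "z = (f, p)" "z' = (g, q)" by (metis surj_pair)
    have mem: "f \<in> F" "g \<in> F" "p \<in> P" "q \<in> P" using zz z by auto
    show ?thesis
    proof (cases "f = g")
      case True
      then have "p \<noteq> q" using zz z by auto
      then obtain r where "\<bar>p r - q r\<bar> > \<theta> ^ k * (\<delta> / 2)"
        using P(5) mem by (auto simp: separated_def \<theta>_def)
      then have "\<theta> * \<bar>p r - q r\<bar> > \<theta> * (\<theta> ^ k * (\<delta> / 2))" using \<theta> by simp
      moreover have "\<bar>m z r - m z' r\<bar> = \<theta> * \<bar>p r - q r\<bar>"
        using True z \<theta> by (simp add: m_def abs_mult flip: right_diff_distrib)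
      ultimately show ?thesis by (intro exI[of _ r]) (simp add: mult_ac)
    next
      case False
      then obtain r where r: "\<bar>f r - g r\<bar> > \<delta>"
        using F(3) mem by (auto simp: separated_def)
      have "\<bar>p r - q r\<bar> \<le> 16 / 7" using P(4)[OF mem(3), of r] P(4)[OF mem(4), of r] by linarith
      then have "\<theta> * \<bar>p r - q r\<bar> \<le> \<theta> * (16 / 7)" using \<theta> by (intro mult_left_mono) auto
      moreover have "\<bar>m z r - m z' r\<bar> \<ge> \<bar>f r - g r\<bar> - \<theta> * \<bar>p r - q r\<bar>"
      proof -
        have "m z r - m z' r = (f r - g r) + \<theta> * (p r - q r)"
          using z by (simp add: m_def algebra_simps)
        moreover have "\<bar>\<theta> * (p r - q r)\<bar> = \<theta> * \<bar>p r - q r\<bar>" using \<theta> by (simp add: abs_mult)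
        ultimately show ?thesis by linarith
      qed
      \<comment> \<open>The gap \<open>\<delta>\<close> between leading digits exceeds the possible
        compensation by the tails, which is \<open>2 * \<delta> / 7\<close>, by more than
        \<open>\<delta> / 2\<close>.\<close>
      moreover have "\<theta> * (16 / 7) < \<delta> / 2" using \<delta> by (simp add: \<theta>_def)
      ultimately have "\<bar>m z r - m z' r\<bar> > \<delta> / 2" using r by linarith
      moreover have "\<theta> ^ Suc k * (\<delta> / 2) \<le> 1 * (\<delta> / 2)"
        using \<theta> \<delta> by (intro mult_right_mono power_le_one) auto
      ultimately show ?thesis by (intro exI[of _ r]) linarith
    qed
  qed
  have inj: "inj_on m (F \<times> P)"
  proof (rule inj_onI, rule ccontr)
    fix z z' assume "z \<in> F \<times> P" "z' \<in> F \<times> P" "m z = m z'" "z \<noteq> z'"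
    then obtain r where "\<bar>m z r - m z' r\<bar> > \<theta> ^ Suc k * (\<delta> / 2)" using sep by blast
    moreover have "\<theta> ^ Suc k * (\<delta> / 2) \<ge> 0" using \<theta> \<delta> by auto
    ultimately show False using \<open>m z = m z'\<close> by simp
  qed
  have bound: "\<bar>m z r\<bar> \<le> 8 / 7" if "z \<in> F \<times> P" for z r
  proof -
    obtain f p where z: "z = (f, p)" by (metis surj_pair)
    have "\<theta> * \<bar>p r\<bar> \<le> 1 / 8 * (8 / 7)" using that z \<theta> P(4) by (intro mult_mono) auto
    moreover have "\<bar>f r\<bar> \<le> 1" using that z F by auto
    moreover have "\<bar>m z r\<bar> \<le> \<bar>f r\<bar> + \<theta> * \<bar>p r\<bar>"
      using z \<theta> abs_triangle_ineq[of "f r" "\<theta> * p r"] by (simp add: m_def abs_mult)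
    ultimately show ?thesis by linarith
  qed
  have mem: "m z \<in> V" if "z \<in> F \<times> P" for z
  proof -
    have "fst z \<in> V" "snd z \<in> V" using that F(2) P(2) by auto
    from funspace_lincomb2[OF V this, of 1 \<theta>] show ?thesis by (simp add: m_def case_prod_beta)
  qed
  show ?case
  proof (intro exI[of _ "m ` (F \<times> P)"] conjI)
    show "separated ((\<delta> / 8) ^ Suc k * (\<delta> / 2)) (m ` (F \<times> P))"
      unfolding separated_def using sep by (fold \<theta>_def) blast
    show "card (m ` (F \<times> P)) = card F ^ Suc k"
      using inj P(3) by (simp add: card_image card_cartesian_product)
    show "finite (m ` (F \<times> P))" using F P by auto
  qed (use bound mem in auto)
qed

text \<open>An element of \<open>V\<close> is determined by its values at the nodes. Rounding these
  to a grid of width \<open>e\<close> is injective on a separated set, and each of the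
  \<open>d\<close> rounded values ranges over a number of integers of order
  \<open>1 / e\<close>.\<close>

lemma packing_crude:
  assumes d: "\<And>g r. g \<in> V \<Longrightarrow> g r = (\<Sum>i<d. g (x i) * l i r)" and l: "\<And>i r. i < d \<Longrightarrow> \<bar>l i r\<bar> \<le> \<Lambda>"
    and P: "finite P" "P \<subseteq> V" "separated \<eta> P" "\<And>p r. p \<in> P \<Longrightarrow> \<bar>p r\<bar> \<le> 8 / 7"
    and \<eta>: "0 < \<eta>" "\<eta> \<le> 1" and \<Lambda>: "0 \<le> \<Lambda>"
  shows "real (card P) \<le> ((4 * (real d * \<Lambda> + 1) + 4) / \<eta>) ^ d"
proof -
  \<comment> \<open>Errors \<open>e\<close> at the nodes produce an error of at most
    \<open>d * \<Lambda> * e\<close> everywhere; the summand 1 keeps the denominator positive and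
    the total below \<open>\<eta>\<close>.\<close>
  define e where "e = \<eta> / (real d * \<Lambda> + 1)"
  have dL: "real d * \<Lambda> + 1 \<ge> 1" using \<Lambda> by simp
  have e: "e > 0" unfolding e_def using dL \<eta> by (intro divide_pos_pos) linarith+
  define m where "m = \<lceil>2 / e\<rceil>"
  define c where "c = (\<lambda>p::real \<Rightarrow> real. \<lambda>i\<in>{..<d}. \<lfloor>p (x i) / e\<rfloor>)"
  have m0: "m \<ge> 0" unfolding m_def using e divide_pos_pos[of 2 e] by linarith
  have inj: "inj_on c P"
  proof (rule inj_onI, rule ccontr)
    fix p q assume p: "p \<in> P" and q: "q \<in> P" and eq: "c p = c q" and "p \<noteq> q"
    then obtain r where r: "\<bar>p r - q r\<bar> > \<eta>" using P(3) by (auto simp: separated_def)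
    have near: "\<bar>p (x i) - q (x i)\<bar> \<le> e" if "i < d" for i
    proof -
      have "\<lfloor>p (x i) / e\<rfloor> = \<lfloor>q (x i) / e\<rfloor>"
        using fun_cong[OF eq, of i] that by (simp add: c_def)
      then have "\<bar>p (x i) / e - q (x i) / e\<bar> \<le> 1" by linarith
      then have "\<bar>p (x i) - q (x i)\<bar> / e \<le> 1"
        using e by (simp add: diff_divide_distrib[symmetric])
      then show ?thesis using e by (simp add: pos_divide_le_eq)
    qed
    have "p r - q r = (\<Sum>i<d. (p (x i) - q (x i)) * l i r)"
      unfolding left_diff_distrib sum_subtractf using p q P(2)
      by (intro arg_cong2[where f = "(-)"] d) auto
    also have "\<bar>\<dots>\<bar> \<le> (\<Sum>i<d. e * \<Lambda>)"
      using near l e by (intro order_trans[OF sum_abs] sum_mono) (auto simp: abs_mult intro!: mult_mono)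
    also have "\<dots> = (real d * \<Lambda>) * e" by simp
    also have "\<dots> \<le> (real d * \<Lambda> + 1) * e" using e by (intro mult_right_mono) auto
    also have "\<dots> = \<eta>" using dL by (simp add: e_def)
    finally show False using r by simp
  qed
  have "c ` P \<subseteq> ({..<d} \<rightarrow>\<^sub>E {-m-1..m})"
  proof (rule image_subsetI)
    fix p assume p: "p \<in> P"
    have "\<lfloor>p (x i) / e\<rfloor> \<in> {-m-1..m}" for i
    proof -
      have "\<bar>p (x i)\<bar> \<le> 2" using P(4)[OF p, of "x i"] by linarith
      then have "\<bar>p (x i) / e\<bar> \<le> 2 / e" using e by (simp add: abs_divide divide_right_mono)
      moreover have "2 / e \<le> of_int m" unfolding m_def by simp
      ultimately have "- of_int m \<le> p (x i) / e" "p (x i) / e \<le> of_int m" by linarith+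
      then show ?thesis by (simp add: le_floor_iff floor_le_iff)
    qed
    then show "c p \<in> ({..<d} \<rightarrow>\<^sub>E {-m-1..m})" by (simp add: c_def)
  qed
  then have "card P \<le> card ({..<d} \<rightarrow>\<^sub>E {-m-1..m})"
    using inj by (intro card_inj_on_le finite_PiE) auto
  also have "\<dots> = nat (2 * m + 2) ^ d" by (simp add: card_PiE add.commute)
  finally have "real (card P) \<le> real (nat (2 * m + 2)) ^ d"
    by (metis of_nat_le_iff of_nat_power)
  also have "real (nat (2 * m + 2)) = 2 * of_int m + 2" using m0 by simp
  also have "(2 * of_int m + 2) ^ d \<le> ((4 * (real d * \<Lambda> + 1) + 4) / \<eta>) ^ d"
  proof (rule power_mono)
    have "of_int m \<le> 2 / e + 1" unfolding m_def by linarith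
    then have "2 * of_int m + 2 \<le> 4 / e + 4" by simp
    also have "\<dots> \<le> 4 / e + 4 / \<eta>" using \<eta> by (simp add: le_divide_eq)
    also have "\<dots> = (4 * (real d * \<Lambda> + 1) + 4) / \<eta>"
      unfolding e_def by (simp add: add_divide_distrib)
    finally show "2 * of_int m + 2 \<le> (4 * (real d * \<Lambda> + 1) + 4) / \<eta>" .
  qed (use m0 in simp)
  finally show ?thesis .
qed

text \<open>The crude count loses a factor depending on the size of the dual basis. Applied to the
  \<open>k\<close>-digit expansions of \<open>packing_power\<close>, it disappears after taking \<open>k\<close>-th roots and letting
  \<open>k \<rightarrow> \<infinity>\<close>.\<close>

lemma packing_bound:
  assumes V: "finite_dim_subspace V" and bdd: "\<And>g. g \<in> V \<Longrightarrow> \<exists>C. \<forall>r. \<bar>g r\<bar> \<le> C"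
    and F: "finite F" "F \<subseteq> V" "separated \<delta> F" "\<And>f r. f \<in> F \<Longrightarrow> \<bar>f r\<bar> \<le> 1"
    and \<delta>: "0 < \<delta>" "\<delta> \<le> 1"
  shows "real (card F) \<le> (8 / \<delta>) ^ funspace.dim V"
proof -
  obtain d x l where d: "d \<le> funspace.dim V" and lV: "\<And>i. i < d \<Longrightarrow> l i \<in> V"
    and rep: "\<And>g r. g \<in> V \<Longrightarrow> g r = (\<Sum>i<d. g (x i) * l i r)"
    by (rule biorthogonal_exists[OF V]) (rule that)
  define C where "C i = (SOME C. \<forall>r. \<bar>l i r\<bar> \<le> C)" for i
  have C: "\<bar>l i r\<bar> \<le> C i" if "i < d" for i r
    using someI_ex[OF bdd[OF lV[OF that]]] by (simp add: C_def)
  define \<Lambda> where "\<Lambda> = (\<Sum>i<d. \<bar>C i\<bar>)"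
  have \<Lambda>: "\<Lambda> \<ge> 0" by (auto simp: \<Lambda>_def intro: sum_nonneg)
  have l\<Lambda>: "\<bar>l i r\<bar> \<le> \<Lambda>" if "i < d" for i r
  proof -
    have "\<bar>C i\<bar> \<le> \<Lambda>" unfolding \<Lambda>_def using that by (intro member_le_sum) auto
    then show ?thesis using C[OF that, of r] by linarith
  qed
  \<comment> \<open>The part of the crude bound that does not grow with the number \<open>k\<close>
    of digits.\<close>
  define D where "D = ((4 * (real d * \<Lambda> + 1) + 4) * (2 / \<delta>)) ^ d"
  define q where "q = (8 / \<delta>) ^ d"
  have q: "q \<ge> 1" unfolding q_def using \<delta> by (intro one_le_power) (simp add: le_divide_eq)
  have gen: "(a * c ^ k) ^ d = a ^ d * (c ^ d) ^ k" for a c :: real and k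
    by (simp add: power_mult_distrib mult.commute flip: power_mult)
  have bound: "real (card F) ^ k \<le> D * q ^ k" for k
  proof -
    have sub: "funspace.subspace V" using V by (simp add: finite_dim_subspace_def)
    obtain P where P: "finite P" "P \<subseteq> V" "card P = card F ^ k" "\<And>p r. p \<in> P \<Longrightarrow> \<bar>p r\<bar> \<le> 8 / 7"
     "separated ((\<delta> / 8) ^ k * (\<delta> / 2)) P"
      using packing_power[OF sub F(1-3) _ \<delta>, of k] F(4) by blast
    have "real (card P) \<le> ((4 * (real d * \<Lambda> + 1) + 4) / ((\<delta> / 8) ^ k * (\<delta> / 2))) ^ d"
    proof (rule packing_crude[where V = V and P = P and l = l and x = x and \<Lambda> = \<Lambda>])
      show "(\<delta> / 8) ^ k * (\<delta> / 2) \<le> 1"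
        using \<delta> by (intro mult_le_one power_le_one) auto
      show "g r = (\<Sum>i<d. g (x i) * l i r)" if "g \<in> V" for g r using that by (rule rep)
      show "\<bar>l i r\<bar> \<le> \<Lambda>" if "i < d" for i r using that by (rule l\<Lambda>)
      show "\<bar>p r\<bar> \<le> 8 / 7" if "p \<in> P" for p r using that by (rule P(4))
    qed (use \<delta> \<Lambda> P in auto)
    also have "(4 * (real d * \<Lambda> + 1) + 4) / ((\<delta> / 8) ^ k * (\<delta> / 2)) =
        ((4 * (real d * \<Lambda> + 1) + 4) * (2 / \<delta>)) * (8 / \<delta>) ^ k"
      by (simp add: power_divide mult_ac)
    also have "\<dots> ^ d = D * q ^ k"
      by (simp only: D_def q_def gen)
    finally show ?thesis using P(3) by simp
  qed
  have "real (card F) \<le> q"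
  proof (rule ccontr)
    assume "\<not> real (card F) \<le> q"
    then have "real (card F) / q > 1" using q by simp
    then obtain k where "D < (real (card F) / q) ^ k" using real_arch_pow by blast
    then show False using bound[of k] q by (simp add: power_divide less_divide_eq)
  qed
  also have "q \<le> (8 / \<delta>) ^ funspace.dim V"
    unfolding q_def using \<delta> d by (intro power_increasing) (simp_all add: le_divide_eq)
  finally show ?thesis .
qed

text \<open>A separated family of maximal cardinality is a net, since an element far from all its
  members could be added. The maximum exists by \<open>packing_bound\<close>. The net points lie
  themselves in the ball, so that the deviation bounds for that ball apply to them.\<close>

lemma finite_net:
  assumes V: "finite_dim_subspace V" and bdd: "\<And>g. g \<in> V \<Longrightarrow> \<exists>C. \<forall>r. \<bar>g r\<bar> \<le> C"
    and \<delta>: "0 < \<delta>" "\<delta> \<le> 1" and K: "K > 0"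
  shows "\<exists>F. finite F \<and> F \<subseteq> V \<and> (\<forall>f\<in>F. \<forall>r. \<bar>f r\<bar> \<le> K) \<and>
    real (card F) \<le> (8 / \<delta>) ^ funspace.dim V \<and>
    (\<forall>g\<in>V. (\<forall>r. \<bar>g r\<bar> \<le> K) \<longrightarrow> (\<exists>f\<in>F. \<forall>r. \<bar>g r - f r\<bar> \<le> \<delta> * K))"
proof -
  have sub: "funspace.subspace V" using V by (simp add: finite_dim_subspace_def)
  define good where "good F \<longleftrightarrow> finite F \<and> F \<subseteq> V \<and> separated \<delta> F \<and> (\<forall>f\<in>F. \<forall>r. \<bar>f r\<bar> \<le> 1)" for F
  define A where "A = {card F | F. good F}"
  have bound: "card F \<le> nat \<lfloor>(8 / \<delta>) ^ funspace.dim V\<rfloor>" if "good F" for F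
    using packing_bound[OF V bdd, of F \<delta>] that \<delta> by (simp add: good_def le_nat_floor)
  then have "A \<subseteq> {..nat \<lfloor>(8 / \<delta>) ^ funspace.dim V\<rfloor>}" by (auto simp: A_def)
  then have fin: "finite A" by (rule finite_subset) simp
  have "good {}" by (simp add: good_def separated_def)
  then have "A \<noteq> {}" by (auto simp: A_def)
  then have "Max A \<in> A" using fin by simp
  then obtain F where F: "good F" "card F = Max A" by (auto simp: A_def)
  define G where "G = (\<lambda>f r. K * f r) ` F"
  show ?thesis
  proof (intro exI[of _ G] conjI ballI allI impI)
    show "finite G" using F by (simp add: G_def good_def)
    show "G \<subseteq> V" using F by (auto simp: G_def good_def intro!: funspace.subspace_scale[OF sub])
    show "\<bar>f r\<bar> \<le> K" if "f \<in> G" for f r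
      using that F K by (auto simp: G_def good_def abs_mult mult_le_cancel_left1)
    have "card G \<le> card F" unfolding G_def using F(1) by (intro card_image_le) (simp add: good_def)
    moreover have "real (card F) \<le> (8 / \<delta>) ^ funspace.dim V"
      using packing_bound[OF V bdd, of F \<delta>] F \<delta> by (simp add: good_def)
    ultimately show "real (card G) \<le> (8 / \<delta>) ^ funspace.dim V" by linarith
    fix g assume g: "g \<in> V" and "\<forall>r. \<bar>g r\<bar> \<le> K"
    then have gK: "\<bar>g r\<bar> \<le> K" for r by blast
    define h where "h = (\<lambda>r. (1 / K) * g r)"
    have hV: "h \<in> V" unfolding h_def by (intro funspace.subspace_scale[OF sub] g)
    have h1: "\<bar>h r\<bar> \<le> 1" for r using gK[of r] K by (simp add: h_def abs_mult)
    have "\<exists>f\<in>F. \<forall>r. \<bar>h r - f r\<bar> \<le> \<delta>"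
    proof (rule ccontr)
      assume "\<not> (\<exists>f\<in>F. \<forall>r. \<bar>h r - f r\<bar> \<le> \<delta>)"
      then have far: "\<exists>r. \<bar>h r - f r\<bar> > \<delta>" if "f \<in> F" for f using that by (meson not_le)
      have "h \<notin> F"
      proof
        assume "h \<in> F"
        from far[OF this] show False using \<delta> by simp
      qed
      have far': "\<exists>r. \<bar>f r - h r\<bar> > \<delta>" if "f \<in> F" for f
        using far[OF that] by (simp add: abs_minus_commute)
      have "good (insert h F)"
        using F(1) hV h1 far far' by (auto simp: good_def separated_def)
      then have "card (insert h F) \<in> A" by (auto simp: A_def)
      then have "card (insert h F) \<le> card F" unfolding F(2) using fin by (intro Max_ge)
      then show False using \<open>h \<notin> F\<close> F(1) by (simp add: good_def)
    qed
    then obtain f where f: "f \<in> F" "\<And>r. \<bar>h r - f r\<bar> \<le> \<delta>" by blast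
    have "\<bar>g r - K * f r\<bar> \<le> \<delta> * K" for r
    proof -
      have "g r - K * f r = K * (h r - f r)" using K by (simp add: h_def field_simps)
      then show ?thesis using f(2)[of r] K by (simp add: abs_mult mult.commute)
    qed
    then show "\<exists>f\<in>G. \<forall>r. \<bar>g r - f r\<bar> \<le> \<delta> * K" using f(1) by (auto simp: G_def)
  qed
qed

section \<open>Euler schemes and the driving noise\<close>

text \<open>\<open>indep_var\<close> requires both random variables to take values in the same type.\<close>

definition indep_pair :: "'w measure \<Rightarrow> 'a measure \<Rightarrow> ('w \<Rightarrow> 'a) \<Rightarrow> 'b measure \<Rightarrow> ('w \<Rightarrow> 'b) \<Rightarrow> bool"
  where "indep_pair M S X T Y \<longleftrightarrow> X \<in> measurable M S \<and> Y \<in> measurable M T \<and>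
    distr M S X \<Otimes>\<^sub>M distr M T Y = distr M (S \<Otimes>\<^sub>M T) (\<lambda>\<omega>. (X \<omega>, Y \<omega>))"

text \<open>Two forms of independence are needed. The one with \<sigma>-algebras passes to all
  measurable functions of the given data; the one with product laws can be carried to another
  probability space and is insensitive to null sets. This lemma and the next translate between
  them.\<close>

lemma (in prob_space) indep_set_imp_indep_pair:
  assumes ind: "indep_set (sets F) (sets G)" and sp: "space F = space M" "space G = space M"
    and X: "X \<in> measurable F S" and Y: "Y \<in> measurable G T"
  shows "indep_pair M S X T Y"
proof -
  have ev: "sets F \<subseteq> events" "sets G \<subseteq> events"
    using indep_setD_ev1[OF ind] indep_setD_ev2[OF ind] by auto
  have [measurable]: "random_variable S X" "random_variable T Y"
    using X Y ev sp by (auto simp: measurable_def)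
  interpret X: prob_space "distr M S X" by (rule prob_space_distr) measurable
  interpret Y: prob_space "distr M T Y" by (rule prob_space_distr) measurable
  have "distr M S X \<Otimes>\<^sub>M distr M T Y = distr M (S \<Otimes>\<^sub>M T) (\<lambda>\<omega>. (X \<omega>, Y \<omega>))"
  proof (rule pair_measure_eqI)
    show "sigma_finite_measure (distr M S X)" "sigma_finite_measure (distr M T Y)" ..
    fix A B assume A: "A \<in> sets (distr M S X)" and B: "B \<in> sets (distr M T Y)"
    have "X -` A \<inter> space M \<in> sets F" "Y -` B \<inter> space M \<in> sets G"
      using measurable_sets[OF X, of A] measurable_sets[OF Y, of B] A B sp by auto
    from indep_setD[OF ind this]
    have "prob ((X -` A \<inter> space M) \<inter> (Y -` B \<inter> space M)) = prob (X -` A \<inter> space M) * prob (Y -` B \<inter> space M)" .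
    also have "(X -` A \<inter> space M) \<inter> (Y -` B \<inter> space M) = (\<lambda>\<omega>. (X \<omega>, Y \<omega>)) -` (A \<times> B) \<inter> space M" by auto
    finally show "emeasure (distr M S X) A * emeasure (distr M T Y) B =
        emeasure (distr M (S \<Otimes>\<^sub>M T) (\<lambda>\<omega>. (X \<omega>, Y \<omega>))) (A \<times> B)"
      using A B by (simp add: emeasure_distr emeasure_eq_measure ennreal_mult)
  qed simp
  then show ?thesis by (simp add: indep_pair_def)
qed

lemma (in prob_space) indep_pair_imp_indep_set:
  assumes ind: "indep_pair M S X T Y"
  shows "indep_set (sets (vimage_algebra (space M) X S)) (sets (vimage_algebra (space M) Y T))"
proof -
  have [measurable]: "random_variable S X" "random_variable T Y"
    and eq: "distr M S X \<Otimes>\<^sub>M distr M T Y = distr M (S \<Otimes>\<^sub>M T) (\<lambda>\<omega>. (X \<omega>, Y \<omega>))"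
    using ind by (auto simp: indep_pair_def)
  interpret X: prob_space "distr M S X" by (rule prob_space_distr) measurable
  interpret Y: prob_space "distr M T Y" by (rule prob_space_distr) measurable
  have sX: "sets (vimage_algebra (space M) X S) = {X -` A \<inter> space M |A. A \<in> sets S}"
    by (rule sets_vimage_algebra2) (auto dest: measurable_space[OF \<open>random_variable S X\<close>])
  have sY: "sets (vimage_algebra (space M) Y T) = {Y -` A \<inter> space M |A. A \<in> sets T}"
    by (rule sets_vimage_algebra2) (auto dest: measurable_space[OF \<open>random_variable T Y\<close>])
  show ?thesis
    unfolding sX sY
  proof (safe intro!: indep_setI)
    fix A B assume AB[measurable]: "A \<in> sets S" "B \<in> sets T"
    have "emeasure M ((X -` A \<inter> space M) \<inter> (Y -` B \<inter> space M)) =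
        emeasure (distr M (S \<Otimes>\<^sub>M T) (\<lambda>\<omega>. (X \<omega>, Y \<omega>))) (A \<times> B)"
      by (subst emeasure_distr) (auto intro!: arg_cong[where f = "emeasure M"])
    also have "\<dots> = emeasure (distr M S X) A * emeasure (distr M T Y) B"
      unfolding eq[symmetric] by (rule Y.emeasure_pair_measure_Times) auto
    finally show "prob ((X -` A \<inter> space M) \<inter> (Y -` B \<inter> space M)) = prob (X -` A \<inter> space M) * prob (Y -` B \<inter> space M)"
      by (simp add: emeasure_distr emeasure_eq_measure flip: ennreal_mult)
  qed auto
qed

text \<open>The limit of the Euler schemes coincides with the solution only almost surely, and the
  \<sigma>-algebras generated by the two may differ; their laws do not.\<close>

lemma (in prob_space) indep_pair_AE_cong:
  assumes ind: "indep_pair M S X T Y" and eq: "AE \<omega> in M. X \<omega> = X' \<omega>" "AE \<omega> in M. Y \<omega> = Y' \<omega>"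
    and rv: "random_variable S X'" "random_variable T Y'"
  shows "indep_pair M S X' T Y'"
proof -
  have rv': "random_variable S X" "random_variable T Y" using ind by (auto simp: indep_pair_def)
  have "distr M S X = distr M S X'" "distr M T Y = distr M T Y'"
    using eq rv rv' by (auto intro!: distr_cong_AE)
  moreover have "distr M (S \<Otimes>\<^sub>M T) (\<lambda>\<omega>. (X \<omega>, Y \<omega>)) = distr M (S \<Otimes>\<^sub>M T) (\<lambda>\<omega>. (X' \<omega>, Y' \<omega>))"
  proof (rule distr_cong_AE)
    show "AE \<omega> in M. (X \<omega>, Y \<omega>) = (X' \<omega>, Y' \<omega>)" using eq by eventually_elim simp
  qed (auto intro: measurable_Pair rv rv')
  ultimately show ?thesis
    using ind rv unfolding indep_pair_def by simp
qed

lemma measurable_trajectory: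
  assumes "\<And>r. r \<in> {0..t} \<Longrightarrow> Z r \<in> borel_measurable M"
  shows "trajectory t Z \<in> measurable M (path_space t)"
  unfolding trajectory_def by (rule measurable_restrict) (use assms in auto)

lemma trajectory_component:
  assumes "r \<in> {0..t}"
  shows "Z r \<in> borel_measurable (vimage_algebra \<Omega> (trajectory t Z) (path_space t))"
proof -
  have "(\<lambda>\<omega>. trajectory t Z \<omega> r) \<in> borel_measurable (vimage_algebra \<Omega> (trajectory t Z) (path_space t))"
    by (rule measurable_compose[OF measurable_vimage_algebra1 measurable_component_singleton])
      (use assms in \<open>auto simp: trajectory_def space_PiM\<close>)
  then show ?thesis using assms by (simp add: trajectory_def)
qed

section \<open>Deterministic approximation by Euler schemes and Riemann sums\<close>

lemma uniformly_continuous_interval: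
  fixes f :: "real \<Rightarrow> 'e::real_normed_vector"
  assumes f: "continuous_on {s..t} f" and e: "e > 0"
  obtains d where "d > 0"
    "\<And>u v. u \<in> {s..t} \<Longrightarrow> v \<in> {s..t} \<Longrightarrow> \<bar>u - v\<bar> < d \<Longrightarrow> norm (f u - f v) < e"
proof -
  have "uniformly_continuous_on {s..t} f" by (rule compact_uniformly_continuous[OF f]) simp
  then obtain d where d: "d > 0" "\<forall>x\<in>{s..t}. \<forall>x'\<in>{s..t}. dist x' x < d \<longrightarrow> dist (f x') (f x) < e"
    using e unfolding uniformly_continuous_on_def by blast
  show ?thesis
  proof (rule that[OF d(1)])
    fix u v assume "u \<in> {s..t}" "v \<in> {s..t}" "\<bar>u - v\<bar> < d"
    then show "norm (f u - f v) < e" using d(2) by (simp add: dist_norm)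
  qed
qed

lemma integral_minus_rectangle:
  fixes f :: "real \<Rightarrow> 'e::euclidean_space"
  assumes "continuous_on {a..a+h} f" "h \<ge> 0" and "\<And>u. u \<in> {a..a+h} \<Longrightarrow> norm (f u - f a) \<le> e"
  shows "norm (integral {a..a+h} f - h *\<^sub>R f a) \<le> h * e"
proof -
  have i: "f integrable_on {a..a+h}" using assms(1) by (rule integrable_continuous_interval)
  have "integral {a..a+h} (\<lambda>u. f u - f a) = integral {a..a+h} f - h *\<^sub>R f a"
    using i assms(2) by (subst integral_diff) auto
  moreover have "norm (integral {a..a+h} (\<lambda>u. f u - f a)) \<le> e * ((a+h) - a)"
    using assms by (intro integral_bound continuous_intros) auto
  ultimately show ?thesis by (simp add: mult.commute)
qed

fun euler :: "('e \<Rightarrow> 'e) \<Rightarrow> real \<Rightarrow> 'e \<Rightarrow> (nat \<Rightarrow> 'e) \<Rightarrow> nat \<Rightarrow> 'e::euclidean_space" where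
  "euler b h x0 w 0 = x0"
| "euler b h x0 w (Suc k) = euler b h x0 w k + h *\<^sub>R b (euler b h x0 w k) + (w (Suc k) - w k)"

text \<open>Discrete Gronwall argument, with \<open>\<epsilon>\<close> bounding the oscillation of
  \<open>x\<close> over times at most \<open>h\<close> apart. The noise is additive and cancels
  exactly, so no regularity of \<open>w\<close> enters. Each step multiplies the error by
  \<open>1 + L * h\<close> and adds \<open>h * L * \<epsilon>\<close>; the right-hand side solves
  this recursion with equality, starting from 0.\<close>

lemma euler_error:
  fixes x w :: "real \<Rightarrow> 'e::euclidean_space"
  assumes x: "continuous_on {0..s} x" and b: "\<And>y z. norm (b y - b z) \<le> L * norm (y - z)"
    and eq: "\<And>t. t \<in> {0..s} \<Longrightarrow> x t = x 0 + integral {0..t} (\<lambda>u. b (x u)) + w t"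
    and h: "h \<ge> 0" and L: "L \<ge> 0"
    and \<epsilon>: "\<And>u v. u \<in> {0..s} \<Longrightarrow> v \<in> {0..s} \<Longrightarrow> \<bar>u - v\<bar> \<le> h \<Longrightarrow> norm (x u - x v) \<le> \<epsilon>"
    and k: "real k * h \<le> s"
  shows "norm (x (real k * h) - euler b h (x 0) (\<lambda>k. w (real k * h)) k) \<le> \<epsilon> * ((1 + L * h) ^ k - 1)"
  using k
proof (induction k)
  case 0
  then show ?case by simp
next
  case (Suc k)
  let ?a = "real k * h"
  let ?e = "euler b h (x 0) (\<lambda>k. w (real k * h)) k"
  have S: "real (Suc k) * h = ?a + h" by (simp add: algebra_simps)
  have a: "0 \<le> ?a" "?a + h \<le> s" "?a \<le> s" using Suc.prems[unfolded S] h by auto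
  have "L-lipschitz_on UNIV b" using b L by (intro lipschitz_onI) (auto simp: dist_norm)
  then have "continuous_on UNIV b" by (rule lipschitz_on_continuous_on)
  then have cont: "continuous_on {0..s} (\<lambda>u. b (x u))"
    using x by (auto intro: continuous_on_compose2)
  have "integral {0..?a} (\<lambda>u. b (x u)) + integral {?a..?a+h} (\<lambda>u. b (x u)) = integral {0..?a+h} (\<lambda>u. b (x u))"
    using a h by (intro Henstock_Kurzweil_Integration.integral_combine integrable_continuous_interval
        continuous_on_subset[OF cont]) auto
  then have step: "x (?a + h) = x ?a + integral {?a..?a+h} (\<lambda>u. b (x u)) + (w (?a + h) - w ?a)"
    using eq[of ?a] eq[of "?a + h"] a h by (simp add: algebra_simps)
  have near: "norm (integral {?a..?a+h} (\<lambda>u. b (x u)) - h *\<^sub>R b (x ?a)) \<le> h * (L * \<epsilon>)"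
  proof (rule integral_minus_rectangle)
    fix u assume u: "u \<in> {?a..?a+h}"
    have "norm (b (x u) - b (x ?a)) \<le> L * norm (x u - x ?a)" by (rule b)
    also have "\<dots> \<le> L * \<epsilon>"
    proof (intro mult_left_mono \<epsilon> L)
      show "u \<in> {0..s}" using u a by (meson atLeastAtMost_iff order_trans)
    qed (use u a in auto)
    finally show "norm (b (x u) - b (x ?a)) \<le> L * \<epsilon>" .
  next
    show "continuous_on {?a..?a+h} (\<lambda>u. b (x u))"
      using a by (intro continuous_on_subset[OF cont] atLeastatMost_subset_iff[THEN iffD2]) auto
  qed (use h in auto)
  have IH: "norm (x ?a - ?e) \<le> \<epsilon> * ((1 + L * h) ^ k - 1)" using Suc.IH a by simp
  have "x (?a + h) - euler b h (x 0) (\<lambda>k. w (real k * h)) (Suc k) =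
     (x ?a - ?e) + (integral {?a..?a+h} (\<lambda>u. b (x u)) - h *\<^sub>R b (x ?a)) + h *\<^sub>R (b (x ?a) - b ?e)"
    unfolding euler.simps S step by (simp add: algebra_simps)
  also have "norm \<dots> \<le> norm (x ?a - ?e) + h * (L * \<epsilon>) + h * (L * norm (x ?a - ?e))"
    using near b[of "x ?a" ?e] h by (intro norm_triangle_le add_mono) (auto intro: mult_left_mono)
  also have "\<dots> = (1 + L * h) * norm (x ?a - ?e) + h * (L * \<epsilon>)" by (simp add: algebra_simps)
  also have "\<dots> \<le> (1 + L * h) * (\<epsilon> * ((1 + L * h) ^ k - 1)) + h * (L * \<epsilon>)"
    using IH L h by (intro add_right_mono mult_left_mono) auto
  also have "\<dots> = \<epsilon> * ((1 + L * h) ^ Suc k - 1)" by (simp add: algebra_simps)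
  finally show ?case unfolding S .
qed

lemma euler_limit:
  fixes x w :: "real \<Rightarrow> 'e::euclidean_space"
  assumes x: "continuous_on {0..s} x" and b: "\<And>y z. norm (b y - b z) \<le> L * norm (y - z)"
    and eq: "\<And>t. t \<in> {0..s} \<Longrightarrow> x t = x 0 + integral {0..t} (\<lambda>u. b (x u)) + w t"
    and L: "L \<ge> 0" and r: "r \<in> {0..s}"
  shows "(\<lambda>n. euler b (s / 2 ^ n) (x 0) (\<lambda>k. w (real k * (s / 2 ^ n))) (nat \<lfloor>r * 2 ^ n / s\<rfloor>)) \<longlonglongrightarrow> x r"
proof (cases "s = 0")
  \<comment> \<open>Here \<open>r = 0\<close>, and the index is 0 because division by zero yields
    zero.\<close>
  case True
  then show ?thesis using r by simp
next
  case False
  then have s: "s > 0" using r by simp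
  show ?thesis
  proof (rule LIMSEQ_I)
    fix e :: real assume e: "e > 0"
    \<comment> \<open>Adding the distance from \<open>r\<close> to its grid point, the total error
      is at most \<open>\<epsilon> * (1 + L * h) ^ k\<close>, hence at most
      \<open>\<epsilon> * exp (L * s)\<close>, which is half of \<open>e\<close>.\<close>
    define \<epsilon> where "\<epsilon> = e / (2 * exp (L * s))"
    have \<epsilon>: "\<epsilon> > 0" using e by (simp add: \<epsilon>_def)
    obtain d where d: "d > 0" "\<And>u v. u \<in> {0..s} \<Longrightarrow> v \<in> {0..s} \<Longrightarrow> \<bar>u - v\<bar> < d \<Longrightarrow> norm (x u - x v) < \<epsilon>"
      using uniformly_continuous_interval[OF x \<epsilon>] by blast
    obtain n0 where n0: "s / d < 2 ^ n0" using real_arch_pow[of 2 "s / d"] by auto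
    show "\<exists>no. \<forall>n\<ge>no. norm (euler b (s / 2 ^ n) (x 0) (\<lambda>k. w (real k * (s / 2 ^ n))) (nat \<lfloor>r * 2 ^ n / s\<rfloor>) - x r) < e"
    proof (intro exI[of _ n0] allI impI)
      fix n assume n: "n \<ge> n0"
      define h where "h = s / 2 ^ n"
      define k where "k = nat \<lfloor>r * 2 ^ n / s\<rfloor>"
      have h: "h > 0" using s by (simp add: h_def)
      have "s / d < 2 ^ n" using n0 power_increasing[OF n, of "2::real"] by linarith
      then have hd: "h < d" using d(1) s by (simp add: h_def field_simps)
      have rh: "r * 2 ^ n / s = r / h" by (simp add: h_def)
      have k': "real k \<le> r / h" "r / h \<le> real k + 1"
        unfolding k_def rh using divide_nonneg_pos[of r h] r h by (simp_all add: of_nat_nat)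
      have k: "real k * h \<le> r" "r \<le> real k * h + h"
        using k' h by (simp_all add: field_simps)
      have "norm (x (real k * h) - euler b h (x 0) (\<lambda>k. w (real k * h)) k) \<le> \<epsilon> * ((1 + L * h) ^ k - 1)"
      proof (rule euler_error[OF x b eq _ L])
        show "norm (x u - x v) \<le> \<epsilon>" if "u \<in> {0..s}" "v \<in> {0..s}" "\<bar>u - v\<bar> \<le> h" for u v
          using that hd by (intro less_imp_le d(2)) auto
        show "real k * h \<le> s" using k(1) r by simp
      qed (use h in simp_all)
      moreover have "norm (x r - x (real k * h)) < \<epsilon>"
        using d(2)[of r "real k * h"] r k hd h by auto
      moreover have "norm (x r - euler b h (x 0) (\<lambda>k. w (real k * h)) k) \<le>
          norm (x r - x (real k * h)) + norm (x (real k * h) - euler b h (x 0) (\<lambda>k. w (real k * h)) k)"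
        using norm_triangle_ineq[of "x r - x (real k * h)" "x (real k * h) - euler b h (x 0) (\<lambda>k. w (real k * h)) k"] by simp
      ultimately have "norm (x r - euler b h (x 0) (\<lambda>k. w (real k * h)) k) \<le> \<epsilon> * (1 + L * h) ^ k"
        by (simp add: algebra_simps)
      also have "(1 + L * h) ^ k \<le> exp (L * h) ^ k"
        using L h by (intro power_mono exp_ge_add_one_self) auto
      also have "exp (L * h) ^ k = exp (L * (real k * h))" by (simp add: exp_of_nat_mult[symmetric] mult_ac)
      also have "\<dots> \<le> exp (L * s)" using k r L by (auto intro!: mult_left_mono)
      finally have "norm (x r - euler b h (x 0) (\<lambda>k. w (real k * h)) k) \<le> \<epsilon> * exp (L * s)"
        using \<epsilon> by simp
      also have "\<dots> < e" using e by (simp add: \<epsilon>_def)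
      finally show "norm (euler b (s / 2 ^ n) (x 0) (\<lambda>k. w (real k * (s / 2 ^ n))) (nat \<lfloor>r * 2 ^ n / s\<rfloor>) - x r) < e"
        by (simp add: h_def k_def norm_minus_commute)
    qed
  qed
qed

text \<open>Sums over explicit points turn the drift integral into a limit of functions of finitely
  many path coordinates, which are measurable for the product \<sigma>-algebra.\<close>

lemma riemann_sum_limit:
  fixes f :: "real \<Rightarrow> 'e::euclidean_space"
  assumes f: "continuous_on {s..t} f" and st: "s \<le> t"
  shows "(\<lambda>n. \<Sum>j<Suc n. ((t - s) / real (Suc n)) *\<^sub>R f (s + real j * ((t - s) / real (Suc n)))) \<longlonglongrightarrow> integral {s..t} f"
proof (rule LIMSEQ_I)
  fix e :: real assume e: "e > 0"
  define \<epsilon> where "\<epsilon> = e / (t - s + 1)"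
  have \<epsilon>: "\<epsilon> > 0" using e st by (simp add: \<epsilon>_def)
  obtain d where d: "d > 0" "\<And>u v. u \<in> {s..t} \<Longrightarrow> v \<in> {s..t} \<Longrightarrow> \<bar>u - v\<bar> < d \<Longrightarrow> norm (f u - f v) < \<epsilon>"
    using uniformly_continuous_interval[OF f \<epsilon>] by blast
  obtain n0 where n0: "(t - s) / d < real n0" using reals_Archimedean2 by blast
  show "\<exists>no. \<forall>n\<ge>no. norm ((\<Sum>j<Suc n. ((t - s) / real (Suc n)) *\<^sub>R f (s + real j * ((t - s) / real (Suc n)))) - integral {s..t} f) < e"
  proof (intro exI[of _ n0] allI impI)
    fix n assume n: "n \<ge> n0"
    define h where "h = (t - s) / real (Suc n)"
    have h: "h \<ge> 0" using st by (simp add: h_def)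
    have hn: "real (Suc n) * h = t - s" by (simp add: h_def)
    have "(t - s) / d < real (Suc n)" using n0 n by linarith
    then have hd: "h < d" using d(1) by (simp add: h_def field_simps)
    have "norm (integral {s..s + real k * h} f - (\<Sum>j<k. h *\<^sub>R f (s + real j * h))) \<le> real k * (h * \<epsilon>)"
      if "k \<le> Suc n" for k
      using that
    proof (induction k)
      case 0
      then show ?case by simp
    next
      case (Suc k)
      let ?a = "s + real k * h"
      have S: "s + real (Suc k) * h = ?a + h" by (simp add: algebra_simps)
      have "real (Suc k) * h \<le> real (Suc n) * h" using Suc.prems h by (intro mult_right_mono) auto
      then have le: "?a + h \<le> t" using hn S by linarith
      have a: "s \<le> ?a" using h by simp
      have comb: "integral {s..?a} f + integral {?a..?a+h} f = integral {s..?a+h} f"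
        using a h le by (intro Henstock_Kurzweil_Integration.integral_combine integrable_continuous_interval
          continuous_on_subset[OF f]) auto
      have near: "norm (integral {?a..?a+h} f - h *\<^sub>R f ?a) \<le> h * \<epsilon>"
      proof (rule integral_minus_rectangle)
        show "continuous_on {?a..?a+h} f" using a le by (intro continuous_on_subset[OF f]) auto
        show "norm (f u - f ?a) \<le> \<epsilon>" if "u \<in> {?a..?a+h}" for u
        proof (intro less_imp_le d(2))
          show "u \<in> {s..t}" using that a le by (meson atLeastAtMost_iff order_trans)
        qed (use that a h le hd in auto)
      qed (use h in auto)
      have "integral {s..?a+h} f - (\<Sum>j<Suc k. h *\<^sub>R f (s + real j * h)) =
        (integral {s..?a} f - (\<Sum>j<k. h *\<^sub>R f (s + real j * h))) + (integral {?a..?a+h} f - h *\<^sub>R f ?a)"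
        using comb by (simp add: algebra_simps)
      also have "norm \<dots> \<le> real k * (h * \<epsilon>) + h * \<epsilon>"
        using Suc near by (intro norm_triangle_le add_mono) auto
      finally show ?case by (simp add: S algebra_simps)
    qed
    from this[of "Suc n"] have "norm (integral {s..t} f - (\<Sum>j<Suc n. h *\<^sub>R f (s + real j * h))) \<le> real (Suc n) * (h * \<epsilon>)"
      using hn by simp
    also have "\<dots> = (t - s) * \<epsilon>" using hn by (simp add: mult.assoc[symmetric])
    also have "\<dots> < (t - s + 1) * \<epsilon>" using \<epsilon> by (intro mult_strict_right_mono) auto
    also have "\<dots> = e" using st by (simp add: \<epsilon>_def)
    finally show "norm ((\<Sum>j<Suc n. ((t - s) / real (Suc n)) *\<^sub>R f (s + real j * ((t - s) / real (Suc n)))) - integral {s..t} f) < e"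
      by (simp add: h_def norm_minus_commute)
  qed
qed

text \<open>Along the solution this is
  \<open>\<sigma> *\<^sub>R (B t \<omega> - B s \<omega>)\<close> almost surely. It is written in
  terms of the path alone, so that it also makes sense for the copies.\<close>

definition noise :: "('e \<Rightarrow> 'e) \<Rightarrow> (real \<Rightarrow> 'w \<Rightarrow> 'e::euclidean_space) \<Rightarrow> real \<Rightarrow> real \<Rightarrow> 'w \<Rightarrow> 'e"
  where "noise b Z s t \<omega> = Z t \<omega> - Z s \<omega> - integral {s..t} (\<lambda>u. b (Z u \<omega>))"

text \<open>The only consequence of the stochastic differential equation that is used. It depends on
  nothing but the law of the trajectory, so it passes from \<open>X\<close> to its copies.\<close>

definition gaussian_noise ::
    "'w measure \<Rightarrow> real \<Rightarrow> ('e \<Rightarrow> 'e) \<Rightarrow> real \<Rightarrow> (real \<Rightarrow> 'w \<Rightarrow> 'e::euclidean_space) \<Rightarrow> bool"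
  where "gaussian_noise P T b \<sigma> Z \<longleftrightarrow> (\<forall>s t. 0 \<le> s \<and> s < t \<and> t \<le> T \<longrightarrow>
    indep_pair P (path_space s) (trajectory s Z) borel (noise b Z s t) \<and>
    (\<forall>v. (\<integral>\<^sup>+\<omega>. ennreal (exp (v \<bullet> noise b Z s t \<omega>)) \<partial>P) = ennreal (exp (\<sigma>\<^sup>2 * (t - s) * (norm v)\<^sup>2 / 2))))"

text \<open>A version of \<open>noise\<close> on the space of all functions. A limit of Riemann sums
  is measurable there whether or not it exists along a given function, whereas the integral of an
  arbitrary function would be out of reach.\<close>

definition noise_functional :: "('e \<Rightarrow> 'e) \<Rightarrow> real \<Rightarrow> real \<Rightarrow> (real \<Rightarrow> 'e::euclidean_space) \<Rightarrow> 'e"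
  where "noise_functional b s t x = x t - x s -
    lim (\<lambda>n. \<Sum>j<Suc n. ((t - s) / real (Suc n)) *\<^sub>R b (x (s + real j * ((t - s) / real (Suc n)))))"

lemma noise_functional_measurable:
  assumes b: "continuous_on UNIV b" and st: "0 \<le> s" "s < t" "t \<le> T"
  shows "noise_functional b s t \<in> measurable (path_space T) (borel :: 'e::euclidean_space measure)"
proof -
  have [measurable]: "b \<in> borel_measurable borel" using b by (rule borel_measurable_continuous_onI)
  have c: "(\<lambda>x. x u) \<in> borel_measurable (path_space T)" if "u \<in> {0..T}" for u
    using that by measurable
  have m: "(\<lambda>x. b (x (s + real j * ((t - s) / real (Suc n))))) \<in> borel_measurable (path_space T)"
    if "j < Suc n" for j n
  proof (rule measurable_compose[OF c \<open>b \<in> borel_measurable borel\<close>])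
    have "real j * ((t - s) / real (Suc n)) \<le> real (Suc n) * ((t - s) / real (Suc n))"
      using that st by (intro mult_right_mono) auto
    then show "s + real j * ((t - s) / real (Suc n)) \<in> {0..T}" using st by simp
  qed
  have [measurable]: "(\<lambda>x. x t) \<in> borel_measurable (path_space T)" "(\<lambda>x. x s) \<in> borel_measurable (path_space T)"
    using st by (auto intro: c)
  have "(\<lambda>x. lim (\<lambda>n. \<Sum>j<Suc n. ((t - s) / real (Suc n)) *\<^sub>R b (x (s + real j * ((t - s) / real (Suc n)))))) \<in> borel_measurable (path_space T)"
    by (intro borel_measurable_lim_metric borel_measurable_sum borel_measurable_scaleR m) (simp_all only: lessThan_iff borel_measurable_const)
  then show ?thesis unfolding noise_functional_def by measurable
qed

lemma noise_eq_functional: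
  assumes b: "continuous_on UNIV b" and Z: "continuous_on {0..T} (\<lambda>t. Z t \<omega>)" and st: "0 \<le> s" "s < t" "t \<le> T"
  shows "noise b Z s t \<omega> = noise_functional b s t (trajectory T Z \<omega>)"
proof -
  have "continuous_on {s..t} (\<lambda>u. b (Z u \<omega>))"
    using st by (intro continuous_on_compose2[OF b continuous_on_subset[OF Z]]) auto
  from limI[OF riemann_sum_limit[OF this]] st
  have "integral {s..t} (\<lambda>u. b (Z u \<omega>)) =
    lim (\<lambda>n. \<Sum>j<Suc n. ((t - s) / real (Suc n)) *\<^sub>R b (Z (s + real j * ((t - s) / real (Suc n))) \<omega>))" by simp
  also have "\<dots> = lim (\<lambda>n. \<Sum>j<Suc n. ((t - s) / real (Suc n)) *\<^sub>R b (trajectory T Z \<omega> (s + real j * ((t - s) / real (Suc n)))))"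
  proof (intro arg_cong[where f = lim] ext sum.cong refl)
    fix n j assume j: "j \<in> {..<Suc n}"
    have "real j * ((t - s) / real (Suc n)) \<le> real (Suc n) * ((t - s) / real (Suc n))"
      using j st by (intro mult_right_mono) auto
    then have "s + real j * ((t - s) / real (Suc n)) \<in> {0..T}" using st by simp
    then show "((t - s) / real (Suc n)) *\<^sub>R b (Z (s + real j * ((t - s) / real (Suc n))) \<omega>) =
      ((t - s) / real (Suc n)) *\<^sub>R b (trajectory T Z \<omega> (s + real j * ((t - s) / real (Suc n))))"
      by (simp add: trajectory_def)
  qed
  finally show ?thesis using st by (simp add: noise_def noise_functional_def trajectory_def)
qed

context
  fixes M :: "'w measure" and b :: "'e::euclidean_space \<Rightarrow> 'e" and T s t :: real and Z :: "real \<Rightarrow> 'w \<Rightarrow> 'e"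
  assumes b: "continuous_on UNIV b" and Z: "continuous_process M T Z" and st: "0 \<le> s" "s < t" "t \<le> T"
begin

lemma trajectory_measurable_process: "trajectory T Z \<in> measurable M (path_space T)"
  using Z by (intro measurable_trajectory) (auto simp: continuous_process_def)

lemma noise_functional_trajectory:
  "\<omega> \<in> space M \<Longrightarrow> noise b Z s t \<omega> = noise_functional b s t (trajectory T Z \<omega>)"
  using Z by (intro noise_eq_functional[OF b _ st]) (auto simp: continuous_process_def)

lemma trajectory_restrict: "trajectory s Z \<omega> = restrict (trajectory T Z \<omega>) {0..s}"
  using st by (auto simp: trajectory_def restrict_def)

lemma restrict_path_measurable:
  "(\<lambda>x. restrict x {0..s}) \<in> measurable (path_space T) (path_space s :: (real \<Rightarrow> 'e) measure)"
  using st by (intro measurable_restrict_subset) auto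

lemma noise_measurable: "noise b Z s t \<in> borel_measurable M"
  using measurable_compose[OF trajectory_measurable_process noise_functional_measurable[OF b st]]
  by (rule measurable_cong[THEN iffD1, rotated]) (simp add: noise_functional_trajectory)

lemma trajectory_measurable_restrict: "trajectory s Z \<in> measurable M (path_space s)"
  unfolding trajectory_restrict
  by (rule measurable_compose[OF trajectory_measurable_process restrict_path_measurable])

lemma distr_noise:
  "distr M borel (noise b Z s t) = distr (distr M (path_space T) (trajectory T Z)) borel (noise_functional b s t)"
  unfolding distr_distr[OF noise_functional_measurable[OF b st] trajectory_measurable_process]
  by (rule distr_cong) (simp_all add: noise_functional_trajectory)

lemma distr_trajectory:
  "distr M (path_space s) (trajectory s Z) =
    distr (distr M (path_space T) (trajectory T Z)) (path_space s) (\<lambda>x. restrict x {0..s})"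
  unfolding distr_distr[OF restrict_path_measurable trajectory_measurable_process]
  by (rule distr_cong) (simp_all add: trajectory_restrict)

lemma distr_trajectory_noise:
  "distr M (path_space s \<Otimes>\<^sub>M borel) (\<lambda>\<omega>. (trajectory s Z \<omega>, noise b Z s t \<omega>)) =
    distr (distr M (path_space T) (trajectory T Z)) (path_space s \<Otimes>\<^sub>M borel)
      (\<lambda>x. (restrict x {0..s}, noise_functional b s t x))"
  unfolding distr_distr[OF measurable_Pair[OF restrict_path_measurable noise_functional_measurable[OF b st]]
      trajectory_measurable_process]
  by (rule distr_cong) (simp_all add: noise_functional_trajectory trajectory_restrict)

end

text \<open>Restricted trajectory and noise are measurable functionals of the trajectory on
  \<open>[0,T]\<close>, so both clauses of \<open>gaussian_noise\<close> are statements about image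
  measures of its law.\<close>

lemma gaussian_noise_transfer:
  fixes Z :: "real \<Rightarrow> 'v \<Rightarrow> 'e::euclidean_space"
  assumes g: "gaussian_noise P T b \<sigma> X" and b: "continuous_on UNIV b"
    and X: "continuous_process P T X" and Z: "continuous_process Q T Z"
    and law: "distr Q (path_space T) (trajectory T Z) = distr P (path_space T) (trajectory T X)"
  shows "gaussian_noise Q T b \<sigma> Z"
  unfolding gaussian_noise_def
proof (intro allI impI conjI)
  fix s t assume *: "0 \<le> s \<and> s < t \<and> t \<le> T"
  then have st: "0 \<le> s" "s < t" "t \<le> T" by auto
  have "indep_pair P (path_space s) (trajectory s X) borel (noise b X s t)"
    using g * unfolding gaussian_noise_def by blast
  then show "indep_pair Q (path_space s) (trajectory s Z) borel (noise b Z s t)"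
    unfolding indep_pair_def
    using trajectory_measurable_restrict[OF b Z st] noise_measurable[OF b Z st]
    by (simp only: distr_noise[OF b Z st] distr_noise[OF b X st] distr_trajectory[OF b Z st] distr_trajectory[OF b X st]
        distr_trajectory_noise[OF b Z st] distr_trajectory_noise[OF b X st] law simp_thms)
  fix v :: 'e
  have "(\<integral>\<^sup>+\<omega>. ennreal (exp (v \<bullet> noise b Z s t \<omega>)) \<partial>Q) = (\<integral>\<^sup>+x. ennreal (exp (v \<bullet> x)) \<partial>distr Q borel (noise b Z s t))"
    by (rule nn_integral_distr[symmetric]) (auto intro: noise_measurable[OF b Z st])
  also have "distr Q borel (noise b Z s t) = distr P borel (noise b X s t)"
    by (simp only: distr_noise[OF b Z st] distr_noise[OF b X st] law)
  also have "(\<integral>\<^sup>+x. ennreal (exp (v \<bullet> x)) \<partial>distr P borel (noise b X s t)) = (\<integral>\<^sup>+\<omega>. ennreal (exp (v \<bullet> noise b X s t \<omega>)) \<partial>P)"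
    by (rule nn_integral_distr) (auto intro: noise_measurable[OF b X st])
  also have "\<dots> = ennreal (exp (\<sigma>\<^sup>2 * (t - s) * (norm v)\<^sup>2 / 2))"
    using g * unfolding gaussian_noise_def by blast
  finally show "(\<integral>\<^sup>+\<omega>. ennreal (exp (v \<bullet> noise b Z s t \<omega>)) \<partial>Q) = ennreal (exp (\<sigma>\<^sup>2 * (t - s) * (norm v)\<^sup>2 / 2))" .
qed

section \<open>Brownian increments: exponential moments and independence of the past\<close>

lemma nn_integral_normal_density: "s > 0 \<Longrightarrow> (\<integral>\<^sup>+x. ennreal (normal_density m s x) \<partial>lborel) = 1"
  using prob_space.emeasure_space_1[OF prob_space_normal_density[of s m]] by (simp add: emeasure_density)

text \<open>Completing the square in the exponent shifts the mean to \<open>a * s^2\<close> and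
  leaves the constant factor \<open>exp (a^2 * s^2 / 2)\<close>.\<close>

lemma normal_mgf:
  assumes s: "s > 0"
  shows "(\<integral>\<^sup>+x. ennreal (normal_density 0 s x) * ennreal (exp (a * x)) \<partial>lborel) = ennreal (exp (a\<^sup>2 * s\<^sup>2 / 2))"
proof -
  have eq: "normal_density 0 s x * exp (a * x) = exp (a\<^sup>2 * s\<^sup>2 / 2) * normal_density (a * s\<^sup>2) s x" for x
  proof -
    have "- (x\<^sup>2 / (2 * s\<^sup>2)) + a * x = a\<^sup>2 * s\<^sup>2 / 2 - (x - a * s\<^sup>2)\<^sup>2 / (2 * s\<^sup>2)"
      using s by (simp add: field_simps power2_eq_square)
    then have "exp (- (x\<^sup>2 / (2 * s\<^sup>2))) * exp (a * x) = exp (a\<^sup>2 * s\<^sup>2 / 2) * exp (- ((x - a * s\<^sup>2)\<^sup>2 / (2 * s\<^sup>2)))"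
      by (simp flip: exp_add)
    then show ?thesis by (simp add: normal_density_def)
  qed
  have "(\<integral>\<^sup>+x. ennreal (normal_density 0 s x) * ennreal (exp (a * x)) \<partial>lborel) =
      (\<integral>\<^sup>+x. ennreal (exp (a\<^sup>2 * s\<^sup>2 / 2)) * ennreal (normal_density (a * s\<^sup>2) s x) \<partial>lborel)"
    by (intro nn_integral_cong) (simp add: eq flip: ennreal_mult)
  also have "\<dots> = ennreal (exp (a\<^sup>2 * s\<^sup>2 / 2))"
    using s by (simp add: nn_integral_cmult nn_integral_normal_density)
  finally show ?thesis .
qed

lemma brownian_increment_mgf:
  fixes B :: "real \<Rightarrow> 'w \<Rightarrow> 'e::euclidean_space"
  assumes P: "prob_space P" and B: "brownian_motion P T B" and st: "0 \<le> s" "s < t" "t \<le> T"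
  shows "(\<integral>\<^sup>+\<omega>. ennreal (exp (v \<bullet> (B t \<omega> - B s \<omega>))) \<partial>P) = ennreal (exp ((t - s) * (norm v)\<^sup>2 / 2))"
proof -
  interpret prob_space P by fact
  let ?D = "\<lambda>b \<omega>. (B t \<omega> - B s \<omega>) \<bullet> b"
  have dist: "distributed P lborel (?D b) (\<lambda>x. ennreal (normal_density 0 (sqrt (t - s)) x))" if "b \<in> Basis" for b
    using B st that unfolding brownian_motion_def by blast
  have ind: "indep_vars (\<lambda>_. borel) ?D Basis"
    using B st unfolding brownian_motion_def by blast
  have "(\<integral>\<^sup>+\<omega>. ennreal (exp (v \<bullet> (B t \<omega> - B s \<omega>))) \<partial>P) =
      (\<integral>\<^sup>+\<omega>. (\<Prod>b\<in>Basis. ennreal (exp ((v \<bullet> b) * ?D b \<omega>))) \<partial>P)"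
  proof (intro nn_integral_cong)
    fix \<omega>
    have "exp (v \<bullet> (B t \<omega> - B s \<omega>)) = (\<Prod>b\<in>Basis. exp ((v \<bullet> b) * ?D b \<omega>))"
      by (subst euclidean_inner) (simp only: exp_sum[OF finite_Basis])
    then show "ennreal (exp (v \<bullet> (B t \<omega> - B s \<omega>))) = (\<Prod>b\<in>Basis. ennreal (exp ((v \<bullet> b) * ?D b \<omega>)))"
      by (simp only: prod_ennreal[OF exp_ge_zero])
  qed
  also have "\<dots> = (\<Prod>b\<in>Basis. \<integral>\<^sup>+\<omega>. ennreal (exp ((v \<bullet> b) * ?D b \<omega>)) \<partial>P)"
    by (intro indep_vars_nn_integral indep_vars_compose2[OF ind]) auto
  also have "\<dots> = (\<Prod>b\<in>(Basis::'e set). ennreal (exp ((v \<bullet> b)\<^sup>2 * (t - s) / 2)))"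
  proof (intro prod.cong refl)
    fix b :: 'e assume b: "b \<in> Basis"
    have "(\<integral>\<^sup>+\<omega>. ennreal (exp ((v \<bullet> b) * ?D b \<omega>)) \<partial>P) =
        (\<integral>\<^sup>+x. ennreal (normal_density 0 (sqrt (t - s)) x) * ennreal (exp ((v \<bullet> b) * x)) \<partial>lborel)"
      by (rule distributed_nn_integral[OF dist[OF b], symmetric]) simp
    then show "(\<integral>\<^sup>+\<omega>. ennreal (exp ((v \<bullet> b) * ?D b \<omega>)) \<partial>P) = ennreal (exp ((v \<bullet> b)\<^sup>2 * (t - s) / 2))"
      using st by (simp add: normal_mgf)
  qed
  also have "\<dots> = ennreal (exp (\<Sum>b\<in>Basis. (v \<bullet> b)\<^sup>2 * (t - s) / 2))"
    by (simp add: exp_sum prod_ennreal)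
  also have "(\<Sum>b\<in>Basis. (v \<bullet> b)\<^sup>2 * (t - s) / 2) = (t - s) * (norm v)\<^sup>2 / 2"
  proof -
    have "(norm v)\<^sup>2 = (\<Sum>b\<in>Basis. (v \<bullet> b)\<^sup>2)"
      unfolding power2_norm_eq_inner by (subst euclidean_inner) (simp add: power2_eq_square)
    then show ?thesis by (simp add: sum_distrib_left sum_divide_distrib mult.commute)
  qed
  finally show ?thesis .
qed

text \<open>Subtracting \<open>B 0\<close> makes this a function of increments everywhere and not
  merely off the null set where \<open>B 0\<close> differs from 0. The index set contains both end
  points of the grid.\<close>

definition dyadic_path :: "(real \<Rightarrow> 'w \<Rightarrow> 'e::euclidean_space) \<Rightarrow> real \<Rightarrow> nat \<Rightarrow> 'w \<Rightarrow> nat \<Rightarrow> 'e"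
  where "dyadic_path B s n \<omega> = (\<lambda>k\<in>{..2 ^ n}. B (real k * (s / 2 ^ n)) \<omega> - B 0 \<omega>)"

lemma dyadic_time: "0 \<le> s \<Longrightarrow> k \<le> 2 ^ n \<Longrightarrow> real k * (s / 2 ^ n) \<in> {0..s}"
proof -
  assume s: "0 \<le> s" and k: "k \<le> 2 ^ n"
  then have "real k \<le> 2 ^ n" by (metis of_nat_le_iff of_nat_numeral of_nat_power)
  then have "real k * (s / 2 ^ n) \<le> 2 ^ n * (s / 2 ^ n)" using s by (intro mult_right_mono) auto
  then show ?thesis using s by simp
qed

lemma dyadic_path_refine:
  assumes "n \<le> m"
  shows "dyadic_path B s n \<omega> = (\<lambda>k\<in>{..2 ^ n}. dyadic_path B s m \<omega> (k * 2 ^ (m - n)))"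
proof
  fix k
  show "dyadic_path B s n \<omega> k = (\<lambda>k\<in>{..2 ^ n}. dyadic_path B s m \<omega> (k * 2 ^ (m - n))) k"
  proof (cases "k \<le> 2 ^ n")
    case True
    have p: "(2::nat) ^ m = 2 ^ n * 2 ^ (m - n)" "(2::real) ^ m = 2 ^ n * 2 ^ (m - n)"
      using assms by (simp_all flip: power_add)
    then have "k * 2 ^ (m - n) \<le> 2 ^ m" using True by simp
    moreover have "real (k * 2 ^ (m - n)) * (s / 2 ^ m) = real k * (s / 2 ^ n)"
      using p by simp
    ultimately show ?thesis using True by (simp add: dyadic_path_def)
  qed (simp add: dyadic_path_def)
qed

text \<open>The increments over the dyadic grid of \<open>[0,s]\<close>, followed by the increment
  from \<open>s\<close> to \<open>t\<close>, form one independent family. The dyadic path consists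
  of partial sums of all members but the last.\<close>

lemma dyadic_path_indep:
  fixes B :: "real \<Rightarrow> 'w \<Rightarrow> 'e::euclidean_space"
  assumes P: "prob_space P" and B: "brownian_motion P T B" and st: "0 \<le> s" "s < t" "t \<le> T"
    and E: "E \<in> sets (Pi\<^sub>M {..2 ^ n} (\<lambda>_. borel))" and C: "C \<in> sets borel"
  shows "measure P ((dyadic_path B s n -` E \<inter> space P) \<inter> ((\<lambda>\<omega>. B t \<omega> - B s \<omega>) -` C \<inter> space P)) =
    measure P (dyadic_path B s n -` E \<inter> space P) * measure P ((\<lambda>\<omega>. B t \<omega> - B s \<omega>) -` C \<inter> space P)"
proof -
  interpret prob_space P by fact
  \<comment> \<open>For \<open>s = 0\<close> all grid points coincide, while independence of
    increments is available for strictly increasing times only; the grid then shrinks to one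
    point.\<close>
  define N :: nat where "N = (if s = 0 then 0 else 2 ^ n)"
  define ts where "ts j = (if j \<le> N then real j * (s / 2 ^ n) else t)" for j
  define I where "I = (\<lambda>j \<omega>. B (ts (Suc j)) \<omega> - B (ts j) \<omega>)"
  have tsN: "ts N = s" by (simp add: ts_def N_def)
  have mem: "ts j \<in> {0..T}" if "j \<le> Suc N" for j
  proof (cases "j \<le> N")
    case True
    then have "j \<le> 2 ^ n" by (auto simp: N_def split: if_splits)
    then have "real j * (s / 2 ^ n) \<in> {0..s}" using st by (intro dyadic_time) auto
    then show ?thesis using True st by (auto simp: ts_def)
  qed (use that st in \<open>auto simp: ts_def\<close>)
  have less: "ts j < ts (Suc j)" if "j < Suc N" for j
  proof (cases "j = N")
    case True
    then show ?thesis using tsN st by (simp add: ts_def)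
  next
    case False
    then have "j < N" using that by simp
    moreover from this have "s > 0" using st by (auto simp: N_def split: if_splits)
    ultimately show ?thesis by (simp add: ts_def divide_strict_right_mono)
  qed
  have "indep_vars (\<lambda>_. borel) I {..<Suc N}"
    using B mem less unfolding brownian_motion_def I_def by blast
  then have "indep_var (Pi\<^sub>M {..<N} (\<lambda>_. borel)) (\<lambda>\<omega>. \<lambda>j\<in>{..<N}. I j \<omega>) (Pi\<^sub>M {N} (\<lambda>_. borel)) (\<lambda>\<omega>. \<lambda>j\<in>{N}. I j \<omega>)"
    by (rule indep_var_restrict) auto
  then have ind: "indep_set (sets (vimage_algebra (space P) (\<lambda>\<omega>. \<lambda>j\<in>{..<N}. I j \<omega>) (Pi\<^sub>M {..<N} (\<lambda>_. borel))))
     (sets (vimage_algebra (space P) (\<lambda>\<omega>. \<lambda>j\<in>{N}. I j \<omega>) (Pi\<^sub>M {N} (\<lambda>_. borel))))"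
    (is "indep_set (sets ?F) (sets ?G)")
    by (simp add: indep_var_eq sets_vimage_algebra)
  have D: "(\<lambda>\<omega>. B t \<omega> - B s \<omega>) \<in> borel_measurable ?G"
  proof -
    have "(\<lambda>\<omega>. (\<lambda>j\<in>{N}. I j \<omega>) N) \<in> borel_measurable ?G"
      by (rule measurable_compose[OF measurable_vimage_algebra1 measurable_component_singleton])
        (auto simp: space_PiM PiE_def extensional_def)
    then show ?thesis by (simp add: I_def tsN) (simp add: ts_def)
  qed
  have Im: "I j \<in> borel_measurable ?F" if "j < N" for j
  proof -
    have "(\<lambda>\<omega>. (\<lambda>j\<in>{..<N}. I j \<omega>) j) \<in> borel_measurable ?F"
      by (rule measurable_compose[OF measurable_vimage_algebra1 measurable_component_singleton])
        (use that in \<open>auto simp: space_PiM PiE_def extensional_def\<close>)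
    then show ?thesis using that by simp
  qed
  have Y: "dyadic_path B s n \<in> measurable ?F (Pi\<^sub>M {..2 ^ n} (\<lambda>_. borel))"
    unfolding dyadic_path_def
  proof (rule measurable_restrict)
    fix k :: nat assume k: "k \<in> {..2 ^ n}"
    show "(\<lambda>\<omega>. B (real k * (s / 2 ^ n)) \<omega> - B 0 \<omega>) \<in> borel_measurable ?F"
    proof (cases "s = 0")
      case True
      then show ?thesis by simp
    next
      case False
      then have kN: "k \<le> N" using k by (simp add: N_def)
      have "(\<Sum>j<k. I j \<omega>) = B (real k * (s / 2 ^ n)) \<omega> - B 0 \<omega>" for \<omega>
        unfolding I_def by (subst sum_lessThan_telescope) (use kN in \<open>simp add: ts_def\<close>)
      moreover have "(\<lambda>\<omega>. \<Sum>j<k. I j \<omega>) \<in> borel_measurable ?F"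
        using kN by (intro borel_measurable_sum Im) auto
      ultimately show ?thesis by simp
    qed
  qed
  show ?thesis
    using indep_setD[OF ind, of "dyadic_path B s n -` E \<inter> space P" "(\<lambda>\<omega>. B t \<omega> - B s \<omega>) -` C \<inter> space P"]
      measurable_sets[OF Y E] measurable_sets[OF D C] by simp
qed

text \<open>The solution up to time \<open>s\<close> is a limit of Euler schemes on dyadic grids of \<open>[0,s]\<close>, and those are
  functions of \<open>X\<^sub>0\<close> and of increments of \<open>B\<close> before time \<open>s\<close>. Refining grids generate an
  intersection-stable system, from which independence extends.\<close>

lemma solution_gaussian_noise:
  fixes X B :: "real \<Rightarrow> 'w \<Rightarrow> 'e::euclidean_space"
  assumes P: "prob_space P" and X: "continuous_process P T X" and B: "brownian_motion P T B"
    and ind0: "prob_space.indep_set P (sets (vimage_algebra (space P) (X 0) borel))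
      (sets (vimage_algebra (space P) (trajectory T B) (path_space T)))"
    and eq: "AE \<omega> in P. \<forall>t\<in>{0..T}. X t \<omega> = X 0 \<omega> + (LBINT u:{0..t}. b (X u \<omega>)) + \<sigma> *\<^sub>R B t \<omega>"
    and lip: "\<And>y z. norm (b y - b z) \<le> L * norm (y - z)" and L: "L \<ge> 0"
  shows "gaussian_noise P T b \<sigma> X"
  unfolding gaussian_noise_def
proof (intro allI impI)
  fix s t assume "0 \<le> s \<and> s < t \<and> t \<le> T"
  then have st: "0 \<le> s" "s < t" "t \<le> T" by auto
  interpret prob_space P by fact
  have "L-lipschitz_on UNIV b" using lip L by (intro lipschitz_onI) (auto simp: dist_norm)
  then have bc: "continuous_on UNIV b" by (rule lipschitz_on_continuous_on)
  have bm: "b \<in> borel_measurable borel" using bc by (rule borel_measurable_continuous_onI)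
  define D where "D = (\<lambda>\<omega>. B t \<omega> - B s \<omega>)"
  define Y where "Y = dyadic_path B s"
  let ?FB = "vimage_algebra (space P) (trajectory T B) (path_space T)"
  let ?FX = "vimage_algebra (space P) (X 0) borel"
  have Bm: "B r \<in> borel_measurable ?FB" if "r \<in> {0..T}" for r
    using that by (rule trajectory_component)
  have DB: "D \<in> borel_measurable ?FB" unfolding D_def using st by (intro borel_measurable_diff Bm) auto
  have YB: "Y n \<in> measurable ?FB (Pi\<^sub>M {..2 ^ n} (\<lambda>_. borel))" for n
    unfolding Y_def dyadic_path_def
  proof (intro measurable_restrict borel_measurable_diff Bm)
    fix k :: nat assume "k \<in> {..2 ^ n}"
    then have "real k * (s / 2 ^ n) \<in> {0..s}" using st by (intro dyadic_time) auto
    then show "real k * (s / 2 ^ n) \<in> {0..T}" using st by auto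
  qed (use st in auto)
  have FB: "sets ?FB \<subseteq> events" using indep_setD_ev2[OF ind0] .
  have FX: "sets ?FX \<subseteq> events" using indep_setD_ev1[OF ind0] .
  define G where "G = {(X 0 -` A \<inter> space P) \<inter> (Y n -` E \<inter> space P) | n A E.
     A \<in> sets borel \<and> E \<in> sets (Pi\<^sub>M {..2 ^ n} (\<lambda>_. borel))}"
  define H where "H = {D -` C \<inter> space P | C. C \<in> sets borel}"
  have X0: "X 0 -` A \<inter> space P \<in> sets ?FX" if "A \<in> sets borel" for A
    using that by (rule in_vimage_algebra)
  have Ys: "Y n -` E \<inter> space P \<in> sets ?FB" if "E \<in> sets (Pi\<^sub>M {..2 ^ n} (\<lambda>_. borel))" for n E
    using measurable_sets[OF YB that] by simp
  have Ds: "D -` C \<inter> space P \<in> sets ?FB" if "C \<in> sets borel" for C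
    using measurable_sets[OF DB that] by simp
  \<comment> \<open>The initial value is split off from the pair of dyadic path and later increment
    by \<open>ind0\<close>, then the dyadic path from the increment by
    \<open>dyadic_path_indep\<close>; a second use of \<open>ind0\<close> puts the two past factors
    together again.\<close>
  have indGH: "indep_set G H"
  proof (rule indep_setI)
    show "G \<subseteq> events"
    proof
      fix a assume "a \<in> G"
      then obtain n A E where "A \<in> sets borel" "E \<in> sets (Pi\<^sub>M {..2 ^ n} (\<lambda>_. borel))"
        and a: "a = (X 0 -` A \<inter> space P) \<inter> (Y n -` E \<inter> space P)"
        unfolding G_def by blast
      then show "a \<in> events"
        unfolding a by (intro sets.Int subsetD[OF FX X0] subsetD[OF FB Ys])
    qed
    show "H \<subseteq> events" using Ds FB by (auto simp: H_def)
    fix a c assume "a \<in> G" "c \<in> H"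
    then obtain n A E C where A: "A \<in> sets borel" and E: "E \<in> sets (Pi\<^sub>M {..2 ^ n} (\<lambda>_. borel))" and C: "C \<in> sets borel"
      and a: "a = (X 0 -` A \<inter> space P) \<inter> (Y n -` E \<inter> space P)" and c: "c = D -` C \<inter> space P"
      by (auto simp: G_def H_def)
    have "prob (a \<inter> c) = prob ((X 0 -` A \<inter> space P) \<inter> ((Y n -` E \<inter> space P) \<inter> c))"
      by (simp add: a Int_assoc)
    also have "\<dots> = prob (X 0 -` A \<inter> space P) * prob ((Y n -` E \<inter> space P) \<inter> c)"
      using X0[OF A] Ys[OF E] Ds[OF C] by (intro indep_setD[OF ind0]) (auto simp: c)
    also have "prob ((Y n -` E \<inter> space P) \<inter> c) = prob (Y n -` E \<inter> space P) * prob c"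
      unfolding c D_def Y_def by (rule dyadic_path_indep[OF P B st E C])
    also have "prob (X 0 -` A \<inter> space P) * (prob (Y n -` E \<inter> space P) * prob c) = prob a * prob c"
      unfolding a using indep_setD[OF ind0 X0[OF A] Ys[OF E]] by simp
    finally show "prob (a \<inter> c) = prob a * prob c" .
  qed
  have refine: "\<exists>E'\<in>sets (Pi\<^sub>M {..2 ^ m} (\<lambda>_. borel)). Y n -` E \<inter> space P = Y m -` E' \<inter> space P"
    if nm: "n \<le> m" and E: "E \<in> sets (Pi\<^sub>M {..2 ^ n} (\<lambda>_. borel))" for n m and E :: "(nat \<Rightarrow> 'e) set"
  proof -
    let ?r = "\<lambda>f::nat \<Rightarrow> 'e. \<lambda>k\<in>{..2 ^ n::nat}. f (k * 2 ^ (m - n))"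
    have r: "?r \<in> measurable (Pi\<^sub>M {..2 ^ m} (\<lambda>_. borel)) (Pi\<^sub>M {..2 ^ n} (\<lambda>_. borel))"
    proof (intro measurable_restrict measurable_component_singleton)
      fix k :: nat assume "k \<in> {..2 ^ n}"
      then have "k * 2 ^ (m - n) \<le> 2 ^ n * 2 ^ (m - n)" by simp
      also have "\<dots> = 2 ^ m" using nm by (simp flip: power_add)
      finally show "k * 2 ^ (m - n) \<in> {..2 ^ m}" by simp
    qed
    have "Y n \<omega> = ?r (Y m \<omega>)" for \<omega> unfolding Y_def by (rule dyadic_path_refine[OF nm])
    moreover have "Y m \<omega> \<in> space (Pi\<^sub>M {..2 ^ m} (\<lambda>_. borel))" for \<omega>
      by (simp add: Y_def dyadic_path_def space_PiM)
    ultimately show ?thesis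
      by (intro bexI[OF _ measurable_sets[OF r E]]) auto
  qed
  have stG: "Int_stable G"
  proof (rule Int_stableI)
    fix a a' assume "a \<in> G" "a' \<in> G"
    then obtain n A E n' A' E' where A: "A \<in> sets borel" "A' \<in> sets borel"
      and E: "E \<in> sets (Pi\<^sub>M {..2 ^ n} (\<lambda>_. borel))" "E' \<in> sets (Pi\<^sub>M {..2 ^ n'} (\<lambda>_. borel))"
      and a: "a = (X 0 -` A \<inter> space P) \<inter> (Y n -` E \<inter> space P)" "a' = (X 0 -` A' \<inter> space P) \<inter> (Y n' -` E' \<inter> space P)"
      unfolding G_def by blast
    obtain F where F: "F \<in> sets (Pi\<^sub>M {..2 ^ max n n'} (\<lambda>_. borel))" "Y n -` E \<inter> space P = Y (max n n') -` F \<inter> space P"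
      using refine[OF max.cobounded1 E(1)] by blast
    obtain F' where F': "F' \<in> sets (Pi\<^sub>M {..2 ^ max n n'} (\<lambda>_. borel))" "Y n' -` E' \<inter> space P = Y (max n n') -` F' \<inter> space P"
      using refine[OF max.cobounded2 E(2)] by blast
    have "a \<inter> a' = (X 0 -` (A \<inter> A') \<inter> space P) \<inter> (Y (max n n') -` (F \<inter> F') \<inter> space P)"
      unfolding a F(2) F'(2) by auto
    then show "a \<inter> a' \<in> G" using A F(1) F'(1) unfolding G_def by blast
  qed
  have stH: "Int_stable H"
  proof (rule Int_stableI)
    fix c c' assume "c \<in> H" "c' \<in> H"
    then obtain C C' where C: "C \<in> sets borel" "C' \<in> sets borel" "c = D -` C \<inter> space P" "c' = D -` C' \<inter> space P"
      by (auto simp: H_def)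
    then have "c \<inter> c' = D -` (C \<inter> C') \<inter> space P" by auto
    then show "c \<inter> c' \<in> H" using C unfolding H_def by blast
  qed
  define FG where "FG = sigma (space P) G"
  define FH where "FH = sigma (space P) H"
  have GH: "G \<subseteq> Pow (space P)" "H \<subseteq> Pow (space P)" by (auto simp: G_def H_def)
  have sFG: "space FG = space P" "sets FG = sigma_sets (space P) G"
    and sFH: "space FH = space P" "sets FH = sigma_sets (space P) H"
    using GH by (simp_all add: FG_def FH_def)
  have ind: "indep_set (sets FG) (sets FH)"
    unfolding sFG sFH by (rule indep_set_sigma_sets[OF indGH stG stH])
  have DFH: "D \<in> borel_measurable FH"
    by (rule measurableI) (auto simp: sFH H_def)
  have X0G: "X 0 \<in> borel_measurable FG"
  proof (rule measurableI)
    fix A :: "'e set" assume A: "A \<in> sets borel"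
    have "X 0 -` A \<inter> space P = (X 0 -` A \<inter> space P) \<inter> (Y 0 -` space (Pi\<^sub>M {..2 ^ 0} (\<lambda>_. borel)) \<inter> space P)"
      by (auto simp: Y_def dyadic_path_def space_PiM)
    also have "\<dots> \<in> G" unfolding G_def using A by blast
    finally show "X 0 -` A \<inter> space FG \<in> sets FG" by (simp add: sFG)
  qed simp
  have YG: "Y n \<in> measurable FG (Pi\<^sub>M {..2 ^ n} (\<lambda>_. borel))" for n
  proof (rule measurableI)
    fix E :: "(nat \<Rightarrow> 'e) set" assume E: "E \<in> sets (Pi\<^sub>M {..2 ^ n} (\<lambda>_. borel))"
    have "Y n -` E \<inter> space P = (X 0 -` UNIV \<inter> space P) \<inter> (Y n -` E \<inter> space P)" by auto
    also have "\<dots> \<in> G"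
      unfolding G_def by (intro CollectI exI[of _ n] exI[of _ UNIV] exI[of _ E] conjI refl E) simp
    finally show "Y n -` E \<inter> space FG \<in> sets FG" by (simp add: sFG)
  qed (auto simp: Y_def dyadic_path_def space_PiM)
  define e where "e = (\<lambda>n k \<omega>. euler b (s / 2 ^ n) (X 0 \<omega>) (\<lambda>k. \<sigma> *\<^sub>R (B (real k * (s / 2 ^ n)) \<omega> - B 0 \<omega>)) k)"
  have wG: "(\<lambda>\<omega>. B (real k * (s / 2 ^ n)) \<omega> - B 0 \<omega>) \<in> borel_measurable FG" if "k \<le> 2 ^ n" for n k
  proof -
    have "(\<lambda>\<omega>. Y n \<omega> k) \<in> borel_measurable FG"
      by (rule measurable_compose[OF YG measurable_component_singleton]) (use that in auto)
    then show ?thesis using that by (simp add: Y_def dyadic_path_def)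
  qed
  have eG: "e n k \<in> borel_measurable FG" if "k \<le> 2 ^ n" for n k
    using that
  proof (induction k)
    case 0
    then show ?case using X0G by (simp add: e_def)
  next
    case (Suc k)
    have "(\<lambda>\<omega>. e n k \<omega> + (s / 2 ^ n) *\<^sub>R b (e n k \<omega>) +
        (\<sigma> *\<^sub>R (B (real (Suc k) * (s / 2 ^ n)) \<omega> - B 0 \<omega>) - \<sigma> *\<^sub>R (B (real k * (s / 2 ^ n)) \<omega> - B 0 \<omega>))) \<in> borel_measurable FG"
      using Suc by (intro borel_measurable_add borel_measurable_diff borel_measurable_scaleR borel_measurable_const
          measurable_compose[OF _ bm] wG) auto
    then show ?case by (simp add: e_def)
  qed
  \<comment> \<open>A version of the solution that is measurable for the \<sigma>-algebra generated
    by \<open>G\<close> itself, without completion. It equals \<open>X\<close> only where the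
    equation holds and \<open>B\<close> starts in 0.\<close>
  define X' where "X' = (\<lambda>r \<omega>. lim (\<lambda>n. e n (nat \<lfloor>r * 2 ^ n / s\<rfloor>) \<omega>))"
  have X'G: "X' r \<in> borel_measurable FG" if r: "r \<in> {0..s}" for r
    unfolding X'_def
  proof (intro borel_measurable_lim_metric eG)
    fix n
    have "r * 2 ^ n / s \<le> 2 ^ n" using r st by (cases "s = 0") (auto simp: divide_le_eq mult.commute)
    then have "\<lfloor>r * 2 ^ n / s\<rfloor> \<le> 2 ^ n" by (metis floor_mono floor_of_int of_int_numeral of_int_power)
    then show "nat \<lfloor>r * 2 ^ n / s\<rfloor> \<le> 2 ^ n" by (simp add: nat_le_iff)
  qed
  have trX': "trajectory s X' \<in> measurable FG (path_space s)"
    by (rule measurable_trajectory) (rule X'G)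
  have pair: "indep_pair P (path_space s) (trajectory s X') borel (\<lambda>\<omega>. \<sigma> *\<^sub>R D \<omega>)"
    by (rule indep_set_imp_indep_pair[OF ind sFG(1) sFH(1) trX'])
      (intro borel_measurable_scaleR borel_measurable_const DFH)
  have B0: "AE \<omega> in P. B 0 \<omega> = 0" using B by (simp add: brownian_motion_def)
  \<comment> \<open>The equation enters here. Its null set serves all times simultaneously, so the
    Euler schemes converge at every time of \<open>[0,s]\<close> off one null set.\<close>
  have "AE \<omega> in P. trajectory s X' \<omega> = trajectory s X \<omega> \<and> \<sigma> *\<^sub>R D \<omega> = noise b X s t \<omega>"
    using eq B0 AE_space
  proof eventually_elim
    case (elim \<omega>)
    have cX: "continuous_on {0..T} (\<lambda>u. X u \<omega>)" using X elim(3) by (auto simp: continuous_process_def)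
    have cb: "continuous_on {0..T} (\<lambda>u. b (X u \<omega>))"
      using cX by (intro continuous_on_compose2[OF bc]) auto
    have eq': "X r \<omega> = X 0 \<omega> + integral {0..r} (\<lambda>u. b (X u \<omega>)) + \<sigma> *\<^sub>R (B r \<omega> - B 0 \<omega>)" if r: "r \<in> {0..T}" for r
    proof -
      have "continuous_on {0..r} (\<lambda>u. b (X u \<omega>))" using r by (intro continuous_on_subset[OF cb]) auto
      then have "set_integrable lborel {0..r} (\<lambda>u. b (X u \<omega>))" by (rule borel_integrable_atLeastAtMost')
      then have "(LBINT u:{0..r}. b (X u \<omega>)) = integral {0..r} (\<lambda>u. b (X u \<omega>))"
        by (rule set_borel_integral_eq_integral)
      with bspec[OF elim(1) r] show ?thesis by (simp only: elim(2) diff_zero)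
    qed
    have "X' r \<omega> = X r \<omega>" if r: "r \<in> {0..s}" for r
      unfolding X'_def e_def
    proof (intro limI euler_limit[where s = s and L = L and x = "\<lambda>u. X u \<omega>" and w = "\<lambda>u. \<sigma> *\<^sub>R (B u \<omega> - B 0 \<omega>)"])
      show "continuous_on {0..s} (\<lambda>u. X u \<omega>)" using st by (intro continuous_on_subset[OF cX]) auto
      show "norm (b y - b z) \<le> L * norm (y - z)" for y z by (rule lip)
      show "X t' \<omega> = X 0 \<omega> + integral {0..t'} (\<lambda>u. b (X u \<omega>)) + \<sigma> *\<^sub>R (B t' \<omega> - B 0 \<omega>)"
        if "t' \<in> {0..s}" for t'
        using that st by (intro eq') auto
    qed (rule L r)+
    then have 1: "trajectory s X' \<omega> = trajectory s X \<omega>"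
      by (auto simp: trajectory_def restrict_def)
    have "integral {0..s} (\<lambda>u. b (X u \<omega>)) + integral {s..t} (\<lambda>u. b (X u \<omega>)) = integral {0..t} (\<lambda>u. b (X u \<omega>))"
      using st by (intro Henstock_Kurzweil_Integration.integral_combine integrable_continuous_interval
          continuous_on_subset[OF cb]) auto
    then have 2: "\<sigma> *\<^sub>R D \<omega> = noise b X s t \<omega>"
    proof -
      have "s \<in> {0..T}" "t \<in> {0..T}" using st by auto
      from eq'[OF this(1)] eq'[OF this(2)] \<open>_ = integral {0..t} _\<close>[symmetric] show ?thesis
        unfolding noise_def D_def by (simp only: scaleR_diff_right) (simp add: algebra_simps)
    qed
    show ?case using 1 2 by blast
  qed
  then have AE1: "AE \<omega> in P. trajectory s X' \<omega> = trajectory s X \<omega>" and AE2: "AE \<omega> in P. \<sigma> *\<^sub>R D \<omega> = noise b X s t \<omega>"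
    by (auto elim: AE_mp)
  note Um = noise_measurable[OF bc X st]
  have "indep_pair P (path_space s) (trajectory s X) borel (noise b X s t)"
    by (rule indep_pair_AE_cong[OF pair AE1 AE2 trajectory_measurable_restrict[OF bc X st] Um])
  moreover have "(\<integral>\<^sup>+\<omega>. ennreal (exp (v \<bullet> noise b X s t \<omega>)) \<partial>P) = ennreal (exp (\<sigma>\<^sup>2 * (t - s) * (norm v)\<^sup>2 / 2))" for v
  proof -
    have "(\<integral>\<^sup>+\<omega>. ennreal (exp (v \<bullet> noise b X s t \<omega>)) \<partial>P) = (\<integral>\<^sup>+\<omega>. ennreal (exp ((\<sigma> *\<^sub>R v) \<bullet> (B t \<omega> - B s \<omega>))) \<partial>P)"
      
    proof (rule nn_integral_cong_AE)
      show "AE \<omega> in P. ennreal (exp (v \<bullet> noise b X s t \<omega>)) = ennreal (exp ((\<sigma> *\<^sub>R v) \<bullet> (B t \<omega> - B s \<omega>)))"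
        using AE2
      proof eventually_elim
        case (elim \<omega>)
        show ?case unfolding elim[symmetric] D_def by simp
      qed
    qed
    also have "\<dots> = ennreal (exp ((t - s) * (norm (\<sigma> *\<^sub>R v))\<^sup>2 / 2))"
      by (rule brownian_increment_mgf[OF P B st])
    also have "(t - s) * (norm (\<sigma> *\<^sub>R v))\<^sup>2 / 2 = \<sigma>\<^sup>2 * (t - s) * (norm v)\<^sup>2 / 2"
      by (simp add: power_mult_distrib)
    finally show ?thesis .
  qed
  ultimately show "indep_pair P (path_space s) (trajectory s X) borel (noise b X s t) \<and>
    (\<forall>v. (\<integral>\<^sup>+\<omega>. ennreal (exp (v \<bullet> noise b X s t \<omega>)) \<partial>P) = ennreal (exp (\<sigma>\<^sup>2 * (t - s) * (norm v)\<^sup>2 / 2)))" by blast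
qed

section \<open>Exponential moments of stochastic integrals\<close>

lemma measurable_larger_algebra:
  assumes f: "f \<in> measurable F N" and s: "sets F \<subseteq> sets G" "space F = space G"
  shows "f \<in> measurable G N"
proof (rule measurableI)
  show "f x \<in> space N" if "x \<in> space G" for x using measurable_space[OF f] that s(2) by simp
  show "f -` A \<inter> space G \<in> sets G" if "A \<in> sets N" for A
    using subsetD[OF s(1) measurable_sets[OF f that]] s(2) by simp
qed

lemma natural_filtration_mono:
  fixes Z :: "real \<Rightarrow> 'w \<Rightarrow> 'e::euclidean_space"
  assumes "s \<le> t" and f: "f \<in> measurable (natural_filtration Q Z s) N"
  shows "f \<in> measurable (natural_filtration Q Z t) N"
proof -
  have "trajectory s Z \<in> measurable (natural_filtration Q Z t) (path_space s)"
    unfolding natural_filtration_def using assms(1)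
    by (intro measurable_trajectory trajectory_component) auto
  then have "sets (natural_filtration Q Z s) \<subseteq> sets (natural_filtration Q Z t)"
    unfolding natural_filtration_def[of Q Z s]
    by (intro sets_image_in_sets) (auto simp: natural_filtration_def)
  with f show ?thesis by (rule measurable_larger_algebra) (simp add: natural_filtration_def)
qed

lemma space_natural_filtration [simp]: "space (natural_filtration Q Z t) = space Q"
  by (simp add: natural_filtration_def)

text \<open>Taking the \<sigma>-algebra of the past as the underlying measurable space turns every
  measurability result on processes into one on adaptedness.\<close>

lemma natural_filtration_continuous_process:
  assumes "continuous_process Q T Z" "t \<le> T"
  shows "continuous_process (natural_filtration Q Z t) t Z"
proof -
  have "continuous_on {0..t} (\<lambda>u. Z u \<omega>)" if "\<omega> \<in> space Q" for \<omega>
  proof (rule continuous_on_subset)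
    show "continuous_on {0..T} (\<lambda>u. Z u \<omega>)" using assms(1) that by (simp add: continuous_process_def)
  qed (use assms(2) in simp)
  then show ?thesis
    unfolding continuous_process_def natural_filtration_def by (simp add: trajectory_component)
qed

lemma natural_filtration_sets:
  fixes Z :: "real \<Rightarrow> 'w \<Rightarrow> 'e::euclidean_space"
  assumes Z: "continuous_process Q T Z" and t: "t \<le> T"
  shows "sets (natural_filtration Q Z t) \<subseteq> sets Q"
proof -
  have "trajectory t Z \<in> measurable Q (path_space t)"
    using Z t by (intro measurable_trajectory) (simp add: continuous_process_def)
  then show ?thesis
    unfolding natural_filtration_def by (intro sets_image_in_sets) auto
qed

lemma natural_filtration_measurable:
  assumes "continuous_process Q T Z" "t \<le> T" "f \<in> measurable (natural_filtration Q Z t) N"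
  shows "f \<in> measurable Q N"
  by (rule measurable_larger_algebra[OF assms(3) natural_filtration_sets[OF assms(1,2)]]) simp

text \<open>The pair of \<open>Y\<close> and \<open>\<xi>\<close> is a function of the path up to
  \<open>s\<close> and hence independent of the noise after \<open>s\<close>. Fubini allows
  \<open>\<xi>\<close> to be frozen, and the exponential moment of the noise cancels the
  compensator. With nonnegative integrals no integrability of \<open>Y\<close> or
  \<open>\<xi>\<close> has to be checked.\<close>

lemma (in prob_space) exp_noise_step:
  fixes Z :: "real \<Rightarrow> 'a \<Rightarrow> 'e::euclidean_space"
  assumes g: "gaussian_noise M T b \<sigma> Z" and st: "0 \<le> s" "s < t" "t \<le> T"
    and Y: "Y \<in> borel_measurable (natural_filtration M Z s)"
    and \<xi>: "\<xi> \<in> borel_measurable (natural_filtration M Z s)"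
  shows "(\<integral>\<^sup>+\<omega>. Y \<omega> * ennreal (exp (\<xi> \<omega> \<bullet> noise b Z s t \<omega> - \<sigma>\<^sup>2 * (t - s) * (norm (\<xi> \<omega>))\<^sup>2 / 2)) \<partial>M) = (\<integral>\<^sup>+\<omega>. Y \<omega> \<partial>M)"
proof -
  let ?U = "noise b Z s t"
  have pair: "indep_pair M (path_space s) (trajectory s Z) borel ?U"
    and mgf: "\<And>v. (\<integral>\<^sup>+\<omega>. ennreal (exp (v \<bullet> ?U \<omega>)) \<partial>M) = ennreal (exp (\<sigma>\<^sup>2 * (t - s) * (norm v)\<^sup>2 / 2))"
    using g st unfolding gaussian_noise_def by blast+
  have U[measurable]: "?U \<in> borel_measurable M" using pair by (simp add: indep_pair_def)
  have "indep_pair M (borel \<Otimes>\<^sub>M borel) (\<lambda>\<omega>. (Y \<omega>, \<xi> \<omega>)) borel ?U"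
  proof (rule indep_set_imp_indep_pair[OF indep_pair_imp_indep_set[OF pair]])
    show "(\<lambda>\<omega>. (Y \<omega>, \<xi> \<omega>)) \<in> measurable (vimage_algebra (space M) (trajectory s Z) (path_space s)) (borel \<Otimes>\<^sub>M borel)"
      using Y \<xi> unfolding natural_filtration_def by (rule measurable_Pair)
    show "?U \<in> measurable (vimage_algebra (space M) ?U borel) borel"
      by (rule measurable_vimage_algebra1) auto
  qed auto
  then have YX[measurable]: "(\<lambda>\<omega>. (Y \<omega>, \<xi> \<omega>)) \<in> measurable M (borel \<Otimes>\<^sub>M borel)"
    and eq: "distr M (borel \<Otimes>\<^sub>M borel) (\<lambda>\<omega>. (Y \<omega>, \<xi> \<omega>)) \<Otimes>\<^sub>M distr M borel ?U =
      distr M ((borel \<Otimes>\<^sub>M borel) \<Otimes>\<^sub>M borel) (\<lambda>\<omega>. ((Y \<omega>, \<xi> \<omega>), ?U \<omega>))"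
    by (auto simp: indep_pair_def)
  interpret U: prob_space "distr M borel ?U" by (rule prob_space_distr) measurable
  define c where "c = \<sigma>\<^sup>2 * (t - s)"
  define f where "f = (\<lambda>z::(ennreal \<times> 'e) \<times> 'e.
    fst (fst z) * ennreal (exp (snd (fst z) \<bullet> snd z - c * (norm (snd (fst z)))\<^sup>2 / 2)))"
  have f[measurable]: "f \<in> borel_measurable ((borel \<Otimes>\<^sub>M borel) \<Otimes>\<^sub>M borel)"
    unfolding f_def by measurable
  let ?D = "distr M (borel \<Otimes>\<^sub>M borel) (\<lambda>\<omega>. (Y \<omega>, \<xi> \<omega>))"
  have "(\<integral>\<^sup>+\<omega>. Y \<omega> * ennreal (exp (\<xi> \<omega> \<bullet> ?U \<omega> - c * (norm (\<xi> \<omega>))\<^sup>2 / 2)) \<partial>M) =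
      (\<integral>\<^sup>+z. f z \<partial>distr M ((borel \<Otimes>\<^sub>M borel) \<Otimes>\<^sub>M borel) (\<lambda>\<omega>. ((Y \<omega>, \<xi> \<omega>), ?U \<omega>)))"
    by (subst nn_integral_distr) (auto simp: f_def)
  also have "\<dots> = (\<integral>\<^sup>+z. f z \<partial>(?D \<Otimes>\<^sub>M distr M borel ?U))"
    by (simp only: eq)
  also have "\<dots> = (\<integral>\<^sup>+z. \<integral>\<^sup>+u. f (z, u) \<partial>distr M borel ?U \<partial>?D)"
    by (rule U.nn_integral_fst[symmetric]) (simp cong: measurable_cong_sets)
  also have "\<dots> = (\<integral>\<^sup>+z. fst z \<partial>?D)"
  proof (rule nn_integral_cong)
    fix z :: "ennreal \<times> 'e"
    have "(\<integral>\<^sup>+u. f (z, u) \<partial>distr M borel ?U) =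
        (\<integral>\<^sup>+u. fst z * ennreal (exp (- c * (norm (snd z))\<^sup>2 / 2)) * ennreal (exp (snd z \<bullet> u)) \<partial>distr M borel ?U)"
      by (intro nn_integral_cong) (simp add: f_def mult.assoc flip: ennreal_mult exp_add)
    also have "\<dots> = fst z * ennreal (exp (- c * (norm (snd z))\<^sup>2 / 2)) * (\<integral>\<^sup>+u. ennreal (exp (snd z \<bullet> u)) \<partial>distr M borel ?U)"
      by (rule nn_integral_cmult) simp
    also have "(\<integral>\<^sup>+u. ennreal (exp (snd z \<bullet> u)) \<partial>distr M borel ?U) = ennreal (exp (c * (norm (snd z))\<^sup>2 / 2))"
      by (subst nn_integral_distr) (simp_all add: mgf c_def)
    also have "fst z * ennreal (exp (- c * (norm (snd z))\<^sup>2 / 2)) * ennreal (exp (c * (norm (snd z))\<^sup>2 / 2)) = fst z"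
      by (simp add: mult.assoc flip: ennreal_mult exp_add)
    finally show "(\<integral>\<^sup>+u. f (z, u) \<partial>distr M borel ?U) = fst z" .
  qed
  also have "\<dots> = (\<integral>\<^sup>+\<omega>. Y \<omega> \<partial>M)" by (subst nn_integral_distr) auto
  finally show ?thesis by (simp add: c_def)
qed

text \<open>The integral of a simple integrand against the martingale part of
  \<open>Z\<close>.\<close>

definition simple_noise :: "('e \<Rightarrow> 'e) \<Rightarrow> (real \<Rightarrow> 'w \<Rightarrow> 'e::euclidean_space) \<Rightarrow> nat \<Rightarrow> (nat \<Rightarrow> real) \<Rightarrow> (nat \<Rightarrow> 'w \<Rightarrow> 'e) \<Rightarrow> 'w \<Rightarrow> real"
  where "simple_noise b Z k ts \<xi> \<omega> = (\<Sum>j<k. \<xi> j \<omega> \<bullet> noise b Z (ts j) (ts (Suc j)) \<omega>)"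

text \<open>Multiplied by \<open>\<sigma>^2\<close>, this is the quadratic variation belonging to
  \<open>simple_noise\<close>.\<close>

definition simple_energy :: "nat \<Rightarrow> (nat \<Rightarrow> real) \<Rightarrow> (nat \<Rightarrow> 'w \<Rightarrow> 'e::euclidean_space) \<Rightarrow> 'w \<Rightarrow> real"
  where "simple_energy k ts \<xi> \<omega> = (\<Sum>j<k. (ts (Suc j) - ts j) * (norm (\<xi> j \<omega>))\<^sup>2)"

text \<open>Measurability at time \<open>ts i\<close>, and not only at the final time, lets the
  exponential of the first \<open>i\<close> summands play the role of the past factor in
  \<open>exp_noise_step\<close>.\<close>

lemma simple_noise_measurable:
  assumes Z: "continuous_process Q T Z" and b: "continuous_on UNIV b"
    and si: "simple_integrand Q T Z k ts \<xi>"
    and i: "i \<le> k"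
  shows "simple_noise b Z i ts \<xi> \<in> borel_measurable (natural_filtration Q Z (ts i))"
    and "simple_energy i ts \<xi> \<in> borel_measurable (natural_filtration Q Z (ts i))"
proof -
  have ts: "\<And>j. j \<le> k \<Longrightarrow> 0 \<le> ts j \<and> ts j \<le> T" "\<And>j. j < k \<Longrightarrow> ts j < ts (Suc j)"
    and \<xi>: "\<And>j. j < k \<Longrightarrow> \<xi> j \<in> borel_measurable (natural_filtration Q Z (ts j))"
    using si by (auto simp: simple_integrand_def)
  have mono: "ts j \<le> ts l" if "j \<le> l" "l \<le> k" for j l
    using that
  proof (induction l)
    case (Suc l)
    then show ?case using ts(2)[of l] by (cases "j = Suc l") auto
  qed simp
  have \<xi>': "\<xi> j \<in> borel_measurable (natural_filtration Q Z (ts i))" if "j < i" for j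
    using that i by (intro natural_filtration_mono[OF mono \<xi>]) auto
  have U: "noise b Z (ts j) (ts (Suc j)) \<in> borel_measurable (natural_filtration Q Z (ts i))" if "j < i" for j
  proof (rule natural_filtration_mono)
    show "ts (Suc j) \<le> ts i" using that i by (intro mono) auto
    show "noise b Z (ts j) (ts (Suc j)) \<in> borel_measurable (natural_filtration Q Z (ts (Suc j)))"
      using that i ts by (intro noise_measurable[OF b natural_filtration_continuous_process[OF Z]]) auto
  qed
  show "simple_noise b Z i ts \<xi> \<in> borel_measurable (natural_filtration Q Z (ts i))"
    unfolding simple_noise_def by (intro borel_measurable_sum borel_measurable_inner \<xi>' U) auto
  show "simple_energy i ts \<xi> \<in> borel_measurable (natural_filtration Q Z (ts i))"
    unfolding simple_energy_def
    by (intro borel_measurable_sum borel_measurable_times borel_measurable_power borel_measurable_const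
        borel_measurable_norm[THEN measurable_compose[rotated]] \<xi>') auto
qed

text \<open>The exponential martingale, by removing one summand at a time:
  \<open>exp_noise_step\<close> is applied to the last coefficient, scaled by \<open>l\<close>, with
  the exponential of the preceding summands as \<open>Y\<close>.\<close>

lemma (in prob_space) exp_simple_noise:
  fixes Z :: "real \<Rightarrow> 'a \<Rightarrow> 'e::euclidean_space"
  assumes g: "gaussian_noise M T b \<sigma> Z" and Z: "continuous_process M T Z" and b: "continuous_on UNIV b"
    and si: "simple_integrand M T Z k ts \<xi>"
  shows "(\<integral>\<^sup>+\<omega>. ennreal (exp (l * simple_noise b Z k ts \<xi> \<omega> - l\<^sup>2 * \<sigma>\<^sup>2 / 2 * simple_energy k ts \<xi> \<omega>)) \<partial>M) = 1"
proof -
  have "(\<integral>\<^sup>+\<omega>. ennreal (exp (l * simple_noise b Z i ts \<xi> \<omega> - l\<^sup>2 * \<sigma>\<^sup>2 / 2 * simple_energy i ts \<xi> \<omega>)) \<partial>M) = 1"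
    if "i \<le> k" for i
    using that
  proof (induction i)
    case 0
    then show ?case by (simp add: simple_noise_def simple_energy_def emeasure_space_1)
  next
    case (Suc i)
    let ?E = "\<lambda>i \<omega>. ennreal (exp (l * simple_noise b Z i ts \<xi> \<omega> - l\<^sup>2 * \<sigma>\<^sup>2 / 2 * simple_energy i ts \<xi> \<omega>))"
    have ts: "0 \<le> ts i" "ts i < ts (Suc i)" "ts (Suc i) \<le> T"
      and \<xi>: "\<xi> i \<in> borel_measurable (natural_filtration M Z (ts i))"
      using si Suc.prems by (auto simp: simple_integrand_def)
    have E: "?E i \<in> borel_measurable (natural_filtration M Z (ts i))"
    proof -
      have [measurable]: "simple_noise b Z i ts \<xi> \<in> borel_measurable (natural_filtration M Z (ts i))"
        "simple_energy i ts \<xi> \<in> borel_measurable (natural_filtration M Z (ts i))"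
        using simple_noise_measurable[OF Z b si, of i] Suc.prems by auto
      show ?thesis by measurable
    qed
    have "(\<integral>\<^sup>+\<omega>. ?E (Suc i) \<omega> \<partial>M) = (\<integral>\<^sup>+\<omega>. ?E i \<omega> * ennreal (exp ((l *\<^sub>R \<xi> i \<omega>) \<bullet> noise b Z (ts i) (ts (Suc i)) \<omega>
        - \<sigma>\<^sup>2 * (ts (Suc i) - ts i) * (norm (l *\<^sub>R \<xi> i \<omega>))\<^sup>2 / 2)) \<partial>M)"
      by (intro nn_integral_cong, subst ennreal_mult[symmetric])
        (simp_all add: simple_noise_def simple_energy_def power_mult_distrib algebra_simps add_divide_distrib diff_divide_distrib flip: exp_add)
    also have "\<dots> = (\<integral>\<^sup>+\<omega>. ?E i \<omega> \<partial>M)"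
      using \<xi> by (intro exp_noise_step[OF g ts E]) measurable
    also have "\<dots> = 1" using Suc by simp
    finally show ?case .
  qed
  then show ?thesis by simp
qed

text \<open>The intervals are disjoint, so the square has no cross terms.\<close>

lemma simple_process_square:
  assumes "\<And>j. j < k \<Longrightarrow> ts j < ts (Suc j)"
  shows "(norm (simple_process k ts \<xi> t \<omega>))\<^sup>2 = (\<Sum>j<k. indicator {ts j<..ts (Suc j)} t * (norm (\<xi> j \<omega>))\<^sup>2)"
  using assms
proof (induction k)
  case 0
  then show ?case by (simp add: simple_process_def)
next
  case (Suc k)
  have IH: "(norm (simple_process k ts \<xi> t \<omega>))\<^sup>2 = (\<Sum>j<k. indicator {ts j<..ts (Suc j)} t * (norm (\<xi> j \<omega>))\<^sup>2)"
    using Suc by auto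
  have mono: "ts j \<le> ts l" if "j \<le> l" "l \<le> Suc k" for j l
    using that
  proof (induction l)
    case (Suc l)
    then show ?case using Suc.prems \<open>\<And>j. j < Suc k \<Longrightarrow> ts j < ts (Suc j)\<close>[of l] by (cases "j = Suc l") auto
  qed simp
  show ?case
  proof (cases "t \<in> {ts k<..ts (Suc k)}")
    case True
    have z: "indicator {ts j<..ts (Suc j)} t = (0::real)" if "j < k" for j
      using mono[of "Suc j" k] that True by (auto simp: indicator_def)
    have "simple_process k ts \<xi> t \<omega> = 0"
      unfolding simple_process_def using z by (intro sum.neutral) auto
    moreover have "(\<Sum>j<k. indicator {ts j<..ts (Suc j)} t * (norm (\<xi> j \<omega>))\<^sup>2) = 0"
      using z by (intro sum.neutral) auto
    ultimately show ?thesis using True by (simp add: simple_process_def)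
  next
    case False
    then show ?thesis using IH by (simp add: simple_process_def)
  qed
qed

lemma simple_process_bounded:
  "norm (simple_process k ts \<xi> t \<omega>) \<le> (\<Sum>j<k. norm (\<xi> j \<omega>))"
  unfolding simple_process_def by (intro sum_norm_le) (auto simp: indicator_def)

lemma simple_process_borel [measurable]: "(\<lambda>t. simple_process k ts \<xi> t \<omega>) \<in> borel_measurable borel"
  unfolding simple_process_def by measurable

lemma simple_energy_eq:
  assumes "\<And>j. j < k \<Longrightarrow> ts j < ts (Suc j)" "\<And>j. j \<le> k \<Longrightarrow> ts j \<in> {0..T}"
  shows "simple_energy k ts \<xi> \<omega> = (LBINT t:{0..T}. (norm (simple_process k ts \<xi> t \<omega>))\<^sup>2)"
proof -
  have "(LBINT t:{0..T}. (norm (simple_process k ts \<xi> t \<omega>))\<^sup>2) =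
      (LBINT t. (\<Sum>j<k. (norm (\<xi> j \<omega>))\<^sup>2 * indicator {ts j<..ts (Suc j)} t))"
    unfolding set_lebesgue_integral_def
  proof (intro Bochner_Integration.integral_cong refl)
    fix t :: real
    have "indicator {0..T} t * indicator {ts j<..ts (Suc j)} t = (indicator {ts j<..ts (Suc j)} t :: real)" if "j < k" for j
      using assms(2)[of j] assms(2)[of "Suc j"] that by (auto simp: indicator_def)
    moreover have "(norm (simple_process k ts \<xi> t \<omega>))\<^sup>2 = (\<Sum>j<k. indicator {ts j<..ts (Suc j)} t * (norm (\<xi> j \<omega>))\<^sup>2)"
      using assms(1) by (rule simple_process_square)
    ultimately show "indicator {0..T} t *\<^sub>R (norm (simple_process k ts \<xi> t \<omega>))\<^sup>2 =
        (\<Sum>j<k. (norm (\<xi> j \<omega>))\<^sup>2 * indicator {ts j<..ts (Suc j)} t)"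
      unfolding real_scaleR_def sum_distrib_left
      by (simp only: sum_distrib_left mult.assoc[symmetric]) (intro sum.cong refl, simp add: mult.commute)
  qed
  also have "\<dots> = (\<Sum>j<k. (norm (\<xi> j \<omega>))\<^sup>2 * (ts (Suc j) - ts j))"
    using assms(1) by (subst Bochner_Integration.integral_sum) (auto intro!: sum.cong simp: less_imp_le)
  finally show ?thesis by (simp add: simple_energy_def mult.commute)
qed

text \<open>Each noise increment is an increment of \<open>Z\<close> minus the drift integral over
  the same interval. The half-open intervals of the simple process differ from the closed ones in
  \<open>noise\<close> by a null set.\<close>

lemma simple_noise_eq:
  assumes ts: "\<And>j. j < k \<Longrightarrow> ts j < ts (Suc j)" "\<And>j. j \<le> k \<Longrightarrow> ts j \<in> {0..T}"
    and c: "continuous_on {0..T} (\<lambda>u. b (Z u \<omega>))"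
  shows "simple_noise b Z k ts \<xi> \<omega> = simple_integral k ts \<xi> Z \<omega> -
    (LBINT t:{0..T}. simple_process k ts \<xi> t \<omega> \<bullet> b (Z t \<omega>))"
proof -
  have sub: "{ts j<..ts (Suc j)} \<subseteq> {0..T}" "{ts j..ts (Suc j)} \<subseteq> {0..T}" if "j < k" for j
    using ts(2)[of j] ts(2)[of "Suc j"] that by auto
  have i0: "set_integrable lborel {0..T} (\<lambda>u. b (Z u \<omega>))"
    using c by (rule borel_integrable_atLeastAtMost')
  have i1: "set_integrable lborel {ts j<..ts (Suc j)} (\<lambda>u. b (Z u \<omega>))" if "j < k" for j
    by (rule set_integrable_subset[OF i0]) (use sub that in auto)
  have i2: "set_integrable lborel {ts j..ts (Suc j)} (\<lambda>u. b (Z u \<omega>))" if "j < k" for j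
    by (rule set_integrable_subset[OF i0]) (use sub that in auto)
  have eq: "(LBINT u:{ts j<..ts (Suc j)}. b (Z u \<omega>)) = integral {ts j..ts (Suc j)} (\<lambda>u. b (Z u \<omega>))" if "j < k" for j
  proof -
    have "(LBINT u:{ts j<..ts (Suc j)}. b (Z u \<omega>)) = (LBINT u:{ts j..ts (Suc j)}. b (Z u \<omega>))"
      unfolding set_lebesgue_integral_def
    proof (rule integral_cong_AE)
      show "AE x in lborel. indicator {ts j<..ts (Suc j)} x *\<^sub>R b (Z x \<omega>) = indicator {ts j..ts (Suc j)} x *\<^sub>R b (Z x \<omega>)"
        using AE_lborel_singleton[of "ts j"] by eventually_elim (auto simp: indicator_def)
    qed (use i1[OF that] i2[OF that] in \<open>auto simp: set_integrable_def dest: borel_measurable_integrable\<close>)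
    also have "\<dots> = integral {ts j..ts (Suc j)} (\<lambda>u. b (Z u \<omega>))"
      using i2[OF that] by (rule set_borel_integral_eq_integral)
    finally show ?thesis .
  qed
  have "(LBINT t:{0..T}. simple_process k ts \<xi> t \<omega> \<bullet> b (Z t \<omega>)) =
      (LBINT t. (\<Sum>j<k. \<xi> j \<omega> \<bullet> (indicator {ts j<..ts (Suc j)} t *\<^sub>R b (Z t \<omega>))))"
    unfolding set_lebesgue_integral_def
  proof (intro Bochner_Integration.integral_cong refl)
    fix t :: real
    have "indicator {0..T} t * (indicator {ts j<..ts (Suc j)} t * r) = (indicator {ts j<..ts (Suc j)} t * r :: real)" if "j < k" for j r
      using sub[OF that] by (auto simp: indicator_def)
    then show "indicator {0..T} t *\<^sub>R (simple_process k ts \<xi> t \<omega> \<bullet> b (Z t \<omega>)) =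
        (\<Sum>j<k. \<xi> j \<omega> \<bullet> (indicator {ts j<..ts (Suc j)} t *\<^sub>R b (Z t \<omega>)))"
      unfolding simple_process_def inner_sum_left inner_scaleR_left inner_scaleR_right real_scaleR_def sum_distrib_left
      by (intro sum.cong refl) simp
  qed
  also have "\<dots> = (\<Sum>j<k. LBINT t. \<xi> j \<omega> \<bullet> (indicator {ts j<..ts (Suc j)} t *\<^sub>R b (Z t \<omega>)))"
    using i1 by (intro Bochner_Integration.integral_sum integrable_inner_right) (auto simp: set_integrable_def)
  also have "\<dots> = (\<Sum>j<k. \<xi> j \<omega> \<bullet> integral {ts j..ts (Suc j)} (\<lambda>u. b (Z u \<omega>)))"
  proof (intro sum.cong refl)
    fix j assume "j \<in> {..<k}"
    then have j: "j < k" by simp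
    have "(LBINT t. \<xi> j \<omega> \<bullet> (indicator {ts j<..ts (Suc j)} t *\<^sub>R b (Z t \<omega>))) = \<xi> j \<omega> \<bullet> (LBINT t. indicator {ts j<..ts (Suc j)} t *\<^sub>R b (Z t \<omega>))"
      using i1[OF j] by (intro integral_inner_right) (auto simp: set_integrable_def)
    then show "(LBINT t. \<xi> j \<omega> \<bullet> (indicator {ts j<..ts (Suc j)} t *\<^sub>R b (Z t \<omega>))) = \<xi> j \<omega> \<bullet> integral {ts j..ts (Suc j)} (\<lambda>u. b (Z u \<omega>))"
      using eq[OF j] by (simp add: set_lebesgue_integral_def)
  qed
  finally show ?thesis
    by (simp add: simple_noise_def simple_integral_def noise_def inner_diff_right sum_subtractf)
qed

section \<open>Almost sure convergence along a selection of indices, and pathwise convergence in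
  \<open>L2\<close>\<close>

lemma nn_integral_tendsto_0_AE_subseq:
  fixes f :: "nat \<Rightarrow> 'a \<Rightarrow> ennreal"
  assumes [measurable]: "\<And>n. f n \<in> borel_measurable M" and lim: "(\<lambda>n. \<integral>\<^sup>+x. f n x \<partial>M) \<longlonglongrightarrow> 0"
  obtains r where "AE x in M. (\<lambda>n. f (r n) x) \<longlonglongrightarrow> 0"
proof -
  have "\<exists>k. (\<integral>\<^sup>+x. f k x \<partial>M) < ennreal ((1/2) ^ n)" for n :: nat
  proof -
    have "0 < ennreal ((1/2) ^ n)" by simp
    from order_tendstoD(2)[OF lim this] show ?thesis by (auto simp: eventually_sequentially)
  qed
  then obtain r where r: "\<And>n. (\<integral>\<^sup>+x. f (r n) x \<partial>M) < ennreal ((1/2) ^ n)" by metis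
  have "(\<integral>\<^sup>+x. (\<Sum>n. f (r n) x) \<partial>M) = (\<Sum>n. \<integral>\<^sup>+x. f (r n) x \<partial>M)"
    by (rule nn_integral_suminf) measurable
  also have "\<dots> \<le> (\<Sum>n. ennreal ((1/2) ^ n))"
    by (intro suminf_le) (auto intro: less_imp_le[OF r])
  also have "\<dots> = ennreal (\<Sum>n. (1/2) ^ n)"
    by (intro suminf_ennreal2) (auto intro: summable_geometric)
  finally have "(\<integral>\<^sup>+x. (\<Sum>n. f (r n) x) \<partial>M) \<noteq> \<infinity>" by (auto simp: top_unique)
  then have fin: "AE x in M. (\<Sum>n. f (r n) x) \<noteq> \<infinity>"
    by (intro nn_integral_noteq_infinite) measurable
  show ?thesis
  proof (rule that, use fin in eventually_elim)
    case (elim x)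
    have f_fin: "f (r n) x < top" for n
    proof -
      have "(\<Sum>i\<in>{n}. f (r i) x) \<le> (\<Sum>n. f (r n) x)" by (intro sum_le_suminf) auto
      then show ?thesis using elim by (auto simp: top.not_eq_extremum intro: le_less_trans)
    qed
    have eq: "ennreal (enn2real (f (r n) x)) = f (r n) x" for n using f_fin by simp
    have "summable (\<lambda>n. enn2real (f (r n) x))"
      using elim by (intro summable_suminf_not_top) (auto simp: eq)
    then have "(\<lambda>n. enn2real (f (r n) x)) \<longlonglongrightarrow> 0" by (rule summable_LIMSEQ_zero)
    then have "(\<lambda>n. ennreal (enn2real (f (r n) x))) \<longlonglongrightarrow> ennreal 0" by (rule tendsto_ennrealI)
    then show "(\<lambda>n. f (r n) x) \<longlonglongrightarrow> 0" by (simp add: eq)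
  qed
qed

text \<open>Cauchy-Schwarz on a finite measure space. The bounds \<open>C n\<close> provide
  integrability only and may grow with \<open>n\<close>.\<close>

lemma (in finite_measure) integral_tendsto_0_of_square:
  fixes d :: "nat \<Rightarrow> 'a \<Rightarrow> real"
  assumes [measurable]: "\<And>n. d n \<in> borel_measurable M" and d0: "\<And>n x. 0 \<le> d n x"
    and C: "\<And>n x. x \<in> space M \<Longrightarrow> d n x \<le> C n"
    and lim: "(\<lambda>n. \<integral>\<^sup>+x. ennreal ((d n x)\<^sup>2) \<partial>M) \<longlonglongrightarrow> 0"
  shows "(\<lambda>n. \<integral>x. (d n x)\<^sup>2 \<partial>M) \<longlonglongrightarrow> 0" "(\<lambda>n. \<integral>x. d n x \<partial>M) \<longlonglongrightarrow> 0"
    "integrable M (d n)" "integrable M (\<lambda>x. (d n x)\<^sup>2)"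
proof -
  have i1: "integrable M (d n)" for n
    using C d0 by (intro integrable_const_bound[where B = "C n"]) auto
  have i2: "integrable M (\<lambda>x. (d n x)\<^sup>2)" for n
    using C d0 by (intro integrable_const_bound[where B = "(C n)\<^sup>2"]) (auto intro!: AE_I2 power_mono)
  show "integrable M (d n)" "integrable M (\<lambda>x. (d n x)\<^sup>2)" by (rule i1, rule i2)
  have eq2: "(\<integral>\<^sup>+x. ennreal ((d n x)\<^sup>2) \<partial>M) = ennreal (\<integral>x. (d n x)\<^sup>2 \<partial>M)" for n
    by (intro nn_integral_eq_integral i2) auto
  have eq1: "(\<integral>\<^sup>+x. ennreal (d n x) \<partial>M) = ennreal (\<integral>x. d n x \<partial>M)" for n
    by (intro nn_integral_eq_integral i1) (auto simp: d0)
  have pos: "0 \<le> (\<integral>x. (d n x)\<^sup>2 \<partial>M)" "0 \<le> (\<integral>x. d n x \<partial>M)" for n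
    by (auto intro: integral_nonneg_AE simp: d0)
  show lim2: "(\<lambda>n. \<integral>x. (d n x)\<^sup>2 \<partial>M) \<longlonglongrightarrow> 0"
    using lim pos unfolding eq2 by (subst (asm) ennreal_0[symmetric], subst (asm) tendsto_ennreal_iff) auto
  have le: "(\<integral>x. d n x \<partial>M) \<le> sqrt ((\<integral>x. (d n x)\<^sup>2 \<partial>M) * measure M (space M))" for n
  proof (rule real_le_rsqrt)
    have "(\<integral>\<^sup>+x. ennreal (d n x) * 1 \<partial>M)\<^sup>2 \<le> (\<integral>\<^sup>+x. (ennreal (d n x))\<^sup>2 \<partial>M) * (\<integral>\<^sup>+x. 1\<^sup>2 \<partial>M)"
      by (rule Cauchy_Schwarz_nn_integral) measurable
    then have "(ennreal (\<integral>x. d n x \<partial>M))\<^sup>2 \<le> ennreal (\<integral>x. (d n x)\<^sup>2 \<partial>M) * ennreal (measure M (space M))"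
      by (simp add: eq1 eq2 ennreal_power d0 emeasure_eq_measure)
    then show "(\<integral>x. d n x \<partial>M)\<^sup>2 \<le> (\<integral>x. (d n x)\<^sup>2 \<partial>M) * measure M (space M)"
      using pos by (simp add: ennreal_power flip: ennreal_mult)
  qed
  have "(\<lambda>n. sqrt ((\<integral>x. (d n x)\<^sup>2 \<partial>M) * measure M (space M))) \<longlonglongrightarrow> sqrt (0 * measure M (space M))"
    by (intro tendsto_intros lim2)
  then have s0: "(\<lambda>n. sqrt ((\<integral>x. (d n x)\<^sup>2 \<partial>M) * measure M (space M))) \<longlonglongrightarrow> 0" by simp
  show "(\<lambda>n. \<integral>x. d n x \<partial>M) \<longlonglongrightarrow> 0"
    by (rule Lim_null_comparison[OF _ s0]) (simp only: real_norm_def abs_of_nonneg[OF pos(2)] le eventually_True)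
qed

text \<open>Used for a fixed path with Lebesgue measure on \<open>[0,T]\<close>: approximation of
  the integrand in \<open>L2\<close> carries the energies and the drift integrals to their limits.
  The bounds on the approximants may depend on \<open>n\<close>; those on the limits do not.\<close>

lemma (in finite_measure) L2_convergence:
  fixes f :: "nat \<Rightarrow> 'a \<Rightarrow> 'e::euclidean_space"
  assumes [measurable]: "\<And>n. f n \<in> borel_measurable M" "g \<in> borel_measurable M" "h \<in> borel_measurable M"
    and B: "\<And>n x. x \<in> space M \<Longrightarrow> norm (f n x) \<le> B n"
    and C: "\<And>x. x \<in> space M \<Longrightarrow> norm (g x) \<le> C" and D: "\<And>x. x \<in> space M \<Longrightarrow> norm (h x) \<le> D"
    and lim: "(\<lambda>n. \<integral>\<^sup>+x. ennreal ((norm (f n x - g x))\<^sup>2) \<partial>M) \<longlonglongrightarrow> 0"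
  shows "(\<lambda>n. \<integral>x. (norm (f n x))\<^sup>2 \<partial>M) \<longlonglongrightarrow> (\<integral>x. (norm (g x))\<^sup>2 \<partial>M)"
    and "(\<lambda>n. \<integral>x. f n x \<bullet> h x \<partial>M) \<longlonglongrightarrow> (\<integral>x. g x \<bullet> h x \<partial>M)"
proof -
  define d where "d = (\<lambda>n x. norm (f n x - g x))"
  have [measurable]: "d n \<in> borel_measurable M" for n unfolding d_def by measurable
  have dB: "d n x \<le> B n + C" if "x \<in> space M" for n x
    unfolding d_def using B[OF that, of n] C[OF that] norm_triangle_ineq4[of "f n x" "g x"] by linarith
  have d0: "0 \<le> d n x" for n x by (simp add: d_def)
  have lim': "(\<lambda>n. \<integral>\<^sup>+x. ennreal ((d n x)\<^sup>2) \<partial>M) \<longlonglongrightarrow> 0" using lim by (simp add: d_def)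
  have L: "(\<lambda>n. \<integral>x. (d n x)\<^sup>2 \<partial>M) \<longlonglongrightarrow> 0" "(\<lambda>n. \<integral>x. d n x \<partial>M) \<longlonglongrightarrow> 0"
    "integrable M (d n)" "integrable M (\<lambda>x. (d n x)\<^sup>2)" for n
    by (rule integral_tendsto_0_of_square[where d = d and C = "\<lambda>n. B n + C"]; use d0 dB lim' in simp)+
  have i: "integrable M (\<lambda>x. (norm (f n x))\<^sup>2)" "integrable M (\<lambda>x. (norm (g x))\<^sup>2)"
    "integrable M (\<lambda>x. f n x \<bullet> h x)" "integrable M (\<lambda>x. g x \<bullet> h x)" for n
  proof -
    show "integrable M (\<lambda>x. (norm (f n x))\<^sup>2)"
      using B by (intro integrable_const_bound[where B = "(B n)\<^sup>2"]) (auto intro!: AE_I2 power_mono)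
    show "integrable M (\<lambda>x. (norm (g x))\<^sup>2)"
      using C by (intro integrable_const_bound[where B = "C\<^sup>2"]) (auto intro!: AE_I2 power_mono)
    have "\<bar>f n x \<bullet> h x\<bar> \<le> B n * D" "\<bar>g x \<bullet> h x\<bar> \<le> C * D" if x: "x \<in> space M" for x
    proof -
      have "0 \<le> B n" "0 \<le> C" using B[OF x, of n] C[OF x] norm_ge_zero order_trans by blast+
      then show "\<bar>f n x \<bullet> h x\<bar> \<le> B n * D" "\<bar>g x \<bullet> h x\<bar> \<le> C * D"
        using B[OF x, of n] C[OF x] D[OF x]
        by (auto intro!: order_trans[OF Cauchy_Schwarz_ineq2] mult_mono)
    qed
    then show "integrable M (\<lambda>x. f n x \<bullet> h x)" "integrable M (\<lambda>x. g x \<bullet> h x)"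
      by (auto intro: integrable_const_bound[where B = "B n * D" and f = "\<lambda>x. f n x \<bullet> h x"]
          integrable_const_bound[where B = "C * D" and f = "\<lambda>x. g x \<bullet> h x"])
  qed
  have s1: "\<bar>(\<integral>x. (norm (f n x))\<^sup>2 \<partial>M) - (\<integral>x. (norm (g x))\<^sup>2 \<partial>M)\<bar> \<le> (\<integral>x. (d n x)\<^sup>2 \<partial>M) + 2 * C * (\<integral>x. d n x \<partial>M)" for n
  proof -
    have "\<bar>(\<integral>x. (norm (f n x))\<^sup>2 \<partial>M) - (\<integral>x. (norm (g x))\<^sup>2 \<partial>M)\<bar> = \<bar>\<integral>x. (norm (f n x))\<^sup>2 - (norm (g x))\<^sup>2 \<partial>M\<bar>"
      using i by simp
    also have "\<dots> \<le> (\<integral>x. \<bar>(norm (f n x))\<^sup>2 - (norm (g x))\<^sup>2\<bar> \<partial>M)" by (rule integral_abs_bound)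
    also have "\<dots> \<le> (\<integral>x. (d n x)\<^sup>2 + 2 * C * d n x \<partial>M)"
    proof (rule integral_mono)
      fix x assume x: "x \<in> space M"
      have 1: "\<bar>norm (f n x) - norm (g x)\<bar> \<le> d n x" unfolding d_def by (rule norm_triangle_ineq3)
      have 2: "norm (f n x) + norm (g x) \<le> d n x + 2 * C"
        using 1 C[OF x] by linarith
      have "\<bar>(norm (f n x))\<^sup>2 - (norm (g x))\<^sup>2\<bar> = \<bar>norm (f n x) - norm (g x)\<bar> * (norm (f n x) + norm (g x))"
        by (simp add: power2_eq_square square_diff_square_factored abs_mult mult.commute)
      also have "\<dots> \<le> d n x * (d n x + 2 * C)" using 1 2 by (intro mult_mono) (auto simp: d_def)
      finally show "\<bar>(norm (f n x))\<^sup>2 - (norm (g x))\<^sup>2\<bar> \<le> (d n x)\<^sup>2 + 2 * C * d n x"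
        by (simp add: power2_eq_square algebra_simps)
    qed (use i L(3,4) in auto)
    also have "\<dots> = (\<integral>x. (d n x)\<^sup>2 \<partial>M) + 2 * C * (\<integral>x. d n x \<partial>M)" using L(3,4) by simp
    finally show ?thesis .
  qed
  have s2: "\<bar>(\<integral>x. f n x \<bullet> h x \<partial>M) - (\<integral>x. g x \<bullet> h x \<partial>M)\<bar> \<le> D * (\<integral>x. d n x \<partial>M)" for n
  proof -
    have "\<bar>(\<integral>x. f n x \<bullet> h x \<partial>M) - (\<integral>x. g x \<bullet> h x \<partial>M)\<bar> = \<bar>\<integral>x. f n x \<bullet> h x - g x \<bullet> h x \<partial>M\<bar>"
      using i by simp
    also have "\<dots> \<le> (\<integral>x. \<bar>f n x \<bullet> h x - g x \<bullet> h x\<bar> \<partial>M)" by (rule integral_abs_bound)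
    also have "\<dots> \<le> (\<integral>x. D * d n x \<partial>M)"
    proof (rule integral_mono)
      fix x assume x: "x \<in> space M"
      have "\<bar>f n x \<bullet> h x - g x \<bullet> h x\<bar> = \<bar>(f n x - g x) \<bullet> h x\<bar>" by (simp add: inner_diff_left)
      also have "\<dots> \<le> d n x * norm (h x)" unfolding d_def by (rule Cauchy_Schwarz_ineq2)
      also have "\<dots> \<le> D * d n x" using D[OF x] d0 by (subst mult.commute) (intro mult_right_mono)
      finally show "\<bar>f n x \<bullet> h x - g x \<bullet> h x\<bar> \<le> D * d n x" .
    qed (use i L(3) in auto)
    also have "\<dots> = D * (\<integral>x. d n x \<partial>M)" by simp
    finally show ?thesis .
  qed
  have z1: "(\<lambda>n. (\<integral>x. (d n x)\<^sup>2 \<partial>M) + 2 * C * (\<integral>x. d n x \<partial>M)) \<longlonglongrightarrow> 0 + 2 * C * 0"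
    by (intro tendsto_intros L)
  have z2: "(\<lambda>n. D * (\<integral>x. d n x \<partial>M)) \<longlonglongrightarrow> D * 0"
    by (intro tendsto_intros L)
  show "(\<lambda>n. \<integral>x. (norm (f n x))\<^sup>2 \<partial>M) \<longlonglongrightarrow> (\<integral>x. (norm (g x))\<^sup>2 \<partial>M)"
    by (rule LIM_zero_cancel, rule Lim_null_comparison[OF _ z1[simplified]]) (use s1 in auto)
  show "(\<lambda>n. \<integral>x. f n x \<bullet> h x \<partial>M) \<longlonglongrightarrow> (\<integral>x. g x \<bullet> h x \<partial>M)"
    by (rule LIM_zero_cancel, rule Lim_null_comparison[OF _ z2[simplified]]) (use s2 in auto)
qed

lemma process_pair_measurable:
  fixes Z :: "real \<Rightarrow> 'w \<Rightarrow> 'e::euclidean_space"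
  assumes Z: "continuous_process Q T Z" and T: "T > 0" and f: "f \<in> borel_measurable borel"
  shows "(\<lambda>(\<omega>, t). f (Z (max 0 (min T t)) \<omega>)) \<in> borel_measurable (Q \<Otimes>\<^sub>M lborel)"
proof -
  have 1: "(\<lambda>z. Z (max 0 (min T (fst z))) (snd z)) \<in> borel_measurable (lborel \<Otimes>\<^sub>M Q)"
    using continuous_process_pair_measurable[OF Z T] by (simp add: case_prod_beta')
  have 2: "(\<lambda>z. (snd z, fst z)) \<in> measurable (Q \<Otimes>\<^sub>M lborel) (lborel \<Otimes>\<^sub>M Q)" by measurable
  show ?thesis
    using measurable_compose[OF measurable_compose[OF 2 1] f] by (simp add: case_prod_beta')
qed

lemma borel_measurable_time_integral:
  fixes Z :: "real \<Rightarrow> 'w \<Rightarrow> 'e::euclidean_space" and f :: "'e \<Rightarrow> real"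
  assumes Z: "continuous_process Q T Z" and T: "T > 0" and f: "f \<in> borel_measurable borel"
  shows "(\<lambda>\<omega>. LBINT t:{0..T}. f (Z t \<omega>)) \<in> borel_measurable Q"
proof -
  note [measurable] = process_pair_measurable[OF Z T f, unfolded case_prod_beta']
  have "(\<lambda>\<omega>. LBINT t. indicator {0..T} t *\<^sub>R f (Z (max 0 (min T t)) \<omega>)) \<in> borel_measurable Q"
    by (rule lborel.borel_measurable_lebesgue_integral) (simp add: case_prod_beta')
  also have "(\<lambda>\<omega>. LBINT t. indicator {0..T} t *\<^sub>R f (Z (max 0 (min T t)) \<omega>)) = (\<lambda>\<omega>. LBINT t:{0..T}. f (Z t \<omega>))"
    unfolding set_lebesgue_integral_def
    by (intro ext Bochner_Integration.integral_cong) (auto simp: indicator_def)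
  finally show ?thesis .
qed

text \<open>An Ito integral is approximated almost surely, along a subsequence, by integrals of simple
  integrands; the exponential martingales of the latter have mean one. Keeping the compensator
  in the exponent makes uniform bounds on the simple integrands unnecessary.\<close>

lemma (in prob_space) exponential_approx:
  fixes Z :: "real \<Rightarrow> 'a \<Rightarrow> 'e::euclidean_space" and H b :: "'e \<Rightarrow> 'e"
  assumes g: "gaussian_noise M T b \<sigma> Z" and Z: "continuous_process M T Z" and b: "continuous_on UNIV b"
    and T: "T > 0" and ito: "has_ito_integral M T Z (\<lambda>t \<omega>. H (Z t \<omega>)) I"
    and H: "H \<in> borel_measurable borel" "\<And>x. norm (H x) \<le> C" and bD: "\<And>x. norm (b x) \<le> D"
  obtains W :: "nat \<Rightarrow> 'a \<Rightarrow> real" where "\<And>n. W n \<in> borel_measurable (natural_filtration M Z T)"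
    "\<And>n. (\<integral>\<^sup>+\<omega>. ennreal (exp (W n \<omega>)) \<partial>M) = 1"
    "AE \<omega> in M. (\<lambda>n. W n \<omega>) \<longlonglongrightarrow>
       l * (I \<omega> - (LBINT t:{0..T}. H (Z t \<omega>) \<bullet> b (Z t \<omega>))) -
         l\<^sup>2 * \<sigma>\<^sup>2 / 2 * (LBINT t:{0..T}. (norm (H (Z t \<omega>)))\<^sup>2)"
proof -
  have I[measurable]: "I \<in> borel_measurable M" using ito by (simp add: has_ito_integral_def)
  obtain k ts \<xi> where si: "\<And>n. simple_integrand M T Z (k n) (ts n) (\<xi> n)"
    and l1: "(\<lambda>n. \<integral>\<^sup>+\<omega>. (\<integral>\<^sup>+t\<in>{0..T}. ennreal ((norm (simple_process (k n) (ts n) (\<xi> n) t \<omega> - H (Z t \<omega>)))\<^sup>2) \<partial>lborel) \<partial>M) \<longlonglongrightarrow> 0"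
    and l2: "(\<lambda>n. \<integral>\<^sup>+\<omega>. ennreal ((simple_integral (k n) (ts n) (\<xi> n) Z \<omega> - I \<omega>)\<^sup>2) \<partial>M) \<longlonglongrightarrow> 0"
    using ito unfolding has_ito_integral_def by blast
  define A where "A = (\<lambda>n \<omega>. \<integral>\<^sup>+t\<in>{0..T}. ennreal ((norm (simple_process (k n) (ts n) (\<xi> n) t \<omega> - H (Z t \<omega>)))\<^sup>2) \<partial>lborel)"
  define E where "E = (\<lambda>n \<omega>. ennreal ((simple_integral (k n) (ts n) (\<xi> n) Z \<omega> - I \<omega>)\<^sup>2))"
  have ts: "ts n j \<in> {0..T}" if "j \<le> k n" for n j using si[of n] that unfolding simple_integrand_def by blast
  have ts': "ts n j < ts n (Suc j)" if "j < k n" for n j using si[of n] that unfolding simple_integrand_def by blast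
  have \<xi>: "\<xi> n j \<in> borel_measurable M" if "j < k n" for n j
  proof (rule natural_filtration_measurable[OF Z])
    show "ts n j \<le> T" using ts[of j n] that by simp
    show "\<xi> n j \<in> borel_measurable (natural_filtration M Z (ts n j))"
      using si[of n] that unfolding simple_integrand_def by blast
  qed
  have Zm: "Z r \<in> borel_measurable M" if "r \<in> {0..T}" for r
    using Z that by (simp add: continuous_process_def)
  have [measurable]: "E n \<in> borel_measurable M" for n
  proof -
    have [measurable]: "simple_integral (k n) (ts n) (\<xi> n) Z \<in> borel_measurable M"
      unfolding simple_integral_def
      by (intro borel_measurable_sum borel_measurable_inner borel_measurable_diff \<xi> Zm ts) auto
    show ?thesis unfolding E_def by measurable
  qed
  have [measurable]: "A n \<in> borel_measurable M" for n
  proof -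
    note [measurable] = process_pair_measurable[OF Z T H(1), unfolded case_prod_beta']
    have "(\<lambda>z. simple_process (k n) (ts n) (\<xi> n) (snd z) (fst z)) \<in> borel_measurable (M \<Otimes>\<^sub>M lborel)"
      unfolding simple_process_def
    proof (intro borel_measurable_sum borel_measurable_scaleR)
      fix j assume "j \<in> {..<k n}"
      then show "(\<lambda>z. \<xi> n j (fst z)) \<in> borel_measurable (M \<Otimes>\<^sub>M lborel)"
        by (intro measurable_compose[OF measurable_fst \<xi>]) auto
      show "(\<lambda>z. indicator {ts n j<..ts n (Suc j)} (snd z)) \<in> borel_measurable (M \<Otimes>\<^sub>M lborel)"
        by measurable
    qed
    note [measurable] = this
    have "(\<lambda>\<omega>. \<integral>\<^sup>+t. ennreal ((norm (simple_process (k n) (ts n) (\<xi> n) t \<omega> - H (Z (max 0 (min T t)) \<omega>)))\<^sup>2) * indicator {0..T} t \<partial>lborel) \<in> borel_measurable M"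
      by (rule lborel.borel_measurable_nn_integral) (simp add: case_prod_beta')
    also have "(\<lambda>\<omega>. \<integral>\<^sup>+t. ennreal ((norm (simple_process (k n) (ts n) (\<xi> n) t \<omega> - H (Z (max 0 (min T t)) \<omega>)))\<^sup>2) * indicator {0..T} t \<partial>lborel) = A n"
      unfolding A_def by (intro ext nn_integral_cong) (auto simp: indicator_def)
    finally show ?thesis .
  qed
  \<comment> \<open>Adding the two errors yields one selection of indices along which both tend to 0
    almost surely.\<close>
  have "(\<lambda>n. (\<integral>\<^sup>+\<omega>. A n \<omega> \<partial>M) + (\<integral>\<^sup>+\<omega>. E n \<omega> \<partial>M)) \<longlonglongrightarrow> 0 + 0"
    using l1 l2 unfolding A_def E_def by (rule tendsto_add)
  then have "(\<lambda>n. \<integral>\<^sup>+\<omega>. A n \<omega> + E n \<omega> \<partial>M) \<longlonglongrightarrow> 0" by (simp add: nn_integral_add)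
  then obtain r where r: "AE \<omega> in M. (\<lambda>n. A (r n) \<omega> + E (r n) \<omega>) \<longlonglongrightarrow> 0"
    by (rule nn_integral_tendsto_0_AE_subseq[rotated]) measurable
  define W where "W = (\<lambda>n \<omega>. l * simple_noise b Z (k (r n)) (ts (r n)) (\<xi> (r n)) \<omega> -
      l\<^sup>2 * \<sigma>\<^sup>2 / 2 * simple_energy (k (r n)) (ts (r n)) (\<xi> (r n)) \<omega>)"
  show ?thesis
  proof (rule that[of W])
    fix n
    show "(\<integral>\<^sup>+\<omega>. ennreal (exp (W n \<omega>)) \<partial>M) = 1"
      unfolding W_def by (rule exp_simple_noise[OF g Z b si])
    have [measurable]: "simple_noise b Z (k (r n)) (ts (r n)) (\<xi> (r n)) \<in> borel_measurable (natural_filtration M Z T)"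
      "simple_energy (k (r n)) (ts (r n)) (\<xi> (r n)) \<in> borel_measurable (natural_filtration M Z T)"
      using ts[of "k (r n)" "r n"]
      by (auto intro: natural_filtration_mono[OF _ simple_noise_measurable(1)[OF Z b si order_refl]]
         natural_filtration_mono[OF _ simple_noise_measurable(2)[OF Z b si order_refl]])
    show "W n \<in> borel_measurable (natural_filtration M Z T)" unfolding W_def by measurable
  next
    show "AE \<omega> in M. (\<lambda>n. W n \<omega>) \<longlonglongrightarrow>
       l * (I \<omega> - (LBINT t:{0..T}. H (Z t \<omega>) \<bullet> b (Z t \<omega>))) -
         l\<^sup>2 * \<sigma>\<^sup>2 / 2 * (LBINT t:{0..T}. (norm (H (Z t \<omega>)))\<^sup>2)"
      using r AE_space
    proof eventually_elim
      case (elim \<omega>)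
      have A0: "(\<lambda>n. A (r n) \<omega>) \<longlonglongrightarrow> 0"
        by (rule tendsto_sandwich[OF _ _ tendsto_const elim(1)]) auto
      have E0: "(\<lambda>n. E (r n) \<omega>) \<longlonglongrightarrow> 0"
        by (rule tendsto_sandwich[OF _ _ tendsto_const elim(1)]) auto
      have "(\<lambda>n. (simple_integral (k (r n)) (ts (r n)) (\<xi> (r n)) Z \<omega> - I \<omega>)\<^sup>2) \<longlonglongrightarrow> 0"
        using E0 unfolding E_def by (subst (asm) ennreal_0[symmetric], subst (asm) tendsto_ennreal_iff) auto
      from tendsto_real_sqrt[OF this]
      have "(\<lambda>n. simple_integral (k (r n)) (ts (r n)) (\<xi> (r n)) Z \<omega> - I \<omega>) \<longlonglongrightarrow> 0"
        by (simp add: tendsto_rabs_zero_iff)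
      then have i1: "(\<lambda>n. simple_integral (k (r n)) (ts (r n)) (\<xi> (r n)) Z \<omega>) \<longlonglongrightarrow> I \<omega>"
        by (rule LIM_zero_cancel)
      let ?m = "restrict_space lborel {0..T}"
      let ?S = "\<lambda>n t. simple_process (k (r n)) (ts (r n)) (\<xi> (r n)) t \<omega>"
      have cZ: "continuous_on {0..T} (\<lambda>t. Z t \<omega>)" using Z elim(2) by (simp add: continuous_process_def)
      have [measurable]: "(\<lambda>t. Z t \<omega>) \<in> borel_measurable ?m"
        using borel_measurable_continuous_on_restrict[OF cZ] by (simp cong: measurable_cong_sets add: measurable_def sets_restrict_space space_restrict_space)
      have [measurable]: "b \<in> borel_measurable borel" using b by (rule borel_measurable_continuous_onI)
      note [measurable] = H(1)
      interpret fm: finite_measure ?m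
        by (rule finite_measureI) (simp add: emeasure_restrict_space space_restrict_space emeasure_lborel_Icc_eq)
      have lim: "(\<lambda>n. \<integral>\<^sup>+t. ennreal ((norm (?S n t - H (Z t \<omega>)))\<^sup>2) \<partial>?m) \<longlonglongrightarrow> 0"
        using A0 unfolding A_def by (simp add: nn_integral_restrict_space)
      have Sm: "?S n \<in> borel_measurable ?m" for n
        by (rule measurable_restrict_space1) simp
      note conv = fm.L2_convergence[OF Sm _ _ simple_process_bounded H(2) bD lim]
      have c1: "(\<lambda>n. \<integral>t. (norm (?S n t))\<^sup>2 \<partial>?m) \<longlonglongrightarrow> (\<integral>t. (norm (H (Z t \<omega>)))\<^sup>2 \<partial>?m)"
        by (rule conv(1)) measurable
      have c2: "(\<lambda>n. \<integral>t. ?S n t \<bullet> b (Z t \<omega>) \<partial>?m) \<longlonglongrightarrow> (\<integral>t. H (Z t \<omega>) \<bullet> b (Z t \<omega>) \<partial>?m)"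
        by (rule conv(2)) measurable
      have rs: "(\<integral>t. f t \<partial>?m) = (LBINT t:{0..T}. f t)" for f :: "real \<Rightarrow> real"
        by (simp add: integral_restrict_space set_lebesgue_integral_def)
      have "continuous_on {0..T} (\<lambda>u. b (Z u \<omega>))" by (rule continuous_on_compose2[OF b cZ]) auto
      then have "simple_noise b Z (k (r n)) (ts (r n)) (\<xi> (r n)) \<omega> =
          simple_integral (k (r n)) (ts (r n)) (\<xi> (r n)) Z \<omega> - (\<integral>t. ?S n t \<bullet> b (Z t \<omega>) \<partial>?m)" for n
        unfolding rs using ts ts' by (intro simple_noise_eq) auto
      moreover have "simple_energy (k (r n)) (ts (r n)) (\<xi> (r n)) \<omega> = (\<integral>t. (norm (?S n t))\<^sup>2 \<partial>?m)" for n
        unfolding rs using ts ts' by (intro simple_energy_eq) auto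
      ultimately have "(\<lambda>n. W n \<omega>) = (\<lambda>n. l * (simple_integral (k (r n)) (ts (r n)) (\<xi> (r n)) Z \<omega> - (\<integral>t. ?S n t \<bullet> b (Z t \<omega>) \<partial>?m)) -
          l\<^sup>2 * \<sigma>\<^sup>2 / 2 * (\<integral>t. (norm (?S n t))\<^sup>2 \<partial>?m))"
        unfolding W_def by simp
      also have "\<dots> \<longlonglongrightarrow> l * (I \<omega> - (\<integral>t. H (Z t \<omega>) \<bullet> b (Z t \<omega>) \<partial>?m)) - l\<^sup>2 * \<sigma>\<^sup>2 / 2 * (\<integral>t. (norm (H (Z t \<omega>)))\<^sup>2 \<partial>?m)"
        by (intro tendsto_diff tendsto_mult tendsto_const i1 c1 c2)
      finally show ?case by (simp add: rs)
    qed
  qed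
qed

section \<open>Deviation bounds for independent copies\<close>

lemma integrable_indicator_interval: "integrable lborel (indicator {a..b::real} :: real \<Rightarrow> real)"
  by (rule integrable_real_indicator) (simp_all add: emeasure_lborel_Icc_eq)

lemma path_set_integrable:
  fixes z :: "real \<Rightarrow> 'e::euclidean_space" and f :: "'e \<Rightarrow> real"
  assumes z: "continuous_on {0..T} z" and T: "T > 0" and f: "f \<in> borel_measurable borel" and B: "\<And>x. \<bar>f x\<bar> \<le> B"
  shows "set_integrable lborel {0..T} (\<lambda>t. f (z t))"
proof -
  have "continuous_on UNIV (\<lambda>t. z (max 0 (min T t)))"
    using T by (intro continuous_on_compose2[OF z]) (auto intro!: continuous_intros)
  then have [measurable]: "(\<lambda>t. z (max 0 (min T t))) \<in> borel_measurable borel"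
    by (rule borel_measurable_continuous_onI)
  note [measurable] = f
  have "integrable lborel (\<lambda>t. indicator {0..T} t *\<^sub>R f (z (max 0 (min T t))))"
  proof (rule Bochner_Integration.integrable_bound)
    show "integrable lborel (\<lambda>t. indicator {0..T} t * B)"
      by (intro integrable_mult_left integrable_indicator_interval)
    show "AE t in lborel. norm (indicator {0..T} t *\<^sub>R f (z (max 0 (min T t)))) \<le> norm (indicator {0..T} t * B)"
      using B by (intro AE_I2) (auto simp: indicator_def intro: order_trans[OF B abs_ge_self])
  qed measurable
  also have "(\<lambda>t. indicator {0..T} t *\<^sub>R f (z (max 0 (min T t)))) = (\<lambda>t. indicator {0..T} t *\<^sub>R f (z t))"
    by (auto simp: indicator_def fun_eq_iff)
  finally show ?thesis by (simp add: set_integrable_def)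
qed

lemma set_integral_interval_le:
  fixes f :: "real \<Rightarrow> real"
  assumes T: "T \<ge> 0" and f: "\<And>t. t \<in> {0..T} \<Longrightarrow> f t \<le> B" and B: "0 \<le> B"
  shows "(LBINT t:{0..T}. f t) \<le> T * B"
proof (cases "set_integrable lborel {0..T} f")
  case True
  have "(LBINT t:{0..T}. f t) \<le> (LBINT t:{0..T}. B)"
    using True f integrable_indicator_interval[of 0 T] by (intro set_integral_mono) (auto simp: set_integrable_def)
  also have "\<dots> = T * B" using T by (simp add: set_lebesgue_integral_def)
  finally show ?thesis .
next
  case False
  then have "(LBINT t:{0..T}. f t) = 0"
    by (simp add: set_lebesgue_integral_def set_integrable_def not_integrable_integral_eq)
  then show ?thesis using T B by simp
qed

lemma set_integral_interval_nonneg: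
  fixes f :: "real \<Rightarrow> real"
  assumes "\<And>t. 0 \<le> f t"
  shows "0 \<le> (LBINT t:{0..T}. f t)"
  unfolding set_lebesgue_integral_def using assms by (intro integral_nonneg_AE) (auto simp: indicator_def)

lemma (in prob_space) expectation_time_integral:
  fixes Z :: "real \<Rightarrow> 'a \<Rightarrow> 'e::euclidean_space" and f :: "'e \<Rightarrow> real"
  assumes Z: "continuous_process M T Z" and T: "T > 0" and f: "f \<in> borel_measurable borel" and B: "\<And>x. \<bar>f x\<bar> \<le> B"
  shows "(LINT \<omega>|M. (LBINT t:{0..T}. f (Z t \<omega>))) = (LBINT t:{0..T}. (LINT \<omega>|M. f (Z t \<omega>)))"
proof -
  interpret pair_sigma_finite M lborel ..
  define F where "F = (\<lambda>\<omega> t. indicator {0..T} t *\<^sub>R f (Z (max 0 (min T t)) \<omega>))"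
  note [measurable] = process_pair_measurable[OF Z T f, unfolded case_prod_beta']
  have "integrable (M \<Otimes>\<^sub>M lborel) (case_prod F)"
  proof (rule integrableI_bounded_set[where A = "space M \<times> {0..T}" and B = B])
    show "case_prod F \<in> borel_measurable (M \<Otimes>\<^sub>M lborel)" unfolding F_def case_prod_beta' by measurable
    show "emeasure (M \<Otimes>\<^sub>M lborel) (space M \<times> {0..T}) < \<infinity>"
      using T by (subst lborel.emeasure_pair_measure_Times) (auto simp: emeasure_space_1)
    show "AE x in M \<Otimes>\<^sub>M lborel. x \<in> space M \<times> {0..T} \<longrightarrow> norm (case_prod F x) \<le> B"
      using B by (intro AE_I2) (auto simp: F_def)
    show "AE x in M \<Otimes>\<^sub>M lborel. x \<notin> space M \<times> {0..T} \<longrightarrow> case_prod F x = 0"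
      by (intro AE_I2) (auto simp: F_def space_pair_measure split: split_indicator_asm)
  qed simp
  then have "(LBINT t. (LINT \<omega>|M. F \<omega> t)) = (LINT \<omega>|M. (LBINT t. F \<omega> t))"
    by (rule Fubini_integral)
  moreover have "(LBINT t. F \<omega> t) = (LBINT t:{0..T}. f (Z t \<omega>))" for \<omega>
    unfolding set_lebesgue_integral_def F_def
    by (intro Bochner_Integration.integral_cong) (auto simp: indicator_def)
  moreover have "(LBINT t. (LINT \<omega>|M. F \<omega> t)) = (LBINT t:{0..T}. (LINT \<omega>|M. f (Z t \<omega>)))"
    unfolding set_lebesgue_integral_def F_def
    by (intro Bochner_Integration.integral_cong refl) (auto simp: indicator_def)
  ultimately show ?thesis by simp
qed

lemma law_at_time:
  fixes X :: "real \<Rightarrow> 'w \<Rightarrow> 'e::euclidean_space" and Z :: "real \<Rightarrow> 'v \<Rightarrow> 'e" and f :: "'e \<Rightarrow> real"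
  assumes X: "continuous_process P T X" and Z: "continuous_process Q T Z" and t: "t \<in> {0..T}"
    and law: "distr Q (path_space T) (trajectory T Z) = distr P (path_space T) (trajectory T X)"
    and f: "f \<in> borel_measurable borel"
  shows "(LINT \<omega>|Q. f (Z t \<omega>)) = (LINT \<omega>|P. f (X t \<omega>))"
proof -
  have tr: "trajectory T X \<in> measurable P (path_space T)" "trajectory T Z \<in> measurable Q (path_space T)"
    using X Z by (auto intro!: measurable_trajectory simp: continuous_process_def)
  have ev: "(\<lambda>x. f (x t)) \<in> borel_measurable (path_space T)"
    by (rule measurable_compose[OF measurable_component_singleton[OF t] f])
  have "(LINT \<omega>|Q. f (Z t \<omega>)) = (LINT x|distr Q (path_space T) (trajectory T Z). f (x t))"
    using t by (subst integral_distr[OF tr(2) ev]) (simp add: trajectory_def)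
  also have "\<dots> = (LINT \<omega>|P. f (X t \<omega>))"
    unfolding law using t by (subst integral_distr[OF tr(1) ev]) (simp add: trajectory_def)
  finally show ?thesis .
qed

definition energy :: "real \<Rightarrow> ('e \<Rightarrow> 'e::euclidean_space) \<Rightarrow> (real \<Rightarrow> 'v \<Rightarrow> 'e) \<Rightarrow> 'v \<Rightarrow> real"
  where "energy T H Z \<omega> = (LBINT t:{0..T}. (norm (H (Z t \<omega>)))\<^sup>2)"

definition drift_part :: "real \<Rightarrow> ('e \<Rightarrow> 'e) \<Rightarrow> ('e \<Rightarrow> 'e::euclidean_space) \<Rightarrow> (real \<Rightarrow> 'v \<Rightarrow> 'e) \<Rightarrow> 'v \<Rightarrow> real"
  where "drift_part T b H Z \<omega> = (LBINT t:{0..T}. H (Z t \<omega>) \<bullet> b (Z t \<omega>))"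

text \<open>The copies enter through continuity, joint independence and \<open>gauss\<close>; the
  last takes the place of an equation with its own Brownian motion for each copy.\<close>

locale iid_system = prob_space Q
  for Q :: "'v measure" +
  fixes T \<sigma> D :: real and b :: "'e::euclidean_space \<Rightarrow> 'e" and Xs :: "nat \<Rightarrow> real \<Rightarrow> 'v \<Rightarrow> 'e"
  assumes T: "T > 0" and \<sigma>: "\<sigma> > 0"
    and process: "\<And>m. continuous_process Q T (Xs m)"
    and indep: "indep_vars (\<lambda>_. path_space T) (\<lambda>m. trajectory T (Xs m)) UNIV"
    and gauss: "\<And>m. gaussian_noise Q T b \<sigma> (Xs m)"
    and b_cont: "continuous_on UNIV b" and b_bound: "\<And>x. norm (b x) \<le> D"
begin

lemma b_measurable [measurable]: "b \<in> borel_measurable borel"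
  using b_cont by (rule borel_measurable_continuous_onI)

text \<open>Events described by the \<open>m\<close>-th variable are events described by the
  \<open>m\<close>-th trajectory, and subfamilies of independent families of events are
  independent.\<close>

lemma indep_vars_natural_filtration:
  assumes Y: "\<And>m. Y m \<in> measurable (natural_filtration Q (Xs m) T) N"
  shows "indep_vars (\<lambda>_. N) Y I"
proof -
  have tr: "trajectory T (Xs m) \<in> measurable Q (path_space T)" for m
    using process[of m] by (intro measurable_trajectory) (simp add: continuous_process_def)
  have "indep_vars (\<lambda>_. N) Y UNIV"
    unfolding indep_vars_def2
  proof (intro conjI ballI)
    show "Y m \<in> measurable Q N" for m
      by (rule natural_filtration_measurable[OF process order_refl Y])
    have s: "sets (natural_filtration Q (Xs m) T) = {trajectory T (Xs m) -` A \<inter> space Q |A. A \<in> sets (path_space T)}" for m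
      unfolding natural_filtration_def
      by (rule sets_vimage_algebra2) (auto dest: measurable_space[OF tr])
    show "indep_sets (\<lambda>i. {Y i -` A \<inter> space Q |A. A \<in> sets N}) UNIV"
    proof (rule indep_sets_mono_sets)
      show "indep_sets (\<lambda>m. {trajectory T (Xs m) -` A \<inter> space Q |A. A \<in> sets (path_space T)}) UNIV"
        using indep by (simp add: indep_vars_def2)
      show "{Y m -` A \<inter> space Q |A. A \<in> sets N} \<subseteq> {trajectory T (Xs m) -` A \<inter> space Q |A. A \<in> sets (path_space T)}" for m
        unfolding s[symmetric] using measurable_sets[OF Y[of m]] by auto
    qed
  qed
  then show ?thesis by (rule indep_vars_subset) simp
qed

lemma energy_measurable:
  assumes "H \<in> borel_measurable borel"
  shows "energy T H (Xs m) \<in> borel_measurable (natural_filtration Q (Xs m) T)"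
  unfolding energy_def[abs_def]
  by (rule borel_measurable_time_integral[OF natural_filtration_continuous_process[OF process order_refl] T])
    (use assms in measurable)

lemma energy_measurable': "H \<in> borel_measurable borel \<Longrightarrow> energy T H (Xs m) \<in> borel_measurable Q"
  by (rule natural_filtration_measurable[OF process order_refl energy_measurable])

lemma drift_part_measurable:
  assumes [measurable]: "H \<in> borel_measurable borel"
  shows "drift_part T b H (Xs m) \<in> borel_measurable Q"
  unfolding drift_part_def[abs_def]
  by (rule borel_measurable_time_integral[OF process T]) measurable

text \<open>A version of a stochastic integral is measurable for \<open>Q\<close> but perhaps not
  for the \<sigma>-algebra of its own path, so independence of the integrals is not at hand. The
  product formula is applied to the approximants, which are functions of the single paths, and
  Fatou's lemma leads to the limit; equality becomes an inequality there.\<close>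

lemma exp_sum_le_1:
  assumes ito: "\<And>m. has_ito_integral Q T (Xs m) (\<lambda>t \<omega>. H (Xs m t \<omega>)) (I m)"
    and H: "H \<in> borel_measurable borel" "\<And>x. norm (H x) \<le> C"
  shows "(\<integral>\<^sup>+\<omega>. ennreal (exp (\<Sum>m<K. l * (I m \<omega> - drift_part T b H (Xs m) \<omega>) - l\<^sup>2 * \<sigma>\<^sup>2 / 2 * energy T H (Xs m) \<omega>)) \<partial>Q) \<le> 1"
proof -
  define G where "G m \<omega> = l * (I m \<omega> - drift_part T b H (Xs m) \<omega>) - l\<^sup>2 * \<sigma>\<^sup>2 / 2 * energy T H (Xs m) \<omega>" for m \<omega>
  have "\<exists>W. (\<forall>n. W n \<in> borel_measurable (natural_filtration Q (Xs m) T)) \<and>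
      (\<forall>n. (\<integral>\<^sup>+\<omega>. ennreal (exp (W n \<omega>)) \<partial>Q) = 1) \<and> (AE \<omega> in Q. (\<lambda>n. W n \<omega>) \<longlonglongrightarrow> G m \<omega>)" for m
  proof -
    note approx = exponential_approx[where l = l, OF gauss[of m] process b_cont T ito H b_bound,
        folded energy_def drift_part_def, folded G_def]
    show ?thesis
    proof (rule approx)
      fix W :: "nat \<Rightarrow> 'v \<Rightarrow> real"
      assume "\<And>n. W n \<in> borel_measurable (natural_filtration Q (Xs m) T)"
        "\<And>n. (\<integral>\<^sup>+\<omega>. ennreal (exp (W n \<omega>)) \<partial>Q) = 1" "AE \<omega> in Q. (\<lambda>n. W n \<omega>) \<longlonglongrightarrow> G m \<omega>"
      then show ?thesis by (intro exI[of _ W] conjI allI)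
    qed
  qed
  then obtain W where Wm: "\<And>m n. W m n \<in> borel_measurable (natural_filtration Q (Xs m) T)"
    and W1: "\<And>m n. (\<integral>\<^sup>+\<omega>. ennreal (exp (W m n \<omega>)) \<partial>Q) = 1"
    and Wl: "\<And>m. AE \<omega> in Q. (\<lambda>n. W m n \<omega>) \<longlonglongrightarrow> G m \<omega>" by metis
  have Wm'[measurable]: "W m n \<in> borel_measurable Q" for m n
    by (rule natural_filtration_measurable[OF process order_refl Wm])
  have one: "(\<integral>\<^sup>+\<omega>. ennreal (exp (\<Sum>m<K. W m n \<omega>)) \<partial>Q) = 1" for n
  proof -
    have "(\<integral>\<^sup>+\<omega>. ennreal (exp (\<Sum>m<K. W m n \<omega>)) \<partial>Q) = (\<integral>\<^sup>+\<omega>. (\<Prod>m<K. ennreal (exp (W m n \<omega>))) \<partial>Q)"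
      by (simp add: exp_sum prod_ennreal)
    also have "\<dots> = (\<Prod>m<K. \<integral>\<^sup>+\<omega>. ennreal (exp (W m n \<omega>)) \<partial>Q)"
    proof (rule indep_vars_nn_integral)
      show "indep_vars (\<lambda>_. borel) (\<lambda>m \<omega>. ennreal (exp (W m n \<omega>))) {..<K}"
        by (rule indep_vars_natural_filtration) (use Wm in measurable)
    qed auto
    also have "\<dots> = 1" by (simp add: W1)
    finally show ?thesis .
  qed
  have "AE \<omega> in Q. \<forall>m. (\<lambda>n. W m n \<omega>) \<longlonglongrightarrow> G m \<omega>" using Wl by (simp add: AE_all_countable)
  then have "AE \<omega> in Q. ennreal (exp (\<Sum>m<K. G m \<omega>)) = liminf (\<lambda>n. ennreal (exp (\<Sum>m<K. W m n \<omega>)))"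
  proof eventually_elim
    case (elim \<omega>)
    have "(\<lambda>n. ennreal (exp (\<Sum>m<K. W m n \<omega>))) \<longlonglongrightarrow> ennreal (exp (\<Sum>m<K. G m \<omega>))"
      using elim by (intro tendsto_ennrealI tendsto_exp tendsto_sum) auto
    then show ?case by (intro lim_imp_Liminf[symmetric]) auto
  qed
  then have "(\<integral>\<^sup>+\<omega>. ennreal (exp (\<Sum>m<K. G m \<omega>)) \<partial>Q) = (\<integral>\<^sup>+\<omega>. liminf (\<lambda>n. ennreal (exp (\<Sum>m<K. W m n \<omega>))) \<partial>Q)"
    by (rule nn_integral_cong_AE)
  also have "\<dots> \<le> liminf (\<lambda>n. \<integral>\<^sup>+\<omega>. ennreal (exp (\<Sum>m<K. W m n \<omega>)) \<partial>Q)"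
    by (rule nn_integral_liminf) measurable
  also have "\<dots> = 1" by (simp add: one Liminf_const)
  finally show ?thesis by (simp add: G_def)
qed

text \<open>Chernoff bound: on the event in question the compensated exponent is at least
  \<open>q\<close>, because the compensator is controlled by the energy bound
  \<open>E0\<close>.\<close>

lemma noise_deviation:
  assumes ito: "\<And>m. has_ito_integral Q T (Xs m) (\<lambda>t \<omega>. H (Xs m t \<omega>)) (I m)"
    and H: "H \<in> borel_measurable borel" "\<And>x. norm (H x) \<le> C"
    and E: "\<And>m \<omega>. energy T H (Xs m) \<omega> \<le> E0" and E0: "E0 > 0" and \<epsilon>: "\<epsilon> > 0"
  shows "measure Q {\<omega>\<in>space Q. (\<Sum>m<K. I m \<omega> - drift_part T b H (Xs m) \<omega>) \<ge> real K * \<epsilon>}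
    \<le> exp (- (real K * \<epsilon>\<^sup>2 / (2 * \<sigma>\<^sup>2 * E0)))"
proof -
  have [measurable]: "I m \<in> borel_measurable Q" for m using ito[of m] by (simp add: has_ito_integral_def)
  note [measurable] = drift_part_measurable[OF H(1)] energy_measurable'[OF H(1)]
  \<comment> \<open>The maximizer of \<open>l * \<epsilon> - l^2 * \<sigma>^2 * E0 / 2\<close>; the
    maximum, times \<open>K\<close>, is \<open>q\<close>.\<close>
  define l where "l = \<epsilon> / (\<sigma>\<^sup>2 * E0)"
  have l: "l > 0" using \<epsilon> E0 \<sigma> by (simp add: l_def)
  let ?S = "\<lambda>\<omega>. \<Sum>m<K. I m \<omega> - drift_part T b H (Xs m) \<omega>"
  let ?G = "\<lambda>\<omega>. \<Sum>m<K. l * (I m \<omega> - drift_part T b H (Xs m) \<omega>) - l\<^sup>2 * \<sigma>\<^sup>2 / 2 * energy T H (Xs m) \<omega>"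
  define q where "q = real K * \<epsilon>\<^sup>2 / (2 * \<sigma>\<^sup>2 * E0)"
  have ge: "?G \<omega> \<ge> q" if "?S \<omega> \<ge> real K * \<epsilon>" for \<omega>
  proof -
    have "?G \<omega> = l * ?S \<omega> - l\<^sup>2 * \<sigma>\<^sup>2 / 2 * (\<Sum>m<K. energy T H (Xs m) \<omega>)"
      by (simp add: sum_subtractf sum_distrib_left right_diff_distrib)
    moreover have "l * ?S \<omega> \<ge> l * (real K * \<epsilon>)" using that l by (intro mult_left_mono) auto
    moreover have "(\<Sum>m<K. energy T H (Xs m) \<omega>) \<le> real K * E0"
      using sum_mono[of "{..<K}" "\<lambda>m. energy T H (Xs m) \<omega>" "\<lambda>_. E0"] E by simp
    then have "l\<^sup>2 * \<sigma>\<^sup>2 / 2 * (\<Sum>m<K. energy T H (Xs m) \<omega>) \<le> l\<^sup>2 * \<sigma>\<^sup>2 / 2 * (real K * E0)"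
      by (intro mult_left_mono) auto
    moreover have "l * (real K * \<epsilon>) - l\<^sup>2 * \<sigma>\<^sup>2 / 2 * (real K * E0) = q"
      using \<sigma> E0 by (simp add: l_def q_def field_simps power2_eq_square)
    ultimately show ?thesis by linarith
  qed
  have "ennreal (exp q) * emeasure Q {\<omega>\<in>space Q. ?S \<omega> \<ge> real K * \<epsilon>} =
      (\<integral>\<^sup>+\<omega>. ennreal (exp q) * indicator {\<omega>\<in>space Q. ?S \<omega> \<ge> real K * \<epsilon>} \<omega> \<partial>Q)"
    by (subst nn_integral_cmult_indicator) measurable
  also have "\<dots> \<le> (\<integral>\<^sup>+\<omega>. ennreal (exp (?G \<omega>)) \<partial>Q)"
    using ge by (intro nn_integral_mono) (auto simp: indicator_def intro!: ennreal_leI)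
  also have "\<dots> \<le> 1" by (rule exp_sum_le_1[OF ito H])
  finally have "exp q * measure Q {\<omega>\<in>space Q. ?S \<omega> \<ge> real K * \<epsilon>} \<le> 1"
    by (simp add: emeasure_eq_measure flip: ennreal_mult)
  then have "measure Q {\<omega>\<in>space Q. ?S \<omega> \<ge> real K * \<epsilon>} \<le> 1 / exp q"
    by (simp add: pos_le_divide_eq mult.commute)
  then show ?thesis by (simp add: q_def exp_minus inverse_eq_divide)
qed

text \<open>Only this tail is needed: coercivity bounds the squared norm by the mean energy, which
  in turn has to be bounded by the empirical one.\<close>

lemma energy_deviation:
  assumes H: "H \<in> borel_measurable borel"
    and E: "\<And>m \<omega>. energy T H (Xs m) \<omega> \<le> E0" and E0: "E0 > 0" and \<epsilon>: "\<epsilon> > 0" and K: "K > 0"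
    and mean: "\<And>m. expectation (energy T H (Xs m)) = \<mu>"
  shows "measure Q {\<omega>\<in>space Q. (\<Sum>m<K. energy T H (Xs m) \<omega>) \<le> real K * \<mu> - real K * \<epsilon>}
    \<le> exp (- (2 * real K * \<epsilon>\<^sup>2 / E0\<^sup>2))"
proof -
  interpret Hoeffding_ineq Q "{..<K}" "\<lambda>m. energy T H (Xs m)" "\<lambda>_. 0" "\<lambda>_. E0" "\<Sum>m<K. expectation (energy T H (Xs m))"
  proof unfold_locales
    show "indep_vars (\<lambda>_. borel) (\<lambda>m. energy T H (Xs m)) {..<K}"
      by (rule indep_vars_natural_filtration) (rule energy_measurable[OF H])
    show "AE x in Q. energy T H (Xs i) x \<in> {0..E0}" for i
      using E by (intro AE_I2) (auto simp: energy_def intro: set_integral_interval_nonneg)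
  qed auto
  have "measure Q {\<omega>\<in>space Q. (\<Sum>m<K. energy T H (Xs m) \<omega>) \<le> (\<Sum>m<K. expectation (energy T H (Xs m))) - real K * \<epsilon>}
    \<le> exp (- 2 * (real K * \<epsilon>)\<^sup>2 / (\<Sum>m<K. (E0 - 0)\<^sup>2))"
    using \<epsilon> K E0 by (intro Hoeffding_ineq_le) auto
  then show ?thesis using K by (simp add: mean power2_eq_square mult_ac)
qed

end

section \<open>Uniform law of large numbers\<close>

lemma linear_on_lincomb:
  fixes d :: nat
  assumes V: "funspace.subspace V"
    and w: "\<And>f g a b. f \<in> V \<Longrightarrow> g \<in> V \<Longrightarrow> w (\<lambda>r. a * f r + b * g r) = a * w f + b * w g"
    and f: "\<And>i. i < d \<Longrightarrow> f i \<in> V"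
  shows "w (\<lambda>r. \<Sum>i<d. c i * f i r) = (\<Sum>i<d. c i * w (f i) :: real)"
  using f
proof (induction d)
  case 0
  have z: "(\<lambda>r. 0) \<in> V" using funspace.subspace_0[OF V] by (simp add: zero_fun_def)
  from w[OF z z, of 0 0] show ?case by simp
next
  case (Suc d)
  have "w (\<lambda>r. 1 * (\<Sum>i<d. c i * f i r) + c d * f d r) = 1 * w (\<lambda>r. \<Sum>i<d. c i * f i r) + c d * w (f d)"
    using Suc.prems by (intro w funspace_lincomb[OF V]) auto
  then show ?case using Suc by simp
qed

text \<open>Let \<open>s\<close> be the supremum of \<open>w\<close> over the ball. Every element of
  the ball is a net point plus \<open>\<delta>\<close> times another element of the ball, whence
  \<open>s \<le> e + \<delta> * s\<close>, and \<open>\<delta> \<le> 1 / 2\<close> gives the factor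
  2. No modulus of continuity of \<open>w\<close> is involved.\<close>

lemma linear_net_bound:
  assumes V: "finite_dim_subspace V"
    and w: "\<And>f g a b. f \<in> V \<Longrightarrow> g \<in> V \<Longrightarrow> w (\<lambda>r. a * f r + b * g r) = a * w f + b * w g"
    and F: "F \<subseteq> V" "\<And>f. f \<in> F \<Longrightarrow> w f \<le> e"
    and net: "\<And>g. g \<in> V \<Longrightarrow> (\<And>r. \<bar>g r\<bar> \<le> K) \<Longrightarrow> \<exists>f\<in>F. \<forall>r. \<bar>g r - f r\<bar> \<le> \<delta> * K"
    and \<delta>: "0 < \<delta>" "\<delta> \<le> 1 / 2" and K: "K > 0"
    and h: "h \<in> V" "\<And>r. \<bar>h r\<bar> \<le> K"
  shows "w h \<le> (2 * e :: real)"
proof -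
  have sub: "funspace.subspace V" using V by (simp add: finite_dim_subspace_def)
  obtain d x l where "d \<le> funspace.dim V" and l: "\<And>i. i < d \<Longrightarrow> l i \<in> V" and rep: "\<And>g r. g \<in> V \<Longrightarrow> g r = (\<Sum>i<d. g (x i) * l i r)"
    by (rule biorthogonal_exists[OF V]) (rule that)
  define A where "A = {g\<in>V. \<forall>r. \<bar>g r\<bar> \<le> K}"
  have bound: "w g \<le> K * (\<Sum>i<d. \<bar>w (l i)\<bar>)" if g: "g \<in> A" for g
  proof -
    have gV: "g \<in> V" and gK: "\<And>r. \<bar>g r\<bar> \<le> K" using g by (auto simp: A_def)
    have "g = (\<lambda>r. \<Sum>i<d. g (x i) * l i r)" using rep[OF gV] by (rule ext)
    then have "w g = w (\<lambda>r. \<Sum>i<d. g (x i) * l i r)" by (rule arg_cong)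
    also have "\<dots> = (\<Sum>i<d. g (x i) * w (l i))" using l by (intro linear_on_lincomb[OF sub w])
    also have "\<dots> \<le> (\<Sum>i<d. K * \<bar>w (l i)\<bar>)"
    proof (rule sum_mono)
      fix i
      have "g (x i) * w (l i) \<le> \<bar>g (x i)\<bar> * \<bar>w (l i)\<bar>" by (metis abs_ge_self abs_mult)
      also have "\<dots> \<le> K * \<bar>w (l i)\<bar>" using gK by (intro mult_right_mono) auto
      finally show "g (x i) * w (l i) \<le> K * \<bar>w (l i)\<bar>" .
    qed
    finally show ?thesis by (simp add: sum_distrib_left)
  qed
  \<comment> \<open>The inequality for \<open>s\<close> is of use only once \<open>s\<close> is
    known to be finite; this follows from the representation by point evaluations.\<close>
  have bdd: "bdd_above (w ` A)" using bound by (intro bdd_aboveI2) auto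
  have hA: "h \<in> A" using h by (simp add: A_def)
  define s where "s = (SUP g\<in>A. w g)"
  have ws: "w g \<le> s" if "g \<in> A" for g unfolding s_def by (rule cSUP_upper[OF that bdd])
  have "(SUP g\<in>A. w g) \<le> e + \<delta> * s"
  proof (rule cSUP_least)
    show "A \<noteq> {}" using hA by auto
    fix g assume g: "g \<in> A"
    then have gV: "g \<in> V" and gK: "\<And>r. \<bar>g r\<bar> \<le> K" by (auto simp: A_def)
    obtain f where f: "f \<in> F" "\<And>r. \<bar>g r - f r\<bar> \<le> \<delta> * K" using net[OF gV gK] by blast
    have fV: "f \<in> V" using f(1) F(1) by auto
    define u where "u = (\<lambda>r. (1 / \<delta>) * g r + (- 1 / \<delta>) * f r)"
    have uV: "u \<in> V" unfolding u_def by (rule funspace_lincomb2[OF sub gV fV])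
    have u_eq: "u r = (g r - f r) / \<delta>" for r by (simp add: u_def diff_divide_distrib)
    have "\<bar>u r\<bar> \<le> K" for r
      using f(2)[of r] \<delta> by (simp add: u_eq abs_divide pos_divide_le_eq mult.commute)
    then have "u \<in> A" using uV by (simp add: A_def)
    have "g = (\<lambda>r. 1 * f r + \<delta> * u r)" using \<delta> by (auto simp: u_eq)
    then have "w g = 1 * w f + \<delta> * w u" using w[OF fV uV, of 1 \<delta>] by simp
    also have "\<dots> \<le> e + \<delta> * s"
      using F(2)[OF f(1)] ws[OF \<open>u \<in> A\<close>] \<delta> by (simp add: add_mono mult_left_mono)
    finally show "w g \<le> e + \<delta> * s" .
  qed
  then have *: "s * (1 - \<delta>) \<le> e" by (simp add: s_def algebra_simps)
  show ?thesis
  \<comment> \<open>For negative \<open>s\<close> the bound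
    \<open>s / 2 \<le> s * (1 - \<delta>)\<close> may fail, but the zero function belongs to the
    ball and forces \<open>s = 0\<close>.\<close>
  proof (cases "s \<le> 0")
    case True
    have "(\<lambda>r. 0) \<in> A" using funspace.subspace_0[OF sub] K by (simp add: A_def zero_fun_def)
    from ws[OF this] have "w (\<lambda>r. 0) \<le> s" .
    moreover have "w (\<lambda>r. 0) = 0"
      using w[of "\<lambda>r. 0" "\<lambda>r. 0" 0 0] funspace.subspace_0[OF sub] by (simp add: zero_fun_def)
    ultimately have "s = 0" using True by simp
    then show ?thesis using * ws[OF hA] by simp
  next
    case False
    then have "s * (1 / 2) \<le> s * (1 - \<delta>)" using \<delta> by (intro mult_left_mono) auto
    then show ?thesis using * ws[OF hA] by simp
  qed
qed

text \<open>The mean energy \<open>\<mu>\<close> is the same for all copies. It stays abstract here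
  and is later expressed through the law of the observed process, for which coercivity is
  stated.\<close>

locale particle_system = iid_system Q T \<sigma> D b Xs
  for Q :: "'v measure" and T \<sigma> D :: real and b :: "real ^ 'd ^ 'n \<Rightarrow> real ^ 'd ^ 'n"
    and Xs :: "nat \<Rightarrow> real \<Rightarrow> 'v \<Rightarrow> real ^ 'd ^ 'n" +
  fixes R :: real and \<mu> :: "(real \<Rightarrow> real) \<Rightarrow> real"
  assumes R: "R > 0"
    and mean: "\<And>h K m. h \<in> kernels R K \<Longrightarrow> expectation (energy T (interaction h) (Xs m)) = \<mu> h"
begin

abbreviation "En h m \<equiv> energy T (interaction h) (Xs m)"
abbreviation "Dr h m \<equiv> drift_part T b (interaction h) (Xs m)"

definition max_energy :: "real \<Rightarrow> real"
  where "max_energy K = T * (real CARD('n) * (K * R)\<^sup>2)"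

lemma interaction_borel: "h \<in> kernels R K \<Longrightarrow> interaction h \<in> borel_measurable (borel :: (real ^ 'd ^ 'n) measure)"
  by (intro borel_measurable_interaction kernelsD(1))

lemma En_nonneg: "0 \<le> En h m \<omega>"
  unfolding energy_def by (rule set_integral_interval_nonneg) simp

lemma En_bound:
  assumes "h \<in> kernels R K"
  shows "En h m \<omega> \<le> max_energy K"
  unfolding energy_def max_energy_def
  using T R interaction_norm_squared_bound[OF assms] by (intro set_integral_interval_le) auto

lemma En_integrable:
  assumes "h \<in> kernels R K"
  shows "integrable Q (En h m)"
  using En_bound[OF assms] En_nonneg
  by (intro integrable_const_bound[where B = "max_energy K"] energy_measurable' interaction_borel[OF assms]) auto

lemma path_continuous: "\<omega> \<in> space Q \<Longrightarrow> continuous_on {0..T} (\<lambda>t. Xs m t \<omega>)"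
  using process[of m] by (simp add: continuous_process_def)

lemma En_set_integrable:
  assumes h: "h \<in> kernels R K" and \<omega>: "\<omega> \<in> space Q"
  shows "set_integrable lborel {0..T} (\<lambda>t. (norm (interaction h (Xs m t \<omega>)))\<^sup>2)"
proof (rule path_set_integrable[OF path_continuous[OF \<omega>] T])
  note [measurable] = interaction_borel[OF h]
  show "(\<lambda>x. (norm (interaction h x))\<^sup>2) \<in> borel_measurable (borel :: (real ^ 'd ^ 'n) measure)" by measurable
  show "\<bar>(norm (interaction h x))\<^sup>2\<bar> \<le> real CARD('n) * (K * R)\<^sup>2" for x :: "real ^ 'd ^ 'n"
    using interaction_norm_squared_bound[OF h, of x] R by simp
qed

lemma Dr_set_integrable:
  assumes h: "h \<in> kernels R K" and \<omega>: "\<omega> \<in> space Q"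
  shows "set_integrable lborel {0..T} (\<lambda>t. interaction h (Xs m t \<omega>) \<bullet> b (Xs m t \<omega>))"
proof (rule path_set_integrable[OF path_continuous[OF \<omega>] T])
  note [measurable] = interaction_borel[OF h]
  show "(\<lambda>x. interaction h x \<bullet> b x) \<in> borel_measurable borel" by measurable
  show "\<bar>interaction h x \<bullet> b x\<bar> \<le> real CARD('n) * (K * R) * D" for x
  proof -
    have "\<bar>interaction h x \<bullet> b x\<bar> \<le> norm (interaction h x) * norm (b x)" by (rule Cauchy_Schwarz_ineq2)
    also have "\<dots> \<le> real CARD('n) * (K * R) * D"
    proof (rule mult_mono)
      show "norm (interaction h x) \<le> real CARD('n) * (K * R)" using interaction_norm_bound[OF h] R by simp
      show "0 \<le> real CARD('n) * (K * R)"
        using order_trans[OF norm_ge_zero interaction_norm_bound[OF h, of x]] R by simp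
    qed (use b_bound in auto)
    finally show ?thesis .
  qed
qed

lemma Dr_lincomb:
  assumes h: "h \<in> kernels R K" and f: "f \<in> kernels R K'" and \<omega>: "\<omega> \<in> space Q"
  shows "Dr (\<lambda>r. a * h r + c * f r) m \<omega> = a * Dr h m \<omega> + c * Dr f m \<omega>"
  using Dr_set_integrable[OF h \<omega>, of m] Dr_set_integrable[OF f \<omega>, of m]
  by (simp add: drift_part_def interaction_lincomb inner_add_left set_integral_add set_integral_mult_right)

text \<open>A difference of squares is the product of a difference of norms, proportional to
  \<open>\<delta>\<close>, and a sum of norms bounded on the ball.\<close>

lemma En_close:
  assumes h: "h \<in> kernels R K" and f: "f \<in> kernels R K" and hf: "(\<lambda>r. h r - f r) \<in> kernels R (\<delta> * K)"
    and \<omega>: "\<omega> \<in> space Q"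
  shows "En h m \<omega> \<le> En f m \<omega> + T * (2 * (real CARD('n))\<^sup>2 * (K * R)\<^sup>2 * \<delta>)"
proof -
  define c where "c = 2 * (real CARD('n))\<^sup>2 * (K * R)\<^sup>2 * \<delta>"
  have le: "(norm (interaction h x))\<^sup>2 \<le> (norm (interaction f x))\<^sup>2 + c" for x :: "real ^ 'd ^ 'n"
  proof -
    have bh: "norm (interaction h x) \<le> real CARD('n) * (K * R)" and bf: "norm (interaction f x) \<le> real CARD('n) * (K * R)"
      and bd: "norm (interaction h x - interaction f x) \<le> real CARD('n) * (\<delta> * K * R)"
      using interaction_norm_bound[OF h, of x] interaction_norm_bound[OF f, of x]
        interaction_norm_bound[OF hf, of x] R by (auto simp: interaction_diff)
    have "(norm (interaction h x))\<^sup>2 - (norm (interaction f x))\<^sup>2 =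
        (norm (interaction h x) - norm (interaction f x)) * (norm (interaction h x) + norm (interaction f x))"
      by (simp add: power2_eq_square algebra_simps)
    also have "\<dots> \<le> (real CARD('n) * (\<delta> * K * R)) * (2 * (real CARD('n) * (K * R)))"
    proof (rule mult_mono)
      show "norm (interaction h x) - norm (interaction f x) \<le> real CARD('n) * (\<delta> * K * R)"
        using norm_triangle_ineq2[of "interaction h x" "interaction f x"] bd by linarith
      show "norm (interaction h x) + norm (interaction f x) \<le> 2 * (real CARD('n) * (K * R))"
        using bh bf by linarith
      show "0 \<le> real CARD('n) * (\<delta> * K * R)" using order_trans[OF norm_ge_zero bd] .
    qed simp
    also have "\<dots> = c" by (simp add: c_def power2_eq_square)
    finally show ?thesis by simp
  qed
  have ic: "set_integrable lborel {0..T} (\<lambda>_. c)"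
    using integrable_indicator_interval[of 0 T] by (simp add: set_integrable_def)
  have "En h m \<omega> \<le> (LBINT t:{0..T}. (norm (interaction f (Xs m t \<omega>)))\<^sup>2 + c)"
    unfolding energy_def
    by (intro set_integral_mono En_set_integrable[OF h \<omega>] set_integral_add(1) En_set_integrable[OF f \<omega>] ic) (simp add: le)
  also have "\<dots> = En f m \<omega> + (LBINT t:{0..T}. c)"
    unfolding energy_def by (intro set_integral_add(2) En_set_integrable[OF f \<omega>] ic)
  also have "(LBINT t:{0..T}. c) = T * c" using T by (simp add: set_lebesgue_integral_def)
  finally show ?thesis by (simp add: c_def)
qed

lemma mean_close:
  assumes h: "h \<in> kernels R K" and f: "f \<in> kernels R K" and hf: "(\<lambda>r. h r - f r) \<in> kernels R (\<delta> * K)"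
  shows "\<mu> h \<le> \<mu> f + T * (2 * (real CARD('n))\<^sup>2 * (K * R)\<^sup>2 * \<delta>)"
proof -
  have "expectation (En h 0) \<le> expectation (\<lambda>\<omega>. En f 0 \<omega> + T * (2 * (real CARD('n))\<^sup>2 * (K * R)\<^sup>2 * \<delta>))"
    using En_integrable[OF h] En_integrable[OF f] En_close[OF h f hf] by (intro integral_mono) auto
  also have "\<dots> = expectation (En f 0) + T * (2 * (real CARD('n))\<^sup>2 * (K * R)\<^sup>2 * \<delta>)"
    using En_integrable[OF f] by (simp add: prob_space)
  finally show ?thesis using mean[OF h] mean[OF f] by simp
qed

text \<open>The smaller of the exponents per sample in \<open>noise_deviation\<close> and
  \<open>energy_deviation\<close>, so that one bound serves both exceptional events.\<close>

definition rate :: "real \<Rightarrow> real \<Rightarrow> real"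
  where "rate K \<epsilon> = min (\<epsilon>\<^sup>2 / (2 * \<sigma>\<^sup>2 * max_energy K)) (2 * \<epsilon>\<^sup>2 / (max_energy K)\<^sup>2)"

lemma max_energy_pos: "K > 0 \<Longrightarrow> max_energy K > 0"
  using T R by (simp add: max_energy_def)

lemma rate_pos: "K > 0 \<Longrightarrow> \<epsilon> > 0 \<Longrightarrow> rate K \<epsilon> > 0"
  using max_energy_pos[of K] \<sigma> by (simp add: rate_def)

text \<open>Union bound over a net, then passage to the ball: by \<open>linear_net_bound\<close> for
  the noise and by \<open>En_close\<close> for the energy. The exceptional set depends on the net
  alone, so no supremum over uncountably many kernels has to be measurable. Linearity of
  \<open>J\<close> is a hypothesis on \<open>\<omega>\<close> because it holds only almost
  surely.\<close>

lemma uniform_bound: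
  assumes V: "finite_dim_subspace V" "V \<subseteq> C11 R" and K: "K > 0" and \<delta>: "0 < \<delta>" "\<delta> \<le> 1 / 2" and \<epsilon>: "\<epsilon> > 0"
    and M: "M > 0"
    and J: "\<And>m h. h \<in> V \<Longrightarrow> has_ito_integral Q T (Xs m) (\<lambda>t \<omega>. interaction h (Xs m t \<omega>)) (J m h)"
  obtains A where "A \<in> sets Q" "measure Q A \<le> (8 / \<delta>) ^ funspace.dim V * (2 * exp (- (real M * rate K \<epsilon>)))"
    "\<And>\<omega> h. \<omega> \<in> space Q - A \<Longrightarrow>
      (\<forall>m. \<forall>f\<in>V. \<forall>g\<in>V. \<forall>a c. J m (\<lambda>r. a * f r + c * g r) \<omega> = a * J m f \<omega> + c * J m g \<omega>) \<Longrightarrow>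
      h \<in> V \<Longrightarrow> h \<in> kernels R K \<Longrightarrow>
      real M * \<mu> h \<le> (\<Sum>m<M. En h m \<omega>) + real M * (\<epsilon> + 2 * (T * (2 * (real CARD('n))\<^sup>2 * (K * R)\<^sup>2 * \<delta>))) \<and>
      (\<Sum>m<M. J m h \<omega> - Dr h m \<omega>) \<le> 2 * (real M * \<epsilon>)"
proof -
  define c where "c = T * (2 * (real CARD('n))\<^sup>2 * (K * R)\<^sup>2 * \<delta>)"
  have bdd: "\<exists>C. \<forall>r. \<bar>g r\<bar> \<le> C" if "g \<in> V" for g
    using C11_bounded[of g R] V(2) that by blast
  have \<delta>1: "\<delta> \<le> 1" using \<delta>(2) by simp
  obtain F where F: "finite F" "F \<subseteq> V" "\<forall>f\<in>F. \<forall>r. \<bar>f r\<bar> \<le> K"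
    "real (card F) \<le> (8 / \<delta>) ^ funspace.dim V"
    and net': "\<forall>g\<in>V. (\<forall>r. \<bar>g r\<bar> \<le> K) \<longrightarrow> (\<exists>f\<in>F. \<forall>r. \<bar>g r - f r\<bar> \<le> \<delta> * K)"
    using finite_net[OF V(1) bdd \<delta>(1) \<delta>1 K] by metis
  have net: "\<exists>f\<in>F. \<forall>r. \<bar>g r - f r\<bar> \<le> \<delta> * K" if "g \<in> V" "\<And>r. \<bar>g r\<bar> \<le> K" for g
    using net' that by blast
  have Fk: "f \<in> kernels R K" if "f \<in> F" for f
    using C11_kernelI[of f R K] F(2,3) V(2) that by auto
  define A1 where "A1 f = {\<omega>\<in>space Q. (\<Sum>m<M. J m f \<omega> - Dr f m \<omega>) \<ge> real M * \<epsilon>}" for f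
  define A2 where "A2 f = {\<omega>\<in>space Q. (\<Sum>m<M. En f m \<omega>) \<le> real M * \<mu> f - real M * \<epsilon>}" for f
  define A where "A = (\<Union>f\<in>F. A1 f \<union> A2 f)"
  have sets: "A1 f \<in> sets Q" "A2 f \<in> sets Q" if f: "f \<in> F" for f
  proof -
    have [measurable]: "J m f \<in> borel_measurable Q" for m
      using J[of f m] f F(2) by (auto simp: has_ito_integral_def)
    note [measurable] = drift_part_measurable[OF interaction_borel[OF Fk[OF f]]] energy_measurable'[OF interaction_borel[OF Fk[OF f]]]
    show "A1 f \<in> sets Q" "A2 f \<in> sets Q" unfolding A1_def A2_def by measurable
  qed
  have m1: "measure Q (A1 f) \<le> exp (- (real M * rate K \<epsilon>))" if f: "f \<in> F" for f
  proof -
    have "measure Q (A1 f) \<le> exp (- (real M * \<epsilon>\<^sup>2 / (2 * \<sigma>\<^sup>2 * max_energy K)))"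
      unfolding A1_def
    proof (rule noise_deviation)
      show "has_ito_integral Q T (Xs m) (\<lambda>t \<omega>. interaction f (Xs m t \<omega>)) (J m f)" for m
        using J f F(2) by auto
      show "norm (interaction f x) \<le> real CARD('n) * (K * R)" for x :: "real ^ 'd ^ 'n"
        using interaction_norm_bound[OF Fk[OF f]] R by simp
    qed (use interaction_borel[OF Fk[OF f]] En_bound[OF Fk[OF f]] max_energy_pos[OF K] \<epsilon> in auto)
    also have "\<dots> \<le> exp (- (real M * rate K \<epsilon>))"
    proof -
      have "real M * rate K \<epsilon> \<le> real M * (\<epsilon>\<^sup>2 / (2 * \<sigma>\<^sup>2 * max_energy K))"
        unfolding rate_def by (intro mult_left_mono) auto
      then show ?thesis by simp
    qed
    finally show ?thesis .
  qed
  have m2: "measure Q (A2 f) \<le> exp (- (real M * rate K \<epsilon>))" if f: "f \<in> F" for f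
  proof -
    have "measure Q (A2 f) \<le> exp (- (2 * real M * \<epsilon>\<^sup>2 / (max_energy K)\<^sup>2))"
      unfolding A2_def
      by (rule energy_deviation[OF interaction_borel[OF Fk[OF f]] En_bound[OF Fk[OF f]] max_energy_pos[OF K] \<epsilon> M mean[OF Fk[OF f]]])
    also have "\<dots> \<le> exp (- (real M * rate K \<epsilon>))"
    proof -
      have "real M * rate K \<epsilon> \<le> real M * (2 * \<epsilon>\<^sup>2 / (max_energy K)\<^sup>2)"
        unfolding rate_def by (intro mult_left_mono) auto
      then show ?thesis by (simp add: mult_ac)
    qed
    finally show ?thesis .
  qed
  show ?thesis
  proof (rule that[of A])
    show "A \<in> sets Q" unfolding A_def using F(1) sets by auto
    have "measure Q A \<le> (\<Sum>f\<in>F. measure Q (A1 f \<union> A2 f))"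
      unfolding A_def using F(1) sets by (intro finite_measure_subadditive_finite) auto
    also have "\<dots> \<le> (\<Sum>f\<in>F. 2 * exp (- (real M * rate K \<epsilon>)))"
    proof (rule sum_mono)
      fix f assume f: "f \<in> F"
      have "measure Q (A1 f \<union> A2 f) \<le> measure Q (A1 f) + measure Q (A2 f)"
        using sets[OF f] by (intro measure_Un_le) auto
      then show "measure Q (A1 f \<union> A2 f) \<le> 2 * exp (- (real M * rate K \<epsilon>))"
        using m1[OF f] m2[OF f] by linarith
    qed
    also have "\<dots> = real (card F) * (2 * exp (- (real M * rate K \<epsilon>)))" by simp
    also have "\<dots> \<le> (8 / \<delta>) ^ funspace.dim V * (2 * exp (- (real M * rate K \<epsilon>)))"
      using F(4) by (intro mult_right_mono) auto
    finally show "measure Q A \<le> (8 / \<delta>) ^ funspace.dim V * (2 * exp (- (real M * rate K \<epsilon>)))" .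
  next
    fix \<omega> h
    assume \<omega>: "\<omega> \<in> space Q - A"
      and lin: "\<forall>m. \<forall>f\<in>V. \<forall>g\<in>V. \<forall>a c. J m (\<lambda>r. a * f r + c * g r) \<omega> = a * J m f \<omega> + c * J m g \<omega>"
      and h: "h \<in> V" "h \<in> kernels R K"
    have \<omega>': "\<omega> \<in> space Q" using \<omega> by simp
    have n1: "(\<Sum>m<M. J m f \<omega> - Dr f m \<omega>) \<le> real M * \<epsilon>" if "f \<in> F" for f
      using \<omega> that by (auto simp: A_def A1_def)
    have n2: "real M * \<mu> f \<le> (\<Sum>m<M. En f m \<omega>) + real M * \<epsilon>" if "f \<in> F" for f
      using \<omega> that by (force simp: A_def A2_def)
    have 1: "(\<Sum>m<M. J m h \<omega> - Dr h m \<omega>) \<le> 2 * (real M * \<epsilon>)"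
    proof (rule linear_net_bound[where w = "\<lambda>h. \<Sum>m<M. J m h \<omega> - Dr h m \<omega>" and V = V and F = F and K = K])
      fix f g :: "real \<Rightarrow> real" and a c' :: real assume fg: "f \<in> V" "g \<in> V"
      obtain Kf Kg where "f \<in> kernels R Kf" "g \<in> kernels R Kg" using fg V(2) C11_kernel by (metis subsetD)
      then have "Dr (\<lambda>r. a * f r + c' * g r) m \<omega> = a * Dr f m \<omega> + c' * Dr g m \<omega>" for m
        using \<omega>' by (rule Dr_lincomb)
      moreover have "J m (\<lambda>r. a * f r + c' * g r) \<omega> = a * J m f \<omega> + c' * J m g \<omega>" for m
        using lin fg by blast
      ultimately show "(\<Sum>m<M. J m (\<lambda>r. a * f r + c' * g r) \<omega> - Dr (\<lambda>r. a * f r + c' * g r) m \<omega>) =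
          a * (\<Sum>m<M. J m f \<omega> - Dr f m \<omega>) + c' * (\<Sum>m<M. J m g \<omega> - Dr g m \<omega>)"
        by (simp add: sum.distrib sum_subtractf sum_distrib_left algebra_simps)
    next
      show "(\<Sum>m<M. J m f \<omega> - Dr f m \<omega>) \<le> real M * \<epsilon>" if "f \<in> F" for f using that by (rule n1)
      show "\<exists>f\<in>F. \<forall>r. \<bar>g r - f r\<bar> \<le> \<delta> * K" if "g \<in> V" "\<And>r. \<bar>g r\<bar> \<le> K" for g using that by (rule net)
      show "\<bar>h r\<bar> \<le> K" for r by (rule kernelsD(2)[OF h(2)])
    qed (rule V(1) F(2) \<delta> K h(1))+
    obtain f where f: "f \<in> F" "\<And>r. \<bar>h r - f r\<bar> \<le> \<delta> * K"
      using net[OF h(1)] kernelsD(2)[OF h(2)] by blast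
    have fk: "f \<in> kernels R K" by (rule Fk[OF f(1)])
    have hf: "(\<lambda>r. h r - f r) \<in> kernels R (\<delta> * K)" and fh: "(\<lambda>r. f r - h r) \<in> kernels R (\<delta> * K)"
      using h(2) fk f(2) by (auto simp: kernels_def abs_minus_commute)
    \<comment> \<open>Replacing \<open>h\<close> by a net point costs \<open>c\<close> twice, once
      for the mean and once for the empirical sum.\<close>
    have "real M * \<mu> h \<le> real M * (\<mu> f + c)"
      unfolding c_def by (intro mult_left_mono mean_close[OF h(2) fk hf]) auto
    also have "\<dots> \<le> (\<Sum>m<M. En f m \<omega>) + real M * \<epsilon> + real M * c"
      using n2[OF f(1)] by (simp add: algebra_simps)
    also have "(\<Sum>m<M. En f m \<omega>) \<le> (\<Sum>m<M. En h m \<omega> + c)"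
      unfolding c_def by (intro sum_mono En_close[OF fk h(2) fh \<omega>'])
    also have "(\<Sum>m<M. En h m \<omega> + c) + real M * \<epsilon> + real M * c = (\<Sum>m<M. En h m \<omega>) + real M * (\<epsilon> + 2 * c)"
      by (simp add: sum.distrib algebra_simps)
    finally have 2: "real M * \<mu> h \<le> (\<Sum>m<M. En h m \<omega>) + real M * (\<epsilon> + 2 * c)" by simp
    show "real M * \<mu> h \<le> (\<Sum>m<M. En h m \<omega>) + real M * (\<epsilon> + 2 * (T * (2 * (real CARD('n))\<^sup>2 * (K * R)\<^sup>2 * \<delta>))) \<and>
      (\<Sum>m<M. J m h \<omega> - Dr h m \<omega>) \<le> 2 * (real M * \<epsilon>)"
      using 1 2 unfolding c_def by blast
  qed
qed

end

section \<open>Dimension against sample size, and almost sure uniform estimates\<close>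

lemma dim_sample_ratio_tendsto_0:
  assumes n: "filterlim nM at_top sequentially"
    and lim: "(\<lambda>M. real (nM M) * ln (real (nM M)) / real M) \<longlonglongrightarrow> 0"
  shows "(\<lambda>M. real (nM M) / real M) \<longlonglongrightarrow> 0"
proof (rule Lim_null_comparison[OF _ lim])
  have "\<forall>\<^sub>F M in sequentially. nM M \<ge> 3" using n by (simp add: filterlim_at_top)
  then show "\<forall>\<^sub>F M in sequentially. norm (real (nM M) / real M) \<le> real (nM M) * ln (real (nM M)) / real M"
  proof eventually_elim
    case (elim M)
    have "exp 1 \<le> (3::real)" by (rule exp_le)
    also have "3 \<le> real (nM M)" using elim by simp
    finally have "1 \<le> ln (real (nM M))" using elim by (subst ln_ge_iff) auto
    then have "real (nM M) * 1 \<le> real (nM M) * ln (real (nM M))" by (intro mult_left_mono) auto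
    then show ?case by (simp add: divide_right_mono)
  qed
qed

text \<open>Since \<open>nM M / M\<close> tends to 0, the entropy \<open>nM M * ln A\<close> is
  eventually at most half of the exponent \<open>M * \<kappa>\<close>; a geometric series
  remains.\<close>

lemma summable_entropy_exp:
  assumes A: "A > 1" and \<kappa>: "\<kappa> > 0" and lim: "(\<lambda>M. real (nM M) / real M) \<longlonglongrightarrow> 0"
    and f: "\<And>M. M \<ge> 1 \<Longrightarrow> f M \<le> A ^ nM M * (2 * exp (- (real M * \<kappa>)))" "\<And>M. 0 \<le> f M"
  shows "summable (f :: nat \<Rightarrow> real)"
proof (rule summable_comparison_test_ev)
  have "ln A > 0" using A by simp
  then have "0 < \<kappa> / (2 * ln A)" using \<kappa> by simp
  from order_tendstoD(2)[OF lim this] eventually_ge_at_top[of 1]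
  show "\<forall>\<^sub>F M in sequentially. norm (f M) \<le> 2 * exp (- \<kappa> / 2) ^ M"
  proof eventually_elim
    case (elim M)
    have "real (nM M) * ln A \<le> real M * \<kappa> / 2"
      using elim \<open>ln A > 0\<close> by (simp add: field_simps)
    then have "exp (real (nM M) * ln A) \<le> exp (real M * \<kappa> / 2)" by simp
    then have "A ^ nM M \<le> exp (real M * \<kappa> / 2)" using A by (simp add: exp_of_nat_mult)
    then have "A ^ nM M * (2 * exp (- (real M * \<kappa>))) \<le> exp (real M * \<kappa> / 2) * (2 * exp (- (real M * \<kappa>)))"
      by (intro mult_right_mono) auto
    also have "\<dots> = 2 * exp (real M * (- \<kappa> / 2))"
      by (simp flip: exp_add)
    also have "\<dots> = 2 * exp (- \<kappa> / 2) ^ M" by (simp only: exp_of_nat_mult)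
    finally show ?case using f(1)[of M] f(2)[of M] elim by simp
  qed
  show "summable (\<lambda>M. 2 * exp (- \<kappa> / 2) ^ M)"
    using \<kappa> by (intro summable_mult summable_geometric) simp
qed

context particle_system
begin

text \<open>The quantifier over \<open>h\<close> stands inside the almost sure statement, so that a
  kernel depending on \<open>\<omega>\<close> may be inserted.\<close>

lemma uniform_law:
  assumes L: "\<And>n. n \<ge> 1 \<Longrightarrow> finite_dim_subspace (L n) \<and> L n \<subseteq> C11 R"
    and nM: "\<And>M. M \<ge> 1 \<Longrightarrow> nM M \<ge> 1 \<and> funspace.dim (L (nM M)) = nM M"
    and lim: "(\<lambda>M. real (nM M) / real M) \<longlonglongrightarrow> 0"
    and J: "\<And>m n. n \<ge> 1 \<Longrightarrow> interaction_integrals Q T (Xs m) (L n) (J m)"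
    and K: "K > 0" and \<epsilon>: "\<epsilon> > 0"
  shows "AE \<omega> in Q. \<forall>\<^sub>F M in sequentially. \<forall>h\<in>L (nM M). h \<in> kernels R K \<longrightarrow>
    real M * \<mu> h \<le> (\<Sum>m<M. En h m \<omega>) + real M * \<epsilon> \<and>
    (\<Sum>m<M. J m h \<omega> - Dr h m \<omega>) \<le> real M * \<epsilon>"
proof -
  define c where "c = T * (2 * (real CARD('n))\<^sup>2 * (K * R)\<^sup>2)"
  have c: "c > 0" using T K R by (simp add: c_def)
  \<comment> \<open>The doubled approximation error \<open>2 * (c * \<delta>)\<close> uses up one
    half of \<open>\<epsilon>\<close>. The deviation bounds are taken at the other half, which also
    absorbs the factor 2 of the noise.\<close>
  define \<delta> where "\<delta> = min (1 / 2) (\<epsilon> / (4 * c))"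
  have \<delta>: "0 < \<delta>" "\<delta> \<le> 1 / 2" using \<epsilon> c by (auto simp: \<delta>_def)
  have "\<delta> \<le> \<epsilon> / (4 * c)" by (simp add: \<delta>_def)
  then have c\<delta>: "2 * (c * \<delta>) \<le> \<epsilon> / 2" using c by (simp add: field_simps)
  have \<epsilon>2: "\<epsilon> / 2 > 0" using \<epsilon> by simp
  define lin where "lin M \<omega> \<longleftrightarrow> (\<forall>m. \<forall>f\<in>L (nM M). \<forall>g\<in>L (nM M). \<forall>a c.
      J m (\<lambda>r. a * f r + c * g r) \<omega> = a * J m f \<omega> + c * J m g \<omega>)" for M \<omega>
  define good where "good M \<omega> \<longleftrightarrow> (\<forall>h\<in>L (nM M). h \<in> kernels R K \<longrightarrow>
    real M * \<mu> h \<le> (\<Sum>m<M. En h m \<omega>) + real M * \<epsilon> \<and> (\<Sum>m<M. J m h \<omega> - Dr h m \<omega>) \<le> real M * \<epsilon>)" for M \<omega>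
  define \<kappa> where "\<kappa> = rate K (\<epsilon> / 2)"
  have \<kappa>: "\<kappa> > 0" unfolding \<kappa>_def by (rule rate_pos[OF K \<epsilon>2])
  have "\<exists>A. A \<in> sets Q \<and> measure Q A \<le> (8 / \<delta>) ^ nM M * (2 * exp (- (real M * \<kappa>))) \<and>
      (\<forall>\<omega>\<in>space Q - A. lin M \<omega> \<longrightarrow> good M \<omega>)" if M: "M \<ge> 1" for M
  proof -
    have n: "nM M \<ge> 1" "funspace.dim (L (nM M)) = nM M" using nM[OF M] by auto
    have V: "finite_dim_subspace (L (nM M))" "L (nM M) \<subseteq> C11 R" using L[OF n(1)] by auto
    have ito: "has_ito_integral Q T (Xs m) (\<lambda>t \<omega>. interaction h (Xs m t \<omega>)) (J m h)" if "h \<in> L (nM M)" for m h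
      using J[OF n(1), of m] that by (simp add: interaction_integrals_def)
    have M0: "M > 0" using M by simp
    show ?thesis
    proof (rule uniform_bound[OF V K \<delta> \<epsilon>2 M0 ito])
      fix A
      assume A: "A \<in> sets Q" "measure Q A \<le> (8 / \<delta>) ^ funspace.dim (L (nM M)) * (2 * exp (- (real M * rate K (\<epsilon> / 2))))"
        and *: "\<And>\<omega> h. \<omega> \<in> space Q - A \<Longrightarrow>
          (\<forall>m. \<forall>f\<in>L (nM M). \<forall>g\<in>L (nM M). \<forall>a c. J m (\<lambda>r. a * f r + c * g r) \<omega> = a * J m f \<omega> + c * J m g \<omega>) \<Longrightarrow>
          h \<in> L (nM M) \<Longrightarrow> h \<in> kernels R K \<Longrightarrow>
          real M * \<mu> h \<le> (\<Sum>m<M. En h m \<omega>) + real M * (\<epsilon> / 2 + 2 * (T * (2 * (real CARD('n))\<^sup>2 * (K * R)\<^sup>2 * \<delta>))) \<and>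
          (\<Sum>m<M. J m h \<omega> - Dr h m \<omega>) \<le> 2 * (real M * (\<epsilon> / 2))"
      have "good M \<omega>" if \<omega>: "\<omega> \<in> space Q - A" and l: "lin M \<omega>" for \<omega>
        unfolding good_def
      proof (intro ballI impI)
        fix h assume h: "h \<in> L (nM M)" "h \<in> kernels R K"
        note ** = *[OF \<omega> l[unfolded lin_def] h]
        have "real M * (\<epsilon> / 2 + 2 * (T * (2 * (real CARD('n))\<^sup>2 * (K * R)\<^sup>2 * \<delta>))) \<le> real M * \<epsilon>"
          using c\<delta> by (intro mult_left_mono) (simp_all add: c_def mult.assoc)
        with ** show "real M * \<mu> h \<le> (\<Sum>m<M. En h m \<omega>) + real M * \<epsilon> \<and> (\<Sum>m<M. J m h \<omega> - Dr h m \<omega>) \<le> real M * \<epsilon>"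
          by simp
      qed
      then show ?thesis using A n(2) unfolding \<kappa>_def by (intro exI[of _ A]) simp
    qed
  qed
  then obtain A where A: "\<And>M. M \<ge> 1 \<Longrightarrow> A M \<in> sets Q"
    "\<And>M. M \<ge> 1 \<Longrightarrow> measure Q (A M) \<le> (8 / \<delta>) ^ nM M * (2 * exp (- (real M * \<kappa>)))"
    "\<And>M \<omega>. M \<ge> 1 \<Longrightarrow> \<omega> \<in> space Q - A M \<Longrightarrow> lin M \<omega> \<Longrightarrow> good M \<omega>" by metis
  \<comment> \<open>The bounds start at \<open>M = 1\<close>; at 0 the empty set is a harmless
    filler.\<close>
  define B where "B M = (if M \<ge> 1 then A M else {})" for M
  have "AE \<omega> in Q. \<forall>\<^sub>F M in sequentially. \<omega> \<in> space Q - B M"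
  proof (rule borel_cantelli_AE1)
    show "B M \<in> sets Q" for M using A(1) by (simp add: B_def)
    show "emeasure Q (B M) < \<infinity>" for M by (simp add: emeasure_eq_measure)
    show "summable (\<lambda>M. measure Q (B M))"
    proof (rule summable_entropy_exp[OF _ \<kappa> lim])
      show "8 / \<delta> > 1" using \<delta> by simp
      show "measure Q (B M) \<le> (8 / \<delta>) ^ nM M * (2 * exp (- (real M * \<kappa>)))" if "M \<ge> 1" for M
        using A(2)[OF that] that by (simp add: B_def)
    qed simp
  qed
  \<comment> \<open>There is one null set for each copy and each space, countably many in
    all.\<close>
  moreover have "AE \<omega> in Q. \<forall>M\<ge>1. lin M \<omega>"
  proof -
    have "AE \<omega> in Q. \<forall>m. \<forall>n. n \<ge> 1 \<longrightarrow> (\<forall>f\<in>L n. \<forall>g\<in>L n. \<forall>a c.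
      J m (\<lambda>r. a * f r + c * g r) \<omega> = a * J m f \<omega> + c * J m g \<omega>)"
      using J unfolding AE_all_countable interaction_integrals_def by auto
    then show ?thesis
    proof eventually_elim
      case (elim \<omega>)
      show ?case unfolding lin_def using elim nM by blast
    qed
  qed
  ultimately have "AE \<omega> in Q. \<forall>\<^sub>F M in sequentially. good M \<omega>"
  proof eventually_elim
    case (elim \<omega>)
    from elim(1) eventually_ge_at_top[of 1] show ?case
    proof eventually_elim
      case (elim M)
      then show ?case using A(3)[of M \<omega>] \<open>\<forall>M\<ge>1. lin M \<omega>\<close> by (simp add: B_def)
    qed
  qed
  then show ?thesis by (simp add: good_def)
qed

section \<open>The basic inequality for minimizers\<close>

lemma En_diff:
  assumes b: "b = interaction f" and g: "g \<in> kernels R K" and f: "f \<in> kernels R K'" and \<omega>: "\<omega> \<in> space Q"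
  shows "En (\<lambda>r. g r - f r) m \<omega> = En g m \<omega> - 2 * Dr g m \<omega> + En f m \<omega>"
proof -
  have eq: "(norm (interaction (\<lambda>r. g r - f r) x))\<^sup>2 =
      (norm (interaction g x))\<^sup>2 - 2 * (interaction g x \<bullet> b x) + (norm (interaction f x))\<^sup>2" for x
    by (simp add: b interaction_diff power2_norm_eq_inner inner_diff_left inner_diff_right inner_commute)
  have 1: "set_integrable lborel {0..T} (\<lambda>t. 2 * (interaction g (Xs m t \<omega>) \<bullet> b (Xs m t \<omega>)))"
    using Dr_set_integrable[OF g \<omega>, of m] by simp
  have 2: "set_integrable lborel {0..T} (\<lambda>t. (norm (interaction g (Xs m t \<omega>)))\<^sup>2 - 2 * (interaction g (Xs m t \<omega>) \<bullet> b (Xs m t \<omega>)))"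
    by (intro set_integral_diff(1) En_set_integrable[OF g \<omega>] 1)
  show ?thesis
    unfolding energy_def drift_part_def eq
    by (simp only: set_integral_add(2)[OF 2 En_set_integrable[OF f \<omega>]]
        set_integral_diff(2)[OF En_set_integrable[OF g \<omega>] 1] set_integral_mult_right)
qed

lemma En_diff_le:
  assumes g: "g \<in> kernels R K" and f: "f \<in> kernels R K'" and \<omega>: "\<omega> \<in> space Q"
  shows "En (\<lambda>r. g r - f r) m \<omega> \<le> 2 * En g m \<omega> + 2 * En f m \<omega>"
proof -
  have le: "(norm (interaction (\<lambda>r. g r - f r) x))\<^sup>2 \<le> 2 * (norm (interaction g x))\<^sup>2 + 2 * (norm (interaction f x))\<^sup>2"
    for x :: "real ^ 'd ^ 'n"
    using zero_le_power2[of "norm (interaction g x + interaction f x)"]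
    by (simp add: interaction_diff power2_norm_eq_inner inner_diff_left inner_diff_right
        inner_add_left inner_add_right inner_commute)
  have 1: "set_integrable lborel {0..T} (\<lambda>t. 2 * (norm (interaction g (Xs m t \<omega>)))\<^sup>2)"
    and 2: "set_integrable lborel {0..T} (\<lambda>t. 2 * (norm (interaction f (Xs m t \<omega>)))\<^sup>2)"
    using En_set_integrable[OF g \<omega>, of m] En_set_integrable[OF f \<omega>, of m] by simp_all
  have "En (\<lambda>r. g r - f r) m \<omega> \<le> (LBINT t:{0..T}. 2 * (norm (interaction g (Xs m t \<omega>)))\<^sup>2 + 2 * (norm (interaction f (Xs m t \<omega>)))\<^sup>2)"
    unfolding energy_def
    by (intro set_integral_mono En_set_integrable[OF kernels_diff[OF g f] \<omega>] set_integral_add(1) 1 2 le)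
  also have "\<dots> = 2 * En g m \<omega> + 2 * En f m \<omega>"
    unfolding energy_def by (simp only: set_integral_add(2)[OF 1 2] set_integral_mult_right)
  finally show ?thesis .
qed

text \<open>Completing the square controls the energy of \<open>g - f\<close>, but uniform estimates
  are available for elements of the space only, hence for \<open>g - h\<close>. The detour through
  \<open>f\<close> doubles the energies of \<open>g - f\<close> and \<open>h - f\<close>, which
  results in the two factors 4.\<close>

lemma minimizer_energy:
  assumes b: "b = interaction f" and f: "f \<in> kernels R Kf" and g: "g \<in> kernels R Kg" and h: "h \<in> kernels R Kh"
    and \<omega>: "\<omega> \<in> space Q"
    and J: "\<And>m. J m (\<lambda>r. 1 * g r + (-1) * h r) \<omega> = 1 * J m g \<omega> + (-1) * J m h \<omega>"
    and le: "empirical_error \<sigma> T Xs J M g \<omega> \<le> empirical_error \<sigma> T Xs J M h \<omega>" and M: "M > 0"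
  shows "(\<Sum>m<M. En (\<lambda>r. g r - h r) m \<omega>) \<le> 4 * (\<Sum>m<M. En (\<lambda>r. h r - f r) m \<omega>) +
    4 * (\<Sum>m<M. J m (\<lambda>r. g r - h r) \<omega> - Dr (\<lambda>r. g r - h r) m \<omega>)"
proof -
  define k where "k = 1 / (2 * \<sigma>\<^sup>2 * T * real CARD('n))"
  have k: "k > 0" using \<sigma> T by (simp add: k_def)
  have err: "empirical_error \<sigma> T Xs J M u \<omega> = (k / real M) * (\<Sum>m<M. En u m \<omega> - 2 * J m u \<omega>)" for u
    by (simp add: empirical_error_def path_error_def energy_def k_def sum_distrib_left mult_ac)
  have basic: "(\<Sum>m<M. En g m \<omega> - 2 * J m g \<omega>) \<le> (\<Sum>m<M. En h m \<omega> - 2 * J m h \<omega>)"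
  proof -
    have "k / real M > 0" using k M by simp
    then show ?thesis using le unfolding err by (simp only: mult_le_cancel_left_pos)
  qed
  have J': "J m (\<lambda>r. g r - h r) \<omega> = J m g \<omega> - J m h \<omega>" for m using J[of m] by simp
  have D': "Dr (\<lambda>r. g r - h r) m \<omega> = Dr g m \<omega> - Dr h m \<omega>" for m
    using Dr_lincomb[OF g h \<omega>, of 1 "-1" m] by simp
  have "(\<Sum>m<M. En (\<lambda>r. g r - f r) m \<omega>) = (\<Sum>m<M. En g m \<omega> - 2 * J m g \<omega>) + 2 * (\<Sum>m<M. J m g \<omega> - Dr g m \<omega>) + (\<Sum>m<M. En f m \<omega>)"
    by (simp add: En_diff[OF b g f \<omega>] sum.distrib sum_subtractf sum_distrib_left algebra_simps)
  also have "\<dots> \<le> (\<Sum>m<M. En h m \<omega> - 2 * J m h \<omega>) + 2 * (\<Sum>m<M. J m g \<omega> - Dr g m \<omega>) + (\<Sum>m<M. En f m \<omega>)"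
    using basic by simp
  also have "\<dots> = (\<Sum>m<M. En (\<lambda>r. h r - f r) m \<omega>) + 2 * (\<Sum>m<M. J m (\<lambda>r. g r - h r) \<omega> - Dr (\<lambda>r. g r - h r) m \<omega>)"
    by (simp add: En_diff[OF b h f \<omega>] J' D' sum.distrib sum_subtractf sum_distrib_left algebra_simps)
  finally have 1: "(\<Sum>m<M. En (\<lambda>r. g r - f r) m \<omega>) \<le> \<dots>" .
  have "(\<Sum>m<M. En (\<lambda>r. g r - h r) m \<omega>) \<le> (\<Sum>m<M. 2 * En (\<lambda>r. g r - f r) m \<omega> + 2 * En (\<lambda>r. h r - f r) m \<omega>)"
  proof (rule sum_mono)
    fix m
    show "En (\<lambda>r. g r - h r) m \<omega> \<le> 2 * En (\<lambda>r. g r - f r) m \<omega> + 2 * En (\<lambda>r. h r - f r) m \<omega>"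
      using En_diff_le[OF kernels_diff[OF g f] kernels_diff[OF h f] \<omega>, of m] by simp
  qed
  also have "\<dots> = 2 * (\<Sum>m<M. En (\<lambda>r. g r - f r) m \<omega>) + 2 * (\<Sum>m<M. En (\<lambda>r. h r - f r) m \<omega>)"
    by (simp add: sum.distrib sum_distrib_left)
  finally show ?thesis using 1 by simp
qed

end

section \<open>The seminorm belonging to the distribution of pairwise distances\<close>

lemma finite_measure_rho:
  fixes X :: "real \<Rightarrow> 'w \<Rightarrow> real ^ 'd ^ 'n::{finite,linorder}"
  assumes P: "prob_space P" and X: "continuous_process P T X" and T: "T > 0"
  shows "finite_measure (rho P T X)"
proof (rule finite_measureI)
  interpret prob_space P by fact
  have "(\<integral>\<^sup>+t\<in>{0..T}. (\<Sum>(i, i')\<in>{(i, i'). i < i'}. emeasure P {\<omega>\<in>space P. norm (X t \<omega> $ i' - X t \<omega> $ i) \<in> UNIV}) \<partial>lborel)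
     = (\<integral>\<^sup>+t. ennreal (real (card {(i, i'::'n). i < i'})) * indicator {0..T} t \<partial>lborel)"
    by (intro nn_integral_cong) (simp add: emeasure_space_1 case_prod_beta' ennreal_of_nat_eq_real_of_nat)
  also have "\<dots> = ennreal (real (card {(i, i'::'n). i < i'})) * ennreal T"
    using T by (subst nn_integral_cmult_indicator) auto
  finally have "emeasure (rho P T X) UNIV = ennreal (1 / (real (CARD('n) choose 2) * T)) * (ennreal (real (card {(i, i'::'n). i < i'})) * ennreal T)"
    using emeasure_rho[OF P X T, of UNIV] by simp
  then show "emeasure (rho P T X) (space (rho P T X)) \<noteq> \<infinity>"
    by (simp add: ennreal_mult_eq_top_iff)
qed

context
  fixes \<rho> :: "real measure" and R :: real
  assumes fin: "finite_measure \<rho>" and sets: "sets \<rho> = sets borel" and R: "R > 0"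
begin

lemma rho_norm_squared: "(rho_norm \<rho> g)\<^sup>2 = (LINT r:{0..}|\<rho>. \<bar>g r * r\<bar>\<^sup>2)"
proof -
  have "0 \<le> (LINT r:{0..}|\<rho>. \<bar>g r * r\<bar>\<^sup>2)"
    unfolding set_lebesgue_integral_def by (intro integral_nonneg_AE) (auto simp: indicator_def)
  then show ?thesis by (simp add: rho_norm_def)
qed

lemma kernel_rho_norm_finite:
  assumes g: "g \<in> kernels R K"
  shows "rho_norm_finite \<rho> g"
proof -
  interpret finite_measure \<rho> by fact
  note [measurable_cong] = sets
  have [measurable]: "g \<in> borel_measurable borel" by (rule kernelsD(1)[OF g])
  show ?thesis
    unfolding rho_norm_finite_def set_integrable_def
  proof (rule integrable_const_bound[where B = "(K * R)\<^sup>2"])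
    show "AE r in \<rho>. norm (indicator {0..} r *\<^sub>R \<bar>g r * r\<bar>\<^sup>2) \<le> (K * R)\<^sup>2"
      using kernel_times_id_bound[OF g] R
      by (intro AE_I2) (auto simp: indicator_def abs_le_square_iff[symmetric] intro: order_trans[OF _ abs_ge_self])
  qed measurable
qed

lemma kernel_rho_norm_le:
  assumes g: "g \<in> kernels R K"
  shows "(rho_norm \<rho> g)\<^sup>2 \<le> (K * R)\<^sup>2 * measure \<rho> (space \<rho>)"
proof -
  interpret finite_measure \<rho> by fact
  have "(rho_norm \<rho> g)\<^sup>2 \<le> (LINT r|\<rho>. (K * R)\<^sup>2)"
    unfolding rho_norm_squared set_lebesgue_integral_def
  proof (rule integral_mono)
    show "integrable \<rho> (\<lambda>r. indicator {0..} r *\<^sub>R \<bar>g r * r\<bar>\<^sup>2)"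
      using kernel_rho_norm_finite[OF g] by (simp add: rho_norm_finite_def set_integrable_def)
    show "indicator {0..} r *\<^sub>R \<bar>g r * r\<bar>\<^sup>2 \<le> (K * R)\<^sup>2" for r
      using kernel_times_id_bound[OF g, of r] R
      by (auto simp: indicator_def abs_le_square_iff[symmetric] intro: order_trans[OF _ abs_ge_self])
  qed simp
  then show ?thesis by (simp add: mult.commute)
qed

text \<open>Pointwise from \<open>(a + b)^2 \<le> 2 * a^2 + 2 * b^2\<close>. The sum is required on
  the half line only, because \<open>f\<close> is going to contain the true kernel itself while
  \<open>g\<close> and \<open>h\<close> are built with \<open>clip\<close>.\<close>

lemma rho_norm_triangle_squared:
  assumes g: "g \<in> kernels R K" and h: "h \<in> kernels R K'" and f: "\<And>r. r \<ge> 0 \<Longrightarrow> f r = g r + h r"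
  shows "(rho_norm \<rho> f)\<^sup>2 \<le> 2 * (rho_norm \<rho> g)\<^sup>2 + 2 * (rho_norm \<rho> h)\<^sup>2"
proof -
  interpret finite_measure \<rho> by fact
  have ig: "set_integrable \<rho> {0..} (\<lambda>r. 2 * \<bar>g r * r\<bar>\<^sup>2)" and ih: "set_integrable \<rho> {0..} (\<lambda>r. 2 * \<bar>h r * r\<bar>\<^sup>2)"
    using kernel_rho_norm_finite[OF g] kernel_rho_norm_finite[OF h] by (simp_all add: rho_norm_finite_def)
  have eq: "(LINT r:{0..}|\<rho>. \<bar>f r * r\<bar>\<^sup>2) = (LINT r:{0..}|\<rho>. \<bar>(g r - - h r) * r\<bar>\<^sup>2)"
    unfolding set_lebesgue_integral_def
    by (intro Bochner_Integration.integral_cong refl) (auto simp: indicator_def f)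
  have "(\<lambda>r. (-1) * h r) \<in> kernels R (\<bar>-1\<bar> * K')" by (rule kernels_scale[OF h])
  then have "(\<lambda>r. - h r) \<in> kernels R K'" by simp
  from kernel_rho_norm_finite[OF kernels_diff[OF g this]]
  have i: "set_integrable \<rho> {0..} (\<lambda>r. \<bar>(g r - - h r) * r\<bar>\<^sup>2)" by (simp add: rho_norm_finite_def)
  have "(rho_norm \<rho> f)\<^sup>2 \<le> (LINT r:{0..}|\<rho>. 2 * \<bar>g r * r\<bar>\<^sup>2 + 2 * \<bar>h r * r\<bar>\<^sup>2)"
    unfolding rho_norm_squared eq
  proof (intro set_integral_mono i set_integral_add(1) ig ih)
    fix r
    have "0 \<le> (g r * r - h r * r)\<^sup>2" by simp
    then show "\<bar>(g r - - h r) * r\<bar>\<^sup>2 \<le> 2 * \<bar>g r * r\<bar>\<^sup>2 + 2 * \<bar>h r * r\<bar>\<^sup>2"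
      by (simp add: power2_eq_square algebra_simps)
  qed
  also have "\<dots> = 2 * (rho_norm \<rho> g)\<^sup>2 + 2 * (rho_norm \<rho> h)\<^sup>2"
    unfolding rho_norm_squared by (simp only: set_integral_add(2)[OF ig ih] set_integral_mult_right)
  finally show ?thesis .
qed

end

section \<open>Consistency of the estimator\<close>

text \<open>The summand \<open>1 / (M + 1)\<close> in \<open>\<eta>\<close> lets a near-minimizer
  serve, so that it is not necessary to show that the infimum is attained.\<close>

lemma best_approximation:
  assumes L: "\<And>n. n \<ge> 1 \<Longrightarrow> finite_dim_subspace (L n) \<and> L n \<subseteq> C11 R"
    and nM: "\<And>M. M \<ge> 1 \<Longrightarrow> nM M \<ge> 1" and nM_top: "filterlim nM at_top sequentially"
    and \<phi>: "\<phi> \<in> admissible_kernels R S" and R: "R > 0"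
    and lim: "(\<lambda>n. INF \<psi>\<in>L n. sup_norm_on {0..} (\<lambda>r. \<psi> r - \<phi> r)) \<longlonglongrightarrow> 0"
  obtains \<psi> \<eta> where "\<eta> \<longlonglongrightarrow> 0" "\<And>M. M \<ge> 1 \<Longrightarrow> \<psi> M \<in> L (nM M)"
    "\<And>M. M \<ge> 1 \<Longrightarrow> (\<lambda>r. \<psi> M r - clip \<phi> r) \<in> kernels R (\<eta> M)"
proof -
  define I where "I n = (INF \<psi>\<in>L n. sup_norm_on {0..} (\<lambda>r. \<psi> r - \<phi> r))" for n
  define \<eta> where "\<eta> M = I (nM M) + inverse (real (Suc M))" for M
  note k = admissible_kernel(1)[OF \<phi> R]
  have "(\<lambda>M. I (nM M)) \<longlonglongrightarrow> 0" using filterlim_compose[OF lim nM_top] by (simp add: I_def)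
  from tendsto_add[OF this LIMSEQ_inverse_real_of_nat] have \<eta>: "\<eta> \<longlonglongrightarrow> 0" by (simp add: \<eta>_def[abs_def])
  have "\<exists>\<psi>. \<psi> \<in> L (nM M) \<and> (\<lambda>r. \<psi> r - clip \<phi> r) \<in> kernels R (\<eta> M)" if M: "M \<ge> 1" for M
  proof -
    have sub: "funspace.subspace (L (nM M))" and C: "L (nM M) \<subseteq> C11 R"
      using L[OF nM[OF M]] by (auto simp: finite_dim_subspace_def)
    have ne: "(\<lambda>\<psi>. sup_norm_on {0..} (\<lambda>r. \<psi> r - \<phi> r)) ` L (nM M) \<noteq> {}"
      using funspace.subspace_0[OF sub] by auto
    have "I (nM M) < \<eta> M" by (simp add: \<eta>_def)
    from cInf_lessD[OF ne this[unfolded I_def]] obtain \<psi> where \<psi>: "\<psi> \<in> L (nM M)"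
      and le: "sup_norm_on {0..} (\<lambda>r. \<psi> r - \<phi> r) < \<eta> M" by blast
    have \<psi>C: "\<psi> \<in> C11 R" using \<psi> C by blast
    obtain K where K: "\<psi> \<in> kernels R K" using C11_kernel[OF \<psi>C] .
    have "\<bar>\<psi> r - \<phi> r\<bar> \<le> K + S" if "r \<ge> 0" for r
      using kernelsD(2)[OF kernels_diff[OF K k], of r] that by (simp add: clip_def)
    then have "bdd_above ((\<lambda>r. \<bar>\<psi> r - \<phi> r\<bar>) ` {0..})" by (auto intro!: bdd_aboveI)
    from sup_norm_on_upper[OF this] have b: "\<bar>\<psi> r - \<phi> r\<bar> \<le> \<eta> M" if "r \<ge> 0" for r
      using le that by fastforce
    have "\<eta> M \<ge> 0" using b[of 0] by simp
    then have "\<bar>\<psi> r - clip \<phi> r\<bar> \<le> \<eta> M" for r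
      using b[of r] C11_outside[OF \<psi>C, of r] by (cases "r \<ge> 0") (auto simp: clip_def)
    then have "(\<lambda>r. \<psi> r - clip \<phi> r) \<in> kernels R (\<eta> M)"
      using kernels_diff[OF K k] by (simp add: kernels_def)
    then show ?thesis using \<psi> by blast
  qed
  then obtain \<psi> where "\<And>M. M \<ge> 1 \<Longrightarrow> \<psi> M \<in> L (nM M) \<and> (\<lambda>r. \<psi> M r - clip \<phi> r) \<in> kernels R (\<eta> M)" by metis
  then show ?thesis using that[OF \<eta>, of \<psi>] by blast
qed

text \<open>The null set of \<open>uniform_law\<close> depends on the tolerance, so only the
  countable family of tolerances \<open>1 / (j + 1)\<close> can be treated at once.\<close>

lemma tendsto_0_of_eventually_le:
  fixes f g :: "nat \<Rightarrow> real"
  assumes f0: "\<And>M. 0 \<le> f M" and g: "g \<longlonglongrightarrow> 0"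
    and le: "\<And>j::nat. \<forall>\<^sub>F M in sequentially. f M \<le> g M + C / real (Suc j)"
  shows "f \<longlonglongrightarrow> 0"
proof (rule order_tendstoI)
  fix a :: real assume "a < 0"
  then have "a < f M" for M using f0[of M] by linarith
  then show "\<forall>\<^sub>F M in sequentially. a < f M" by simp
next
  fix a :: real assume a: "0 < a"
  have "(\<lambda>j. C / real (Suc j)) \<longlonglongrightarrow> 0"
    using tendsto_mult[OF tendsto_const[of C] LIMSEQ_inverse_real_of_nat] by (simp add: divide_inverse)
  from order_tendstoD(2)[OF this, of "a / 2"] a obtain j where j: "C / real (Suc j) < a / 2"
    by (auto simp: eventually_sequentially)
  have "\<forall>\<^sub>F M in sequentially. g M < a / 2" using order_tendstoD(2)[OF g, of "a / 2"] a by simp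
  with le[of j] show "\<forall>\<^sub>F M in sequentially. f M < a"
    by eventually_elim (use j in linarith)
qed

theorem theorem3p1:
  fixes \<sigma> T R S S0 c c1 \<gamma> :: real
    and \<phi> :: "real \<Rightarrow> real"
    and P :: "'w measure" and Q :: "'v measure"
    and \<mu>0 :: "(real ^ 'd ^ 'n::{finite,linorder}) measure"
    and X B :: "real \<Rightarrow> 'w \<Rightarrow> real ^ 'd ^ 'n::{finite,linorder}"
    and Xs :: "nat \<Rightarrow> real \<Rightarrow> 'v \<Rightarrow> real ^ 'd ^ 'n::{finite,linorder}"
    and J :: "nat \<Rightarrow> (real \<Rightarrow> real) \<Rightarrow> 'v \<Rightarrow> real"
    and L :: "nat \<Rightarrow> (real \<Rightarrow> real) set"
    and nM :: "nat \<Rightarrow> nat"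
    and \<phi>hat :: "nat \<Rightarrow> 'v \<Rightarrow> real \<Rightarrow> real"
  assumes "CARD('n) \<ge> 2" and "\<sigma> > 0" and "T > 0" and "R > 0" and "S > 0"
    and "\<phi> \<in> admissible_kernels R S"
    and "observed_system P \<phi> \<sigma> T \<mu>0 X B"
    and "iid_copies P T X Q Xs"
    and "\<And>n. n \<ge> 1 \<Longrightarrow> finite_dim_subspace (L n) \<and> L n \<subseteq> C11 R"
    and "c1 > 0" and "\<gamma> > 0"
    and "\<And>n \<psi>. n \<ge> 1 \<Longrightarrow> \<psi> \<in> L n \<Longrightarrow>
           sup_norm_on {0..R} (deriv_on {0..R} \<psi>)
             \<le> c1 * real (funspace.dim (L n)) powr \<gamma> * sup_norm_on {0..R} \<psi>"
    and "(\<lambda>n. INF \<psi>\<in>L n. sup_norm_on {0..} (\<lambda>r. \<psi> r - \<phi> r)) \<longlonglongrightarrow> 0"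
    and "S0 \<ge> S"
    and "\<And>M. M \<ge> 1 \<Longrightarrow> nM M \<ge> 1 \<and> funspace.dim (L (nM M)) = nM M"
    and "filterlim nM at_top sequentially"
    and "(\<lambda>M. real (nM M) * ln (real (nM M)) / real M) \<longlonglongrightarrow> 0"
    and "coercive P \<sigma> T X (\<Union>n\<in>{1..}. L n) c"
    and "\<And>m n. n \<ge> 1 \<Longrightarrow> interaction_integrals Q T (Xs m) (L n) (J m)"
    and "AE \<omega> in Q. \<forall>M\<ge>1. \<phi>hat M \<omega> \<in> hypothesis_space L nM S0 M \<and>
           (\<forall>\<psi>\<in>hypothesis_space L nM S0 M.
              empirical_error \<sigma> T Xs J M (\<phi>hat M \<omega>) \<omega> \<le> empirical_error \<sigma> T Xs J M \<psi> \<omega>)"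
  shows "AE \<omega> in Q. (\<lambda>M. rho_norm (rho P T X) (\<lambda>r. \<phi>hat M \<omega> r - \<phi> r)) \<longlonglongrightarrow> 0"
proof -
  note \<sigma> = assms(2) and T = assms(3) and R = assms(4) and S = assms(5) and \<phi> = assms(6) and sys = assms(7)
    and copies = assms(8) and L = assms(9) and dense = assms(13) and S0 = assms(14) and nM = assms(15)
    and nM_top = assms(16) and nM_rate = assms(17) and coer = assms(18) and J = assms(19) and min = assms(20)
  define b where "b = (interaction \<phi> :: real ^ 'd ^ ('n::{finite,linorder}) \<Rightarrow> _)"
  define f where "f = clip \<phi>"
  have bf: "b = interaction f" by (simp add: b_def f_def interaction_clip)
  have fk: "f \<in> kernels R S" unfolding f_def by (rule admissible_kernel(1)[OF \<phi> R])
  define Lb where "Lb = 2 * real CARD('n) * (S * (1 + R))"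
  have Lb: "norm (b x - b y) \<le> Lb * norm (x - y)" for x y
    unfolding b_def Lb_def by (rule interaction_lipschitz[OF \<phi> R])
  have Lb0: "Lb \<ge> 0" using S R by (simp add: Lb_def)
  have "Lb-lipschitz_on UNIV b" using Lb Lb0 by (intro lipschitz_onI) (auto simp: dist_norm)
  then have b_cont: "continuous_on UNIV b" by (rule lipschitz_on_continuous_on)
  have b_bound: "norm (b x) \<le> real CARD('n) * (S * R)" for x
    unfolding bf using interaction_norm_bound[OF fk] R by simp
  have P: "prob_space P" and X: "continuous_process P T X" and Bm: "brownian_motion P T B"
    using sys by (auto simp: observed_system_def)
  have gX: "gaussian_noise P T b \<sigma> X"
    by (rule solution_gaussian_noise[OF P X Bm _ _ Lb Lb0]) (use sys in \<open>auto simp: observed_system_def b_def\<close>)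
  have Q: "prob_space Q" and Xs: "\<And>m. continuous_process Q T (Xs m)"
    and ind: "prob_space.indep_vars Q (\<lambda>_. path_space T) (\<lambda>m. trajectory T (Xs m)) UNIV"
    and law: "\<And>m. distr Q (path_space T) (trajectory T (Xs m)) = distr P (path_space T) (trajectory T X)"
    using copies by (auto simp: iid_copies_def)
  interpret Q: prob_space Q by (rule Q)
  interpret P: prob_space P by (rule P)
  \<comment> \<open>Defined through \<open>X\<close> under \<open>P\<close>, as in the coercivity
    condition; equality of laws identifies it with the mean energy of each copy under
    \<open>Q\<close>.\<close>
  define \<mu> where "\<mu> h = (LBINT t:{0..T}. (LINT \<omega>|P. (norm (interaction h (X t \<omega>)))\<^sup>2))" for h
  interpret particle_system Q T \<sigma> "real CARD('n) * (S * R)" b Xs R \<mu>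
  proof unfold_locales
    show "gaussian_noise Q T b \<sigma> (Xs m)" for m
      by (rule gaussian_noise_transfer[OF gX b_cont X Xs law])
    fix h K m assume h: "h \<in> kernels R K"
    note [measurable] = borel_measurable_interaction[OF kernelsD(1)[OF h]]
    have m: "(\<lambda>x. (norm (interaction h x))\<^sup>2) \<in> borel_measurable (borel :: (real ^ 'd ^ ('n::{finite,linorder})) measure)" by measurable
    have bd: "\<bar>(norm (interaction h x))\<^sup>2\<bar> \<le> real CARD('n) * (K * R)\<^sup>2" for x :: "real ^ 'd ^ ('n::{finite,linorder})"
      using interaction_norm_squared_bound[OF h, of x] R by simp
    have "Q.expectation (energy T (interaction h) (Xs m)) = (LBINT t:{0..T}. (LINT \<omega>|Q. (norm (interaction h (Xs m t \<omega>)))\<^sup>2))"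
      unfolding energy_def[abs_def] by (rule Q.expectation_time_integral[OF Xs T m bd])
    also have "\<dots> = \<mu> h"
      unfolding \<mu>_def by (intro set_lebesgue_integral_cong) (auto intro!: law_at_time[OF X Xs _ law m])
    finally show "Q.expectation (energy T (interaction h) (Xs m)) = \<mu> h" .
  qed (use \<sigma> T R Xs ind b_cont b_bound in auto)
  have fin: "finite_measure (rho P T X)" by (rule finite_measure_rho[OF P X T])
  have setsr: "sets (rho P T X) = sets borel" by simp
  define k where "k = 1 / (2 * \<sigma>\<^sup>2 * real CARD('n) * T)"
  have k: "k > 0" using \<sigma> T by (simp add: k_def)
  have c: "c > 0" using coer by (simp add: coercive_def)
  \<comment> \<open>Summing the squared components inside the expectation turns the right-hand side
    of the coercivity condition into \<open>\<mu>\<close>; boundedness supplies the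
    integrability.\<close>
  have coercive: "c * (rho_norm (rho P T X) h)\<^sup>2 \<le> k * \<mu> h" if h: "h \<in> kernels R K" "h \<in> L n" "n \<ge> 1" for h K n
  proof -
    note [measurable] = borel_measurable_interaction[OF kernelsD(1)[OF h(1)]]
    have "(\<Sum>i\<in>UNIV. LINT \<omega>|P. (norm (interaction h (X t \<omega>) $ i))\<^sup>2) = (LINT \<omega>|P. (norm (interaction h (X t \<omega>)))\<^sup>2)"
      if t: "t \<in> {0..T}" for t
    proof -
      have [measurable]: "X t \<in> borel_measurable P" using X t by (simp add: continuous_process_def)
      have "integrable P (\<lambda>\<omega>. (norm (interaction h (X t \<omega>) $ i))\<^sup>2)" for i
        using interaction_nth_bound[OF h(1)] R
        by (intro P.integrable_const_bound[where B = "(K * R)\<^sup>2"]) (auto intro!: AE_I2 power_mono)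
      then show ?thesis unfolding norm_vec_squared by (intro Bochner_Integration.integral_sum[symmetric])
    qed
    then have "(LBINT t:{0..T}. \<Sum>i\<in>UNIV. LINT \<omega>|P. (norm (interaction h (X t \<omega>) $ i))\<^sup>2) = \<mu> h"
      unfolding \<mu>_def by (intro set_lebesgue_integral_cong) auto
    moreover have "h \<in> (\<Union>n\<in>{1..}. L n)" using h by auto
    ultimately show ?thesis
      using coer kernel_rho_norm_finite[OF fin setsr R h(1)] unfolding coercive_def k_def by fastforce
  qed
  have nM1: "nM M \<ge> 1" if "M \<ge> 1" for M using nM[OF that] by simp
  obtain \<psi> \<eta> where \<eta>: "\<eta> \<longlonglongrightarrow> 0" and \<psi>L: "\<And>M. M \<ge> 1 \<Longrightarrow> \<psi> M \<in> L (nM M)"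
    and \<psi>f: "\<And>M. M \<ge> 1 \<Longrightarrow> (\<lambda>r. \<psi> M r - f r) \<in> kernels R (\<eta> M)"
    by (rule best_approximation[OF _ _ nM_top \<phi> R dense, folded f_def]) (erule L, erule nM1, rule that)
  \<comment> \<open>The difference of two elements of the ball of radius
    \<open>2 * S0\<close>.\<close>
  define K where "K = 2 * S0 + 2 * S0"
  have K: "K > 0" using S S0 by (simp add: K_def)
  note lim = dim_sample_ratio_tendsto_0[OF nM_top nM_rate]
  have "AE \<omega> in Q. \<forall>j::nat. \<forall>\<^sub>F M in sequentially. \<forall>h\<in>L (nM M). h \<in> kernels R K \<longrightarrow>
    real M * \<mu> h \<le> (\<Sum>m<M. En h m \<omega>) + real M * (1 / real (Suc j)) \<and>
    (\<Sum>m<M. J m h \<omega> - Dr h m \<omega>) \<le> real M * (1 / real (Suc j))"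
    unfolding AE_all_countable
    by (intro allI uniform_law[OF L nM lim J K]) simp_all
  moreover have "AE \<omega> in Q. \<forall>m. \<forall>n. n \<ge> 1 \<longrightarrow> (\<forall>f\<in>L n. \<forall>g\<in>L n. \<forall>a c.
      J m (\<lambda>r. a * f r + c * g r) \<omega> = a * J m f \<omega> + c * J m g \<omega>)"
    using J unfolding AE_all_countable interaction_integrals_def by auto
  ultimately show ?thesis
    using min AE_space
  proof eventually_elim
    case (elim \<omega>)
    \<comment> \<open>The quotient \<open>k / c\<close> comes from coercivity, the 2 from
      \<open>rho_norm_triangle_squared\<close>.\<close>
    define C where "C = 2 / c * k"
    define N where "N M = rho_norm (rho P T X) (\<lambda>r. \<phi>hat M \<omega> r - \<phi> r)" for M
    \<comment> \<open>All contributions of the approximation error \<open>\<eta> M\<close>, which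
      vanish in the limit.\<close>
    define g where "g M = C * (4 * max_energy (\<eta> M)) + 2 * ((\<eta> M * R)\<^sup>2 * measure (rho P T X) (space (rho P T X)))" for M
    have C: "C > 0" using c k by (simp add: C_def)
    have "(\<lambda>M. (N M)\<^sup>2) \<longlonglongrightarrow> 0"
    proof (rule tendsto_0_of_eventually_le)
      have "g \<longlonglongrightarrow> C * (4 * (T * (real CARD('n) * (0 * R)\<^sup>2))) + 2 * ((0 * R)\<^sup>2 * measure (rho P T X) (space (rho P T X)))"
        unfolding g_def[abs_def] max_energy_def by (intro tendsto_intros \<eta>)
      then show "g \<longlonglongrightarrow> 0" by simp
      fix j :: nat
      define \<epsilon> where "\<epsilon> = 1 / real (Suc j)"
      have "\<forall>\<^sub>F M in sequentially. \<eta> M < S" using order_tendstoD(2)[OF \<eta>, of S] S by simp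
      with spec[OF elim(1), of j] eventually_ge_at_top[of 1]
      show "\<forall>\<^sub>F M in sequentially. (N M)\<^sup>2 \<le> g M + C * 5 / real (Suc j)"
      proof eventually_elim
        case (elim M)
        have M: "M \<ge> 1" "M > 0" using elim(2) by auto
        have n: "nM M \<ge> 1" using nM[OF M(1)] by simp
        have sub: "funspace.subspace (L (nM M))" and LC: "L (nM M) \<subseteq> C11 R"
          using L[OF n] by (auto simp: finite_dim_subspace_def)
        let ?p = "\<phi>hat M \<omega>"
        let ?h = "\<lambda>r. ?p r - \<psi> M r"
        have hyp: "?p \<in> hypothesis_space L nM S0 M"
          and opt: "\<And>u. u \<in> hypothesis_space L nM S0 M \<Longrightarrow> empirical_error \<sigma> T Xs J M ?p \<omega> \<le> empirical_error \<sigma> T Xs J M u \<omega>"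
          using \<open>\<forall>M\<ge>1. \<phi>hat M \<omega> \<in> hypothesis_space L nM S0 M \<and> _\<close> M(1) by auto
        have pL: "?p \<in> L (nM M)" and psup: "sup_norm_on {0..} ?p \<le> 2 * S0"
          using hyp by (auto simp: hypothesis_space_def)
        have pk: "?p \<in> kernels R (2 * S0)" using C11_sup_norm_kernel[OF _ psup] pL LC by blast
        \<comment> \<open>As soon as \<open>\<eta> M < S\<close>, the approximant is bounded by
          \<open>2 * S\<close>, hence by \<open>2 * S0\<close>, and so competes with the estimator;
          the radius of the hypothesis space leaves exactly this room.\<close>
        have \<psi>bd: "\<bar>\<psi> M r\<bar> \<le> 2 * S0" for r
          using kernelsD(2)[OF \<psi>f[OF M(1)], of r] kernelsD(2)[OF fk, of r] elim(3) S0 by linarith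
        have \<psi>h: "\<psi> M \<in> hypothesis_space L nM S0 M"
          using \<psi>L[OF M(1)] \<psi>bd unfolding hypothesis_space_def by (auto intro!: sup_norm_on_least)
        have \<psi>k: "\<psi> M \<in> kernels R (2 * S0)"
          using C11_kernelI[of "\<psi> M" R "2 * S0"] \<psi>L[OF M(1)] LC \<psi>bd by blast
        have hk: "?h \<in> kernels R K" unfolding K_def by (rule kernels_diff[OF pk \<psi>k])
        have hL: "?h \<in> L (nM M)" by (rule funspace_diff[OF sub pL \<psi>L[OF M(1)]])
        have law1: "real M * \<mu> ?h \<le> (\<Sum>m<M. En ?h m \<omega>) + real M * \<epsilon>"
          and law2: "(\<Sum>m<M. J m ?h \<omega> - Dr ?h m \<omega>) \<le> real M * \<epsilon>"
          using elim(1) hL hk unfolding \<epsilon>_def by auto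
        have lin: "J m (\<lambda>r. 1 * ?p r + (-1) * \<psi> M r) \<omega> = 1 * J m ?p \<omega> + (-1) * J m (\<psi> M) \<omega>" for m
          using \<open>\<forall>m n. 1 \<le> n \<longrightarrow> _\<close> n pL \<psi>L[OF M(1)] by blast
        have "(\<Sum>m<M. En ?h m \<omega>) \<le> 4 * (\<Sum>m<M. En (\<lambda>r. \<psi> M r - f r) m \<omega>) + 4 * (\<Sum>m<M. J m ?h \<omega> - Dr ?h m \<omega>)"
          using \<open>\<omega> \<in> space Q\<close> by (intro minimizer_energy[OF bf fk pk \<psi>k _ lin opt[OF \<psi>h] M(2)])
        also have "(\<Sum>m<M. En (\<lambda>r. \<psi> M r - f r) m \<omega>) \<le> (\<Sum>m<M. max_energy (\<eta> M))"
          by (intro sum_mono En_bound[OF \<psi>f[OF M(1)]])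
        \<comment> \<open>The noise contributes \<open>4 * \<epsilon>\<close> by
          \<open>law2\<close>, the replacement of the mean by the empirical energy one more
          \<open>\<epsilon>\<close> by \<open>law1\<close>.\<close>
        finally have "real M * \<mu> ?h \<le> real M * (4 * max_energy (\<eta> M) + 5 * \<epsilon>)"
          using law1 law2 by (simp add: algebra_simps)
        then have \<mu>h: "\<mu> ?h \<le> 4 * max_energy (\<eta> M) + 5 * \<epsilon>" using M by simp
        have "c * (rho_norm (rho P T X) ?h)\<^sup>2 \<le> k * \<mu> ?h" by (rule coercive[OF hk hL n])
        also have "\<dots> \<le> k * (4 * max_energy (\<eta> M) + 5 * \<epsilon>)" using \<mu>h k by (intro mult_left_mono) auto
        finally have "(rho_norm (rho P T X) ?h)\<^sup>2 \<le> k * (4 * max_energy (\<eta> M) + 5 * \<epsilon>) / c"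
          using c by (simp add: pos_le_divide_eq mult.commute)
        then have r1: "2 * (rho_norm (rho P T X) ?h)\<^sup>2 \<le> C * (4 * max_energy (\<eta> M) + 5 * \<epsilon>)"
          by (simp add: C_def)
        have "(N M)\<^sup>2 \<le> 2 * (rho_norm (rho P T X) ?h)\<^sup>2 + 2 * (rho_norm (rho P T X) (\<lambda>r. \<psi> M r - f r))\<^sup>2"
          unfolding N_def by (rule rho_norm_triangle_squared[OF fin setsr R hk \<psi>f[OF M(1)]]) (simp add: f_def clip_def)
        also have "\<dots> \<le> C * (4 * max_energy (\<eta> M) + 5 * \<epsilon>) + 2 * ((\<eta> M * R)\<^sup>2 * measure (rho P T X) (space (rho P T X)))"
          using r1 kernel_rho_norm_le[OF fin setsr R \<psi>f[OF M(1)]] by linarith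
        also have "\<dots> = g M + C * 5 / real (Suc j)"
          by (simp add: g_def \<epsilon>_def distrib_left)
        finally show ?case .
      qed
    qed simp
    from tendsto_real_sqrt[OF this] show ?case
      by (simp add: N_def tendsto_rabs_zero_iff)
  qed
qed

end
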